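(* Let $\mathcal{SV}$ be the Schrödinger-Virasoro conformal algebra and let $\mathbb{C}$ be its one-dimensional trivial module (with $\partial$ acting as $0$). For $q\in\mathbb{Z}_+$, the dimension over $\mathbb{C}$ of the reduced cohomology group $H^q(\mathcal{SV},\mathbb{C})$ is $$\dim H^q(\mathcal{SV},\mathbb{C})=\begin{cases}1 & \text{if } q=0,2,3,\\ 2 & \text{if } q=4,6,\\ 4 & \text{if } q=5,\\ 0 & \text{otherwise.}\end{cases}$$
   Context: All vector spaces and tensor products are over $\mathbb{C}$; $\mathbb{Z}_+$ is the set of nonnegative integers. A Lie conformal algebra $\mathcal{A}$ is a $\mathbb{C}[\partial]$-module with a $\mathbb{C}$-bilinear map $\mathcal{A}\otimes\mathcal{A}\to\mathbb{C}[\lambda]\otimes\mathcal{A}$, $a\otimes b\mapsto[a_\lambda b]$, such that for all $a,b,c\in\mathcal{A}$: $[(\partial a)_\lambda b]=-\lambda[a_\lambda b]$, $[a_\lambda(\partial b)]=(\partial+\lambda)[a_\lambda b]$, $[a_\lambda b]=-[b_{-\lambda-\partial}a]$, and $[a_\lambda[b_\mu c]]=[[a_\lambda b]_{\lambda+\mu}c]+[b_\mu[a_\lambda c]]$. The Schrödinger-Virasoro conformal algebra is $\mathcal{SV}=\mathbb{C}[\partial]L\oplus\mathbb{C}[\partial]M\oplus\mathbb{C}[\partial]Y$ (free $\mathbb{C}[\partial]$-module of rank 3) with nontrivial $\lambda$-brackets of generators $$[L_\lambda L]=(\partial+2\lambda)L,\quad [L_\lambda Y]=(\partial+\tfrac32\lambda)Y,\quad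 [Y_\lambda L]=(\tfrac12\partial+\tfrac32\lambda)Y,$$ $$[Y_\lambda Y]=(\partial+2\lambda)M,\quad [L_\lambda M]=(\partial+\lambda)M,\quad [M_\lambda L]=\lambda M,$$ all other $\lambda$-brackets of generators being zero. The trivial module $\mathbb{C}$ is the one-dimensional vector space $\mathbb{C}$ with $\partial v=0$ and $a_\lambda v=0$ for all $a\in\mathcal{SV}$, $v\in\mathbb{C}$. Basic complex with coefficients in $\mathbb{C}$. For $n\in\mathbb{Z}_+$, $\tilde C^n(\mathcal{A},\mathbb{C})$ is the space of $n$-cochains: $\mathbb{C}$-linear maps $\gamma:\mathcal{A}^{\otimes n}\to\mathbb{C}[\lambda_1,\ldots,\lambda_n]$, $a_1\otimes\cdots\otimes a_n\mapsto\gamma_{\lambda_1,\ldots,\lambda_n}(a_1,\ldots,a_n)$, such that (1) $\gamma_{\lambda_1,\ldots,\lambda_n}(a_1,\ldots,\partial a_i,\ldots,a_n)=-\lambda_i\gamma_{\lambda_1,\ldots,\lambda_n}(a_1,\ldots,a_n)$ for each $i$; (2) $\gamma$ is skew-symmetric under simultaneous permutations of the $a_i$'s and $\lambda_i$'s. In particular $\tilde C^0(\mathcal{A},\mathbb{C})=\mathbb{C}$. The differential $d=d_n:\tilde C^n\to\tilde C^{n+1}$ is $$(d\gamma)_{\lambda_1,\ldots,\lambda_{n+1}}(a_1,\ldots,a_{n+1})=\sum_{1\le i<j\le n+1}(-1)^{i+j}\gamma_{\lambda_i+\lambda_j,\lambda_1,\ldots,\widehat{\lambda_i},\ldots,\widehat{\lambda_j},\ldots,\lambda_{n+1}}([{a_i}_{\lambda_i}a_j],a_1,\ldots,\widehat{a_i},\ldots,\widehat{a_j},\ldots,a_{n+1}),$$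 where $\gamma$ is extended linearly over polynomials in the $\lambda_i$ (hats denote omission; $d_0=0$); $d^2=0$. Reduced cohomology. Let $\partial$ act on $\tilde C^n(\mathcal{A},\mathbb{C})$ by $(\partial\gamma)_{\lambda_1,\ldots,\lambda_n}(a_1,\ldots,a_n)=\big(\sum_{i=1}^n\lambda_i\big)\gamma_{\lambda_1,\ldots,\lambda_n}(a_1,\ldots,a_n)$ (so $\partial=0$ on $\tilde C^0$). Then $d\partial=\partial d$, so $\partial\tilde C^\bullet$ is a subcomplex of $\tilde C^\bullet$. The reduced complex is the quotient complex $\tilde C^\bullet/\partial\tilde C^\bullet$ with the induced differential, and $H^q(\mathcal{A},\mathbb{C})$ is its $q$-th cohomology. *)

theory Defs
  imports
    "HOL-Library.Poly_Mapping"
    "HOL-Library.Function_Algebras"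
    "HOL-Computational_Algebra.Polynomial"
    "HOL-Combinatorics.Permutations"
    "HOL-Algebra.AbelCoset"
    "Jordan_Normal_Form.VS_Connect"
begin

section \<open>Polynomials in several variables\<close>

text \<open>The ring \<open>\<complex>[\<lambda>\<^sub>0, \<lambda>\<^sub>1, \<dots>]\<close> as the monoid algebra of the finitely supported exponent
  vectors; \<open>\<complex>[\<lambda>\<^sub>0, \<dots>, \<lambda>\<^sub>n\<^sub>-\<^sub>1]\<close> consists of the \<open>p\<close> with \<open>mp_vars p \<subseteq> {..<n}\<close>.
  All indices start at 0 here.\<close>

type_synonym mpol = "(nat \<Rightarrow>\<^sub>0 nat) \<Rightarrow>\<^sub>0 complex"

definition mp_const :: "complex \<Rightarrow> mpol" where
  "mp_const c = Poly_Mapping.single 0 c"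

definition lam :: "nat \<Rightarrow> mpol" where
  "lam i = Poly_Mapping.single (Poly_Mapping.single i 1) 1"

definition mp_vars :: "mpol \<Rightarrow> nat set" where
  "mp_vars p = (\<Union>m\<in>Poly_Mapping.keys p. Poly_Mapping.keys m)"

text \<open>\<open>mp_subst \<sigma> p\<close> substitutes \<open>\<sigma> i\<close> for \<open>\<lambda>\<^sub>i\<close> in \<open>p\<close>.\<close>

definition mp_subst :: "(nat \<Rightarrow> mpol) \<Rightarrow> mpol \<Rightarrow> mpol" where
  "mp_subst \<sigma> p = (\<Sum>m\<in>Poly_Mapping.keys p. mp_const (Poly_Mapping.lookup p m) *
      (\<Prod>i\<in>Poly_Mapping.keys m. \<sigma> i ^ Poly_Mapping.lookup m i))"

section \<open>Lie conformal algebras\<close>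

text \<open>An element \<open>\<Sum>\<^sub>k \<lambda>\<^sup>k x\<^sub>k\<close> of \<open>\<complex>[\<lambda>] \<otimes> A\<close> is represented by the polynomial with
  coefficients \<open>x\<^sub>k\<close> of type \<^typ>\<open>'a poly\<close>, so that \<^term>\<open>pCons 0\<close> is multiplication by
  \<open>\<lambda>\<close>. Replacing \<open>\<lambda>\<close> by an operator \<open>T\<close>, and each coefficient \<open>x\<^sub>k\<close> by
  \<open>f x\<^sub>k\<close>, yields \<open>poly_op T f\<close> of it, i.e. \<open>\<Sum>\<^sub>k T\<^sup>k (f x\<^sub>k)\<close>.\<close>

definition poly_op :: "('b \<Rightarrow> 'b) \<Rightarrow> ('a::zero \<Rightarrow> 'b::comm_monoid_add) \<Rightarrow> 'a poly \<Rightarrow> 'b" where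
  "poly_op T f P = (\<Sum>k\<le>degree P. (T ^^ k) (f (coeff P k)))"

text \<open>The Jacobi identity lives in \<open>\<complex>[\<lambda>,\<mu>] \<otimes> A\<close>, represented by \<^typ>\<open>'a poly poly\<close> with
  outer variable \<open>\<mu>\<close> and inner variable \<open>\<lambda>\<close>: there \<open>\<mu>\<close> acts as \<^term>\<open>pCons 0\<close>
  and \<open>\<lambda>\<close> as \<^term>\<open>map_poly (pCons 0)\<close>.\<close>

locale lie_conformal_algebra =
  vector_space scl
  for scl :: "complex \<Rightarrow> 'a::ab_group_add \<Rightarrow> 'a" +
  fixes D :: "'a \<Rightarrow> 'a"
    and br :: "'a \<Rightarrow> 'a \<Rightarrow> 'a poly"
  assumes D_linear: "Vector_Spaces.linear scl scl D"
    and br_add_left: "br (a + a') b = br a b + br a' b"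
    and br_add_right: "br a (b + b') = br a b + br a b'"
    and br_scl_left: "br (scl r a) b = map_poly (scl r) (br a b)"
    and br_scl_right: "br a (scl r b) = map_poly (scl r) (br a b)"
    and br_D_left: "br (D a) b = - pCons 0 (br a b)"
    and br_D_right: "br a (D b) = map_poly D (br a b) + pCons 0 (br a b)"
    and skew_symmetry:
      "br a b = - poly_op (\<lambda>Q. - pCons 0 Q - map_poly D Q) (\<lambda>x. [:x:]) (br b a)"
    and jacobi:
      "poly_op (pCons 0) (\<lambda>x. [:br a x:]) (br b c) =
         poly_op (map_poly (pCons 0))
           (\<lambda>x. poly_op (\<lambda>Q. map_poly (pCons 0) Q + pCons 0 Q) (\<lambda>y. [:[:y:]:]) (br x c)) (br a b) +
         poly_op (map_poly (pCons 0)) (\<lambda>x. map_poly (\<lambda>y. [:y:]) (br b x)) (br a c)"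

section \<open>Quotient modules\<close>

text \<open>The multiplication and unit of the underlying ring record play no role in a module.\<close>

definition quot_module :: "('k, 'v) module \<Rightarrow> 'v set \<Rightarrow> ('k, 'v set) module" where
  "quot_module V W =
    \<lparr>carrier = a_rcosets\<^bsub>V\<^esub> W, mult = (\<lambda>_ _. W), one = W, zero = W, add = set_add V,
     smult = (\<lambda>c X. \<Union>x\<in>X. W +>\<^bsub>V\<^esub> (c \<odot>\<^bsub>V\<^esub> x))\<rparr>"

section \<open>Cohomology with trivial coefficients\<close>

text \<open>A linear map on \<open>A\<^sup>\<otimes>\<^sup>n\<close> is given by a multilinear function of lists of length \<open>n\<close>; it is set
  to 0 on all other lists, so that equality of cochains is equality of functions.
  \<open>cochain_at \<gamma> ps as\<close> is \<open>\<gamma>\<close> with subscripts \<open>ps\<close>, evaluated at \<open>as\<close>.\<close>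

type_synonym 'a cochain = "'a list \<Rightarrow> mpol"

definition cochain_at :: "'a cochain \<Rightarrow> mpol list \<Rightarrow> 'a list \<Rightarrow> mpol" where
  "cochain_at \<gamma> ps as = mp_subst (\<lambda>k. ps ! k) (\<gamma> as)"

definition cochain_D :: "'a cochain \<Rightarrow> 'a cochain" where
  "cochain_D \<gamma> = (\<lambda>as. (\<Sum>i<length as. lam i) * \<gamma> as)"

context lie_conformal_algebra
begin

definition is_cochain :: "nat \<Rightarrow> 'a cochain \<Rightarrow> bool" where
  "is_cochain n \<gamma> \<longleftrightarrow>
     (\<forall>as. length as \<noteq> n \<longrightarrow> \<gamma> as = 0) \<and>
     (\<forall>as. length as = n \<longrightarrow>
        mp_vars (\<gamma> as) \<subseteq> {..<n} \<and>
        (\<forall>i<n. \<forall>x y c.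
           \<gamma> (as[i := x + y]) = \<gamma> (as[i := x]) + \<gamma> (as[i := y]) \<and>
           \<gamma> (as[i := scl c x]) = mp_const c * \<gamma> (as[i := x])) \<and>
        (\<forall>i<n. \<gamma> (as[i := D (as ! i)]) = - lam i * \<gamma> as) \<and>
        (\<forall>\<pi>. \<pi> permutes {..<n} \<longrightarrow>
           cochain_at \<gamma> (permute_list \<pi> (map lam [0..<n])) (permute_list \<pi> as) =
             of_int (sign \<pi>) * \<gamma> as))"

definition cochains :: "nat \<Rightarrow> (complex, 'a cochain) module" where
  "cochains n =
    \<lparr>carrier = {\<gamma>. is_cochain n \<gamma>}, mult = (\<lambda>_ _. 0), one = 0, zero = 0, add = (+),
     smult = (\<lambda>c \<gamma> as. mp_const c * \<gamma> as)\<rparr>"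

definition differential :: "'a cochain \<Rightarrow> 'a cochain" where
  "differential \<gamma> = (\<lambda>as. \<Sum>j<length as. \<Sum>i<j. (- 1) ^ (i + j) *
     poly_op (\<lambda>p. lam i * p)
       (\<lambda>x. cochain_at \<gamma>
          ((lam i + lam j) # nths (map lam [0..<length as]) (- {i, j}))
          (x # nths as (- {i, j})))
       (br (as ! i) (as ! j)))"

definition D_cochains :: "nat \<Rightarrow> 'a cochain set" where
  "D_cochains n = cochain_D ` carrier (cochains n)"

definition reduced_cochains :: "nat \<Rightarrow> (complex, 'a cochain set) module" where
  "reduced_cochains n = quot_module (cochains n) (D_cochains n)"

text \<open>The union over representatives is a single coset because \<open>d\<close> commutes with \<open>\<partial>\<close>.\<close>

definition reduced_differential :: "nat \<Rightarrow> 'a cochain set \<Rightarrow> 'a cochain set" where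
  "reduced_differential n X =
     (\<Union>\<gamma>\<in>X. D_cochains (Suc n) +>\<^bsub>cochains (Suc n)\<^esub> differential \<gamma>)"

definition reduced_cocycles :: "nat \<Rightarrow> 'a cochain set set" where
  "reduced_cocycles n =
     {X \<in> carrier (reduced_cochains n). reduced_differential n X = \<zero>\<^bsub>reduced_cochains (Suc n)\<^esub>}"

fun reduced_coboundaries :: "nat \<Rightarrow> 'a cochain set set" where
  "reduced_coboundaries 0 = {\<zero>\<^bsub>reduced_cochains 0\<^esub>}"
| "reduced_coboundaries (Suc n) = reduced_differential n ` carrier (reduced_cochains n)"

definition reduced_cohomology :: "nat \<Rightarrow> (complex, 'a cochain set set) module" where
  "reduced_cohomology n =
     quot_module ((reduced_cochains n)\<lparr>carrier := reduced_cocycles n\<rparr>) (reduced_coboundaries n)"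

end

section \<open>The Schroedinger-Virasoro conformal algebra\<close>

datatype sv_gen = SV_L | SV_M | SV_Y

text \<open>Functions from the three generators to \<open>\<complex>[\<partial>]\<close>.\<close>

type_synonym sv = "sv_gen \<Rightarrow> complex poly"

definition sv_scl :: "complex \<Rightarrow> sv \<Rightarrow> sv" where
  "sv_scl c a = (\<lambda>x. Polynomial.smult c (a x))"

definition sv_D :: "sv \<Rightarrow> sv" where
  "sv_D a = (\<lambda>x. [:0, 1:] * a x)"

definition sv_elt :: "sv_gen \<Rightarrow> sv" where
  "sv_elt x = (\<lambda>y. if y = x then 1 else 0)"

text \<open>A bracket \<open>[:u, v:]\<close> is \<open>u + \<lambda> v\<close>.\<close>

fun sv_gen_br :: "sv_gen \<Rightarrow> sv_gen \<Rightarrow> sv poly" where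
  "sv_gen_br SV_L SV_L = [:sv_D (sv_elt SV_L), sv_scl 2 (sv_elt SV_L):]"
| "sv_gen_br SV_L SV_Y = [:sv_D (sv_elt SV_Y), sv_scl (3/2) (sv_elt SV_Y):]"
| "sv_gen_br SV_Y SV_L = [:sv_scl (1/2) (sv_D (sv_elt SV_Y)), sv_scl (3/2) (sv_elt SV_Y):]"
| "sv_gen_br SV_Y SV_Y = [:sv_D (sv_elt SV_M), sv_scl 2 (sv_elt SV_M):]"
| "sv_gen_br SV_L SV_M = [:sv_D (sv_elt SV_M), sv_elt SV_M:]"
| "sv_gen_br SV_M SV_L = [:0, sv_elt SV_M:]"
| "sv_gen_br _ _ = 0"

text \<open>The extension of the brackets of generators forced by sesquilinearity:
  \<open>[f(\<partial>)x \<^bsub>\<lambda>\<^esub> g(\<partial>)y] = f(-\<lambda>) g(\<partial>+\<lambda>) [x \<^bsub>\<lambda>\<^esub> y]\<close>.\<close>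

definition sv_br :: "sv \<Rightarrow> sv \<Rightarrow> sv poly" where
  "sv_br a b = (\<Sum>x\<in>UNIV. \<Sum>y\<in>UNIV.
     poly_op (\<lambda>Q. - pCons 0 Q)
       (\<lambda>c. poly_op (\<lambda>Q. map_poly sv_D Q + pCons 0 Q)
          (\<lambda>c'. map_poly (sv_scl (c * c')) (sv_gen_br x y)) (b y)) (a x))"

lemma UNIV_sv_gen: "UNIV = {SV_L, SV_M, SV_Y}"
  using sv_gen.exhaust by auto

subsection \<open>Verification of the axioms\<close>

text \<open>An element of \<open>\<complex>[\<lambda>] \<otimes> A\<close>, resp. \<open>\<complex>[\<lambda>,\<mu>] \<otimes> A\<close>, is determined by the values of its
  coordinates at \<open>\<lambda> = s\<close>, \<open>\<mu> = u\<close>, \<open>\<partial> = t\<close>.\<close>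

definition sv_ev :: "complex \<Rightarrow> complex \<Rightarrow> sv_gen \<Rightarrow> sv poly \<Rightarrow> complex" where
  "sv_ev s t g P = poly (map_poly (\<lambda>x. poly (x g) t) P) s"

lemma sv_poly_sum_bound:
  fixes p :: "complex poly"
  assumes "degree p \<le> n" shows "poly p x = (\<Sum>k\<le>n. x ^ k * coeff p k)"
proof -
  have "(\<Sum>k\<le>n. x ^ k * coeff p k) = (\<Sum>k\<le>degree p. x ^ k * coeff p k)"
    by (rule sum.mono_neutral_right) (use assms in \<open>auto simp: coeff_eq_0\<close>)
  then show ?thesis by (simp add: poly_altdef mult.commute)
qed

lemma sv_ev_sum: "sv_ev s t g P = (\<Sum>k\<le>degree P. s ^ k * poly (coeff P k g) t)"
  unfolding sv_ev_def by (subst sv_poly_sum_bound[where n = "degree P"])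
    (auto simp: coeff_map_poly map_poly_degree_leq)

lemma sv_ev_0 [simp]: "sv_ev s t g 0 = 0" by (simp add: sv_ev_def)
lemma sv_ev_pCons [simp]: "sv_ev s t g (pCons x P) = poly (x g) t + s * sv_ev s t g P"
  by (simp add: sv_ev_def map_poly_pCons)
lemma sv_ev_add [simp]: "sv_ev s t g (P + Q) = sv_ev s t g P + sv_ev s t g Q"
proof -
  have "map_poly (\<lambda>x. poly (x g) t) (P + Q) = map_poly (\<lambda>x. poly (x g) t) P + map_poly (\<lambda>x. poly (x g) t) Q"
    by (rule poly_eqI) (simp add: coeff_map_poly)
  then show ?thesis by (simp add: sv_ev_def)
qed
lemma sv_ev_minus [simp]: "sv_ev s t g (- P) = - sv_ev s t g P"
  by (metis add_cancel_right_right sv_ev_0 sv_ev_add neg_eq_iff_add_eq_0 add.right_inverse)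
lemma sv_ev_diff [simp]: "sv_ev s t g (P - Q) = sv_ev s t g P - sv_ev s t g Q"
  by (metis sv_ev_add sv_ev_minus diff_conv_add_uminus)
lemma sv_ev_sum' [simp]: "sv_ev s t g (sum f A) = (\<Sum>a\<in>A. sv_ev s t g (f a))"
  by (induction A rule: infinite_finite_induct) auto
lemma sv_ev_map_D [simp]: "sv_ev s t g (map_poly sv_D P) = t * sv_ev s t g P"
proof (induction P)
  case 0 then show ?case by simp
next
  case (pCons a P)
  have "sv_D 0 = 0" by (simp add: sv_D_def fun_eq_iff)
  then show ?case using pCons by (simp add: map_poly_pCons algebra_simps) (simp add: sv_D_def)
qed
lemma sv_ev_map_scl [simp]: "sv_ev s t g (map_poly (sv_scl c) P) = c * sv_ev s t g P"
proof (induction P)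
  case 0 then show ?case by simp
next
  case (pCons a P)
  have "sv_scl c 0 = 0" by (simp add: sv_scl_def fun_eq_iff)
  then show ?case using pCons by (simp add: map_poly_pCons algebra_simps) (simp add: sv_scl_def)
qed

lemma sv_poly_ext: fixes p q :: "complex poly" assumes "\<And>x. poly p x = poly q x" shows "p = q"
  using assms poly_eq_poly_eq_iff by blast

lemma sv_ev_inject: assumes "\<And>s t g. sv_ev s t g P = sv_ev s t g Q" shows "P = Q"
proof (rule poly_eqI, rule ext, rule sv_poly_ext)
  fix k g t
  have "map_poly (\<lambda>x. poly (x g) t) P = map_poly (\<lambda>x. poly (x g) t) Q"
    by (rule sv_poly_ext) (use assms in \<open>simp add: sv_ev_def\<close>)
  then have "coeff (map_poly (\<lambda>x. poly (x g) t) P) k = coeff (map_poly (\<lambda>x. poly (x g) t) Q) k" by simp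
  then show "poly (coeff P k g) t = poly (coeff Q k g) t" by (simp add: coeff_map_poly)
qed

lemma sv_ev_poly_op:
  assumes "\<And>Q. sv_ev s t g (T Q) = \<tau> * sv_ev s t g Q"
  shows "sv_ev s t g (poly_op T f P) = (\<Sum>k\<le>degree P. \<tau> ^ k * sv_ev s t g (f (coeff P k)))"
proof -
  have "sv_ev s t g ((T ^^ k) Q) = \<tau> ^ k * sv_ev s t g Q" for k Q
    by (induction k) (auto simp: assms)
  then show ?thesis by (simp add: poly_op_def)
qed

lemma sv_ev_br: "sv_ev s t g (sv_br a b) =
  (\<Sum>x\<in>UNIV. \<Sum>y\<in>UNIV. poly (a x) (-s) * poly (b y) (s + t) * sv_ev s t g (sv_gen_br x y))"
proof -
  have 1: "sv_ev s t g (poly_op (\<lambda>Q. map_poly sv_D Q + pCons 0 Q)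
          (\<lambda>c'. map_poly (sv_scl (c * c')) R) p) = poly p (s + t) * (c * sv_ev s t g R)" for c R p
    by (subst sv_ev_poly_op[where \<tau> = "s + t"])
       (auto simp: algebra_simps sv_poly_sum_bound[OF order_refl] sum_distrib_left)
  show ?thesis unfolding sv_br_def
    apply (simp only: sv_ev_sum')
    apply (intro sum.cong refl)
    apply (subst sv_ev_poly_op[where \<tau> = "-s"])
     apply (simp)
    apply (simp only: 1)
    apply (simp only: sv_poly_sum_bound[OF order_refl, of "a _"] sum_distrib_right)
    apply (simp add: mult_ac)
    done
qed

lemma sv_ev_elt: "poly (sv_elt x y) t = (if y = x then 1 else 0)"
  by (auto simp: sv_elt_def)

lemma poly_sv_D: "poly (sv_D a g) t = t * poly (a g) t" by (simp add: sv_D_def)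
lemma poly_sv_scl: "poly (sv_scl c a g) t = c * poly (a g) t" by (simp add: sv_scl_def)

lemma sv_ev_gen:
  "sv_ev s t g (sv_gen_br x y) = (case (x, y, g) of
     (SV_L, SV_L, SV_L) \<Rightarrow> t + 2 * s
   | (SV_L, SV_Y, SV_Y) \<Rightarrow> t + 3/2 * s
   | (SV_Y, SV_L, SV_Y) \<Rightarrow> 1/2 * t + 3/2 * s
   | (SV_Y, SV_Y, SV_M) \<Rightarrow> t + 2 * s
   | (SV_L, SV_M, SV_M) \<Rightarrow> t + s
   | (SV_M, SV_L, SV_M) \<Rightarrow> s
   | _ \<Rightarrow> 0)"
  by (cases x; cases y; cases g) (simp_all add: poly_sv_D poly_sv_scl sv_ev_elt)

lemma sv_ev_br_L: "sv_ev s t SV_L (sv_br a b) = poly (a SV_L) (-s) * poly (b SV_L) (s + t) * (t + 2 * s)"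
  by (simp add: sv_ev_br UNIV_sv_gen sv_ev_gen)
lemma sv_ev_br_Y: "sv_ev s t SV_Y (sv_br a b) = poly (a SV_L) (-s) * poly (b SV_Y) (s + t) * (t + 3/2 * s)
   + poly (a SV_Y) (-s) * poly (b SV_L) (s + t) * (1/2 * t + 3/2 * s)"
  by (simp add: sv_ev_br UNIV_sv_gen sv_ev_gen)
lemma sv_ev_br_M: "sv_ev s t SV_M (sv_br a b) = poly (a SV_Y) (-s) * poly (b SV_Y) (s + t) * (t + 2 * s)
   + poly (a SV_L) (-s) * poly (b SV_M) (s + t) * (t + s)
   + poly (a SV_M) (-s) * poly (b SV_L) (s + t) * s"
  by (simp add: sv_ev_br UNIV_sv_gen sv_ev_gen)
lemmas sv_ev_brs = sv_ev_br_L sv_ev_br_Y sv_ev_br_M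

lemma sv_br_gen: "sv_br (sv_elt x) (sv_elt y) = sv_gen_br x y"
proof (rule sv_ev_inject)
  fix s t g show "sv_ev s t g (sv_br (sv_elt x) (sv_elt y)) = sv_ev s t g (sv_gen_br x y)"
    by (cases x; cases y; cases g) (simp_all add: sv_ev_brs poly_sv_D poly_sv_scl sv_ev_elt)
qed

definition sv_ev2 :: "complex \<Rightarrow> complex \<Rightarrow> complex \<Rightarrow> sv_gen \<Rightarrow> sv poly poly \<Rightarrow> complex" where
  "sv_ev2 s u t g R = poly (map_poly (sv_ev s t g) R) u"

lemma sv_ev2_0 [simp]: "sv_ev2 s u t g 0 = 0" by (simp add: sv_ev2_def)
lemma sv_ev2_pCons [simp]: "sv_ev2 s u t g (pCons x P) = sv_ev s t g x + u * sv_ev2 s u t g P"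
  by (simp add: sv_ev2_def map_poly_pCons)
lemma sv_ev2_add [simp]: "sv_ev2 s u t g (P + Q) = sv_ev2 s u t g P + sv_ev2 s u t g Q"
proof -
  have "map_poly (sv_ev s t g) (P + Q) = map_poly (sv_ev s t g) P + map_poly (sv_ev s t g) Q"
    by (rule poly_eqI) (simp add: coeff_map_poly)
  then show ?thesis by (simp add: sv_ev2_def)
qed
lemma sv_ev2_sum [simp]: "sv_ev2 s u t g (sum f A) = (\<Sum>a\<in>A. sv_ev2 s u t g (f a))"
  by (induction A rule: infinite_finite_induct) auto
lemma sv_ev2_lam: "sv_ev2 s u t g (map_poly (pCons 0) R) = s * sv_ev2 s u t g R"
proof (induction R)
  case (pCons a R)
  have *: "map_poly (pCons 0) (pCons a R) = pCons (pCons 0 a) (map_poly (pCons 0) R)"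
    by (rule map_poly_pCons) (rule pCons_0_0)
  show ?case unfolding * sv_ev2_pCons pCons.IH sv_ev_pCons by (simp add: algebra_simps)
qed simp
lemma sv_ev2_lift [simp]: "sv_ev2 s u t g (map_poly (\<lambda>y. [:y:]) P) = sv_ev u t g P"
  by (induction P) (simp_all add: map_poly_pCons algebra_simps)

lemma sv_ev2_inject: assumes "\<And>s u t g. sv_ev2 s u t g P = sv_ev2 s u t g Q" shows "P = Q"
proof (rule poly_eqI, rule sv_ev_inject)
  fix k s t g
  have "map_poly (sv_ev s t g) P = map_poly (sv_ev s t g) Q"
    by (rule sv_poly_ext) (use assms in \<open>simp add: sv_ev2_def\<close>)
  then have "coeff (map_poly (sv_ev s t g) P) k = coeff (map_poly (sv_ev s t g) Q) k" by simp
  then show "sv_ev s t g (coeff P k) = sv_ev s t g (coeff Q k)" by (simp add: coeff_map_poly)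
qed

lemma sv_ev2_poly_op:
  assumes "\<And>Q. sv_ev2 s u t g (T Q) = \<tau> * sv_ev2 s u t g Q"
  shows "sv_ev2 s u t g (poly_op T f P) = (\<Sum>k\<le>degree P. \<tau> ^ k * sv_ev2 s u t g (f (coeff P k)))"
proof -
  have "sv_ev2 s u t g ((T ^^ k) Q) = \<tau> ^ k * sv_ev2 s u t g Q" for k Q
    by (induction k) (auto simp: assms)
  then show ?thesis by (simp add: poly_op_def)
qed

lemma sv_sum_br:
  assumes F: "\<And>x. F x = (\<Sum>z\<in>UNIV. poly (x z) v * h z)"
  shows "(\<Sum>k\<le>degree P. w ^ k * F (coeff P k)) = (\<Sum>z\<in>UNIV. sv_ev w v z P * h z)"
proof -
  have "(\<Sum>k\<le>degree P. w ^ k * F (coeff P k)) =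
      (\<Sum>k\<le>degree P. \<Sum>z\<in>UNIV. w ^ k * poly (coeff P k z) v * h z)"
    by (simp add: F sum_distrib_left mult_ac)
  also have "\<dots> = (\<Sum>z\<in>UNIV. \<Sum>k\<le>degree P. w ^ k * poly (coeff P k z) v * h z)"
    by (rule sum.swap)
  also have "\<dots> = (\<Sum>z\<in>UNIV. sv_ev w v z P * h z)"
    by (simp only: sv_ev_sum sum_distrib_right)
  finally show ?thesis .
qed

lemma lie_conformal_algebra_sv: "lie_conformal_algebra sv_scl sv_D sv_br"
proof -
  interpret vector_space sv_scl
    by standard (simp_all add: sv_scl_def fun_eq_iff smult_add_right smult_add_left)
  show ?thesis
  proof
    show "sv_D (a + b) = sv_D a + sv_D b" for a b by (simp add: sv_D_def fun_eq_iff algebra_simps)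
    show "sv_D (sv_scl r b) = sv_scl r (sv_D b)" for r b by (simp add: sv_D_def sv_scl_def fun_eq_iff)
    show "sv_br (a + a') b = sv_br a b + sv_br a' b" for a a' b
      by (rule sv_ev_inject) (simp add: sv_ev_br algebra_simps sum.distrib)
    show "sv_br a (b + b') = sv_br a b + sv_br a b'" for a b b'
      by (rule sv_ev_inject) (simp add: sv_ev_br algebra_simps sum.distrib)
    show "sv_br (sv_scl r a) b = map_poly (sv_scl r) (sv_br a b)" for r a b
      by (rule sv_ev_inject) (simp add: sv_ev_br sv_scl_def mult_ac sum_distrib_left)
    show "sv_br a (sv_scl r b) = map_poly (sv_scl r) (sv_br a b)" for r a b
      by (rule sv_ev_inject) (simp add: sv_ev_br sv_scl_def mult_ac sum_distrib_left)
    show "sv_br (sv_D a) b = - pCons 0 (sv_br a b)" for a b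
      by (rule sv_ev_inject) (simp add: sv_ev_br sv_D_def mult_ac sum_distrib_left sum_negf)
    show "sv_br a (sv_D b) = map_poly sv_D (sv_br a b) + pCons 0 (sv_br a b)" for a b
    proof (rule sv_ev_inject)
      fix s t g
      have "sv_ev s t g (map_poly sv_D (sv_br a b) + pCons 0 (sv_br a b)) = (s + t) * sv_ev s t g (sv_br a b)"
        by (simp add: algebra_simps)
      then show "sv_ev s t g (sv_br a (sv_D b)) = sv_ev s t g (map_poly sv_D (sv_br a b) + pCons 0 (sv_br a b))"
        by (simp only: sv_ev_br poly_sv_D sum_distrib_left mult_ac)
    qed
    show "sv_br a b = - poly_op (\<lambda>Q. - pCons 0 Q - map_poly sv_D Q) (\<lambda>x. [:x:]) (sv_br b a)" for a b
    proof (rule sv_ev_inject)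
      fix s t g
      have "sv_ev s t g (poly_op (\<lambda>Q. - pCons 0 Q - map_poly sv_D Q) (\<lambda>x. [:x:]) (sv_br b a)) =
        sv_ev (- s - t) t g (sv_br b a)"
        by (subst sv_ev_poly_op[where \<tau> = "- s - t"], simp add: algebra_simps)
           (simp add: sv_ev_sum[of "- s - t"])
      moreover have "sv_ev s t g (sv_br a b) = - sv_ev (- s - t) t g (sv_br b a)"
        by (cases g) (simp_all add: sv_ev_brs field_simps)
      ultimately show "sv_ev s t g (sv_br a b) =
        sv_ev s t g (- poly_op (\<lambda>Q. - pCons 0 Q - map_poly sv_D Q) (\<lambda>x. [:x:]) (sv_br b a))"
        by (simp only: sv_ev_minus)
    qed
    fix a b c
    show "poly_op (pCons 0) (\<lambda>x. [:sv_br a x:]) (sv_br b c) =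
         poly_op (map_poly (pCons 0))
           (\<lambda>x. poly_op (\<lambda>Q. map_poly (pCons 0) Q + pCons 0 Q) (\<lambda>y. [:[:y:]:]) (sv_br x c)) (sv_br a b) +
         poly_op (map_poly (pCons 0)) (\<lambda>x. map_poly (\<lambda>y. [:y:]) (sv_br b x)) (sv_br a c)"
      (is "?A = ?B + ?C")
    proof (rule sv_ev2_inject)
      fix s u t g
      have A: "sv_ev2 s u t g ?A =
        (\<Sum>z\<in>UNIV. sv_ev u (s + t) z (sv_br b c) * (\<Sum>x\<in>UNIV. poly (a x) (- s) * sv_ev s t g (sv_gen_br x z)))"
        apply (subst sv_ev2_poly_op[where \<tau> = u], simp)
        apply (rule sv_sum_br)
        apply (simp add: sv_ev_br sum_distrib_left)
        apply (subst sum.swap)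
        apply (simp add: mult_ac)
        done
      have C: "sv_ev2 s u t g ?C =
        (\<Sum>z\<in>UNIV. sv_ev s (u + t) z (sv_br a c) * (\<Sum>x\<in>UNIV. poly (b x) (- u) * sv_ev u t g (sv_gen_br x z)))"
        apply (subst sv_ev2_poly_op[where \<tau> = s], rule sv_ev2_lam)
        apply (rule sv_sum_br)
        apply (simp add: sv_ev_br sum_distrib_left)
        apply (subst sum.swap)
        apply (simp add: mult_ac)
        done
      have B0: "sv_ev2 s u t g (poly_op (\<lambda>Q. map_poly (pCons 0) Q + pCons 0 Q) (\<lambda>y. [:[:y:]:]) P)
         = sv_ev (s + u) t g P" for P
        by (subst sv_ev2_poly_op[where \<tau> = "s + u"])
           (simp_all only: sv_ev2_add sv_ev2_lam sv_ev2_pCons sv_ev_0, simp_all add: algebra_simps sv_ev_sum[of "s + u"])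
      have B: "sv_ev2 s u t g ?B =
        (\<Sum>z\<in>UNIV. sv_ev s (- (s + u)) z (sv_br a b) *
           (\<Sum>y\<in>UNIV. poly (c y) (s + u + t) * sv_ev (s + u) t g (sv_gen_br z y)))"
        apply (subst sv_ev2_poly_op[where \<tau> = s], rule sv_ev2_lam)
        apply (rule sv_sum_br)
        apply (simp only: B0)
        apply (simp add: sv_ev_br sum_distrib_left mult_ac)
        done
      have e: "s + - (s + u) = - u" "u + (s + t) = s + u + t" "s + (u + t) = s + u + t"
        "- (- (s + u)) = s + u"
        by auto
      have sum3: "(\<Sum>x\<in>UNIV. h x) = h SV_L + h SV_M + h SV_Y" for h :: "sv_gen \<Rightarrow> complex"
        by (simp add: UNIV_sv_gen)
      define aL aM aY where "aL = poly (a SV_L) (- s)" "aM = poly (a SV_M) (- s)" "aY = poly (a SV_Y) (- s)"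
      define bL bM bY where "bL = poly (b SV_L) (- u)" "bM = poly (b SV_M) (- u)" "bY = poly (b SV_Y) (- u)"
      define cL cM cY where "cL = poly (c SV_L) (s + u + t)" "cM = poly (c SV_M) (s + u + t)"
        "cY = poly (c SV_Y) (s + u + t)"
      note defs = aL_aM_aY_def bL_bM_bY_def cL_cM_cY_def
      show "sv_ev2 s u t g ?A = sv_ev2 s u t g (?B + ?C)"
        unfolding sv_ev2_add A B C
        apply (cases g)
          apply (simp_all only: sum3 sv_ev_brs e defs[symmetric])
          apply (simp_all only: sv_ev_gen prod.case sv_gen.case)
        apply (simp_all add: field_simps)
        done
    qed
  qed
qed

interpretation sv: lie_conformal_algebra sv_scl sv_D sv_br
  by (rule lie_conformal_algebra_sv)

end

theory Submission
  imports Defs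
begin

text \<open>The divided-power coefficients of the values of a cochain on generators form an alternating,
  finitely supported multilinear form on the annihilation Lie algebra with basis \<open>L\<^sub>n\<close>
  (\<open>n \<ge> -1\<close>), \<open>Y\<^sub>p\<close> (\<open>p \<ge> -1/2\<close>), \<open>M\<^sub>n\<close> (\<open>n \<ge> 0\<close>). This turns the basic complex into the
  Chevalley--Eilenberg complex of this Lie algebra with trivial coefficients, and \<open>\<partial>\<close> into the Lie
  derivative along \<open>L\<^sub>-\<^sub>1\<close>.

  By Cartan's formula for the grading element \<open>L\<^sub>0\<close> only forms of weight 0 contribute to the basic
  cohomology. They form a complex of dimension 28, whose cohomology has dimensions
  1, 0, 0, 1, 0, 2, 2 in degrees 0 to 6.

  In positive degree \<open>\<partial>\<close> is injective, and by Cartan's formula for \<open>L\<^sub>-\<^sub>1\<close> it is null-homotopic. If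
  \<open>d\<gamma> = \<partial>\<beta>\<close>, then \<open>\<beta>\<close> and \<open>\<gamma> - \<iota>\<beta>\<close>, with \<open>\<iota>\<close> the contraction with \<open>L\<^sub>-\<^sub>1\<close>, are basic cocycles, and
  \<open>\<gamma> \<mapsto> (\<gamma> - \<iota>\<beta>, \<beta>)\<close> identifies the reduced cohomology in degree \<open>q \<ge> 1\<close> with the sum of the basic
  cohomologies in degrees \<open>q\<close> and \<open>q + 1\<close>.\<close>

section \<open>The annihilation Lie algebra\<close>

text \<open>The bulk of the work is bookkeeping: the differential is a signed double sum of
  substituted polynomials. Two devices contain it. On forms every operator is a recursion on the
  argument list, and the signed sum is met only in \<open>ce_sum\<close>. On cochains skew-symmetry
  is verified directly only for the cochain rebuilt from a form; sums, multiples, \<partial> and the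
  differential inherit it through \<open>is_cochainI\<close>. Weight 0 is finite-dimensional because
  only L_{-1} and Y_{-1/2} have negative weight and an alternating form takes each at most once.
  Injectivity of \<partial> rests on finite support, that is, on polynomial values: there is a
  largest exponent, and raising it by one detects the form. Adding neighbours in 1, 0, 0, 1, 0, 2,
  2, followed by zeros, gives 0, 1, 1, 2, 4, 2 in degrees 1 to 6; in degree 0 the constants
  remain.\<close>

type_synonym sv_mode = "sv_gen \<times> nat"
type_synonym sv_form = "sv_mode list \<Rightarrow> complex"

text \<open>Extended to a commutative monoid with unit \<open>SV_L\<close>, so that commutativity
  and associativity hold for all generators; brackets that are zero are recorded by zero
  coefficients in \<open>gen_form\<close>.\<close>

fun gen_mult :: "sv_gen \<Rightarrow> sv_gen \<Rightarrow> sv_gen" where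
  "gen_mult SV_L X = X"
| "gen_mult X SV_L = X"
| "gen_mult _ _ = SV_M"

text \<open>Inside a cochain, \<partial> acts on a bracket as minus the sum of its two variables
  \<lambda>, \<mu>. The pair (a, b) records what this makes of the bracket coefficient, namely a
  \<lambda> + b \<mu>. For L and Y, for instance, \<partial> + 3/2 \<lambda> becomes 1/2 \<lambda> -
  \<mu>.\<close>

fun gen_form :: "sv_gen \<Rightarrow> sv_gen \<Rightarrow> complex \<times> complex" where
  "gen_form SV_L SV_L = (1, -1)"
| "gen_form SV_L SV_Y = (1/2, -1)"
| "gen_form SV_Y SV_L = (1, -1/2)"
| "gen_form SV_Y SV_Y = (1, -1)"
| "gen_form SV_L SV_M = (0, -1)"
| "gen_form SV_M SV_L = (1, 0)"
| "gen_form _ _ = (0, 0)"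

text \<open>The mode \<open>(X, e)\<close> is the coefficient \<open>X\<^sub>(\<^sub>e\<^sub>)\<close>, that is \<open>L\<^sub>e\<^sub>-\<^sub>1\<close>, \<open>Y\<^sub>e\<^sub>-\<^sub>1\<^sub>/\<^sub>2\<close> or \<open>M\<^sub>e\<close>.
  The bracket of \<open>x\<close> and \<open>y\<close> is \<open>mode_coef x y\<close> times \<open>mode_mult x y\<close>; the truncated subtraction
  is harmless because the coefficient vanishes when both exponents are 0.\<close>

definition mode_mult :: "sv_mode \<Rightarrow> sv_mode \<Rightarrow> sv_mode" where
  "mode_mult x y = (gen_mult (fst x) (fst y), snd x + snd y - 1)"

definition mode_coef :: "sv_mode \<Rightarrow> sv_mode \<Rightarrow> complex" where
  "mode_coef x y = fst (gen_form (fst x) (fst y)) * of_nat (snd x) +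
     snd (gen_form (fst x) (fst y)) * of_nat (snd y)"

section \<open>Skew-symmetry and the Jacobi identity for modes\<close>

lemma mode_mult_commute: "mode_mult x y = mode_mult y x"
  by (cases "fst x"; cases "fst y") (simp_all add: mode_mult_def add.commute)

lemma mode_coef_commute: "mode_coef x y = - mode_coef y x"
  by (cases "fst x"; cases "fst y") (simp_all add: mode_coef_def)

lemma gen_mult_left_commute: "gen_mult X (gen_mult Y Z) = gen_mult Y (gen_mult X Z)"
  by (cases X; cases Y; cases Z) simp_all

lemma gen_mult_assoc: "gen_mult (gen_mult X Y) Z = gen_mult X (gen_mult Y Z)"
  by (cases X; cases Y; cases Z) simp_all

text \<open>If all pairwise sums of exponents are positive, the truncated subtractions are exact and
  this is a polynomial identity. If two exponents vanish, the third is at least 2: the bracket of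
  those two is truncated but has coefficient 0, and writing the third as k + 2 makes the other
  subtractions computable.\<close>

lemma mode_jacobi_aux:
  assumes "a + b + c \<ge> 2"
  shows "mode_coef (Y, b) (Z, c) * mode_coef (X, a) (mode_mult (Y, b) (Z, c))
       - mode_coef (X, a) (Z, c) * mode_coef (Y, b) (mode_mult (X, a) (Z, c))
       = mode_coef (X, a) (Y, b) * mode_coef (mode_mult (X, a) (Y, b)) (Z, c)"
proof -
  have nz: "complex_of_nat (p + q - 1) = of_nat p + of_nat q - 1" if "p + q \<noteq> 0" for p q
    using that by (subst of_nat_diff) auto
  consider "b = 0" "c = 0" | "a = 0" "c = 0" | "a = 0" "b = 0" | "a + b \<noteq> 0" "a + c \<noteq> 0" "b + c \<noteq> 0" by blast
  then show ?thesis
  proof cases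
    case 1
    with assms obtain k where a: "a = Suc (Suc k)" by (metis add_cancel_right_right le_Suc_ex numeral_2_eq_2 add_Suc)
    show ?thesis unfolding 1 a
      by (cases X; cases Y; cases Z; simp add: mode_coef_def mode_mult_def; simp add: algebra_simps)
  next
    case 2
    with assms obtain k where b: "b = Suc (Suc k)" by (metis add_cancel_right_right add_cancel_right_left le_Suc_ex numeral_2_eq_2 add_Suc)
    show ?thesis unfolding 2 b
      by (cases X; cases Y; cases Z; simp add: mode_coef_def mode_mult_def; simp add: algebra_simps)
  next
    case 3
    with assms obtain k where c: "c = Suc (Suc k)" by (metis add_cancel_right_left le_Suc_ex numeral_2_eq_2 add_Suc)
    show ?thesis unfolding 3 c
      by (cases X; cases Y; cases Z; simp add: mode_coef_def mode_mult_def; simp add: algebra_simps)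
  next
    case 4
    show ?thesis
      unfolding mode_coef_def mode_mult_def fst_conv snd_conv nz[OF 4(1)] nz[OF 4(2)] nz[OF 4(3)]
      by (cases X; cases Y; cases Z; simp; simp add: field_simps)
  qed
qed

lemma mode_coef_small: "snd x + snd y = 0 \<Longrightarrow> mode_coef x y = 0"
  by (simp add: mode_coef_def)

text \<open>The function f stands for evaluation of a form, so modes need to coincide only where the
  coefficient is nonzero. If the total exponent is at most 1, two exponents vanish and every term
  has a zero factor; otherwise the relevant iterated products are one mode, whose exponent is the
  total minus 2.\<close>

lemma mode_jacobi:
  "mode_coef y w * mode_coef x (mode_mult y w) * f (mode_mult x (mode_mult y w))
   - mode_coef x w * mode_coef y (mode_mult x w) * f (mode_mult y (mode_mult x w))
   = mode_coef x y * mode_coef (mode_mult x y) w * f (mode_mult (mode_mult x y) w)"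
proof (cases "snd x + snd y + snd w \<ge> 2")
  case False
  then have "snd x = 0 \<and> snd y = 0 \<or> snd x = 0 \<and> snd w = 0 \<or> snd y = 0 \<and> snd w = 0" by linarith
  with False show ?thesis
    by (auto simp: mode_coef_def mode_mult_def)
next
  case True
  define v where "v = f (gen_mult (fst x) (gen_mult (fst y) (fst w)), snd x + snd y + snd w - Suc (Suc 0))"
  have 1: "mode_coef y w * mode_coef x (mode_mult y w) * f (mode_mult x (mode_mult y w))
    = mode_coef y w * mode_coef x (mode_mult y w) * v"
    using True mode_coef_small[of y w] by (cases "snd y + snd w = 0") (auto simp: mode_mult_def v_def algebra_simps)
  have 2: "mode_coef x w * mode_coef y (mode_mult x w) * f (mode_mult y (mode_mult x w))
    = mode_coef x w * mode_coef y (mode_mult x w) * v"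
    using True mode_coef_small[of x w]
    by (cases "snd x + snd w = 0")
      (auto simp: mode_mult_def v_def algebra_simps gen_mult_left_commute[of "fst y"])
  have 3: "mode_coef x y * mode_coef (mode_mult x y) w * f (mode_mult (mode_mult x y) w)
    = mode_coef x y * mode_coef (mode_mult x y) w * v"
    using True mode_coef_small[of x y]
    by (cases "snd x + snd y = 0") (auto simp: mode_mult_def v_def algebra_simps gen_mult_assoc)
  show ?thesis
    unfolding 1 2 3 using mode_jacobi_aux[of "snd x" "snd y" "snd w" "fst y" "fst w" "fst x"] True
    by (simp flip: left_diff_distrib)
qed

section \<open>Contraction, Lie derivative and differential, with Cartan's formulas\<close>

primrec lie_list :: "sv_mode list \<Rightarrow> sv_mode \<Rightarrow> sv_form \<Rightarrow> complex" where
  "lie_list [] x c = 0"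
| "lie_list (y # ys) x c =
     lie_list ys x (\<lambda>zs. c (y # zs)) - mode_coef x y * c (mode_mult x y # ys)"

text \<open>Minus the sum, over all positions, of the values with that argument replaced by its
  bracket with x. Fixing the head of the list is contraction, which gives the recursion.\<close>

definition lie_der :: "sv_mode \<Rightarrow> sv_form \<Rightarrow> sv_form" where
  "lie_der x c = (\<lambda>xs. lie_list xs x c)"

definition contr :: "sv_mode \<Rightarrow> sv_form \<Rightarrow> sv_form" where
  "contr x c = (\<lambda>xs. c (x # xs))"

primrec ce_list :: "sv_mode list \<Rightarrow> sv_form \<Rightarrow> complex" where
  "ce_list [] c = 0"
| "ce_list (x # xs) c = lie_list xs x c - ce_list xs (\<lambda>zs. c (x # zs))"

text \<open>The Chevalley--Eilenberg differential, defined by Cartan's formula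
  \<open>\<iota>\<^sub>x d = \<theta>\<^sub>x - d \<iota>\<^sub>x\<close>; this makes its properties provable by induction on the
  argument list without any reordering of arguments.\<close>

definition ce :: "sv_form \<Rightarrow> sv_form" where
  "ce c = (\<lambda>xs. ce_list xs c)"

lemma lie_der_Nil [simp]: "lie_der x c [] = 0"
  by (simp add: lie_der_def)

lemma lie_der_Cons: "lie_der x c (y # ys) = lie_der x (contr y c) ys - mode_coef x y * c (mode_mult x y # ys)"
  by (simp add: lie_der_def contr_def)

lemma ce_Nil [simp]: "ce c [] = 0"
  by (simp add: ce_def)

lemma ce_Cons: "ce c (x # xs) = lie_der x c xs - ce (contr x c) xs"
  by (simp add: ce_def lie_der_def contr_def)

lemma contr_apply: "contr x c xs = c (x # xs)"
  by (simp add: contr_def)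

text \<open>A general two-term combination: one induction per operator gives linearity, with sums,
  differences, multiples and 0 as instances.\<close>

definition lincomb2 :: "complex \<Rightarrow> sv_form \<Rightarrow> complex \<Rightarrow> sv_form \<Rightarrow> sv_form" where
  "lincomb2 a c b e = (\<lambda>xs. a * c xs + b * e xs)"

lemma contr_lincomb2: "contr x (lincomb2 a c b e) = lincomb2 a (contr x c) b (contr x e)"
  by (simp add: contr_def lincomb2_def)

lemma lie_der_lincomb2: "lie_der x (lincomb2 a c b e) = lincomb2 a (lie_der x c) b (lie_der x e)"
proof
  fix xs show "lie_der x (lincomb2 a c b e) xs = lincomb2 a (lie_der x c) b (lie_der x e) xs"
    by (induction xs arbitrary: c e)
      (simp_all add: lie_der_Cons contr_lincomb2, simp_all add: lincomb2_def lie_der_Cons algebra_simps)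
qed

lemma ce_lincomb2: "ce (lincomb2 a c b e) = lincomb2 a (ce c) b (ce e)"
proof
  fix xs show "ce (lincomb2 a c b e) xs = lincomb2 a (ce c) b (ce e) xs"
    by (induction xs arbitrary: c e)
      (simp_all add: ce_Cons contr_lincomb2 lie_der_lincomb2, simp_all add: lincomb2_def ce_Cons algebra_simps)
qed

lemma lie_der_add: "lie_der x (c + e) = lie_der x c + lie_der x e"
  using lie_der_lincomb2[of x 1 c 1 e] by (simp add: lincomb2_def plus_fun_def)
lemma lie_der_diff: "lie_der x (c - e) = lie_der x c - lie_der x e"
  using lie_der_lincomb2[of x 1 c "-1" e] by (simp add: lincomb2_def fun_diff_def)
lemma lie_der_scale: "lie_der x (\<lambda>xs. a * c xs) = (\<lambda>xs. a * lie_der x c xs)"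
  using lie_der_lincomb2[of x a c 0 c] by (simp add: lincomb2_def)
lemma ce_add: "ce (c + e) = ce c + ce e"
  using ce_lincomb2[of 1 c 1 e] by (simp add: lincomb2_def plus_fun_def)
lemma ce_diff: "ce (c - e) = ce c - ce e"
  using ce_lincomb2[of 1 c "-1" e] by (simp add: lincomb2_def fun_diff_def)
lemma ce_scale: "ce (\<lambda>xs. a * c xs) = (\<lambda>xs. a * ce c xs)"
  using ce_lincomb2[of a c 0 c] by (simp add: lincomb2_def)
lemma lie_der_0: "lie_der x 0 = 0"
  using lie_der_scale[of x 0 0] by (simp add: zero_fun_def)
lemma ce_0: "ce 0 = 0"
  using ce_scale[of 0 0] by (simp add: zero_fun_def)

lemma contr_lie_der: "contr y (lie_der x c) = lincomb2 1 (lie_der x (contr y c)) (- mode_coef x y) (contr (mode_mult x y) c)"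
  by (rule ext) (simp add: contr_apply lie_der_Cons lincomb2_def)

lemma contr_ce: "contr x (ce c) = lie_der x c - ce (contr x c)"
  by (rule ext) (simp add: contr_apply ce_Cons)

text \<open>In the induction the mixed terms cancel, and the contribution of the head w is the
  Jacobi identity for x, y, w evaluated in c.\<close>

lemma lie_der_commutator:
  "lie_der x (lie_der y c) xs - lie_der y (lie_der x c) xs = mode_coef x y * lie_der (mode_mult x y) c xs"
proof (induction xs arbitrary: c)
  case (Cons w ws)
  show ?case
    using Cons.IH[of "contr w c"] mode_jacobi[of y w x "\<lambda>u. c (u # ws)"]
    by (simp add: lie_der_Cons contr_lie_der lie_der_lincomb2, simp add: lincomb2_def lie_der_Cons contr_def algebra_simps)
qed simp

text \<open>Splitting off y reduces the claim to \<open>contr y c\<close>; the error terms form the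
  commutator of two Lie derivatives, which is the bracket term.\<close>

lemma lie_der_ce: "lie_der x (ce c) xs = ce (lie_der x c) xs"
proof (induction xs arbitrary: c)
  case (Cons y ys)
  have "lie_der x (ce c) (y # ys) = lie_der x (lie_der y c) ys - lie_der x (ce (contr y c)) ys
      - mode_coef x y * ce c (mode_mult x y # ys)"
    by (simp add: lie_der_Cons contr_ce lie_der_diff)
  also have "\<dots> = lie_der y (lie_der x c) ys - ce (lie_der x (contr y c)) ys
      + mode_coef x y * ce (contr (mode_mult x y) c) ys"
    using lie_der_commutator[of x y c ys] by (simp add: Cons.IH ce_Cons algebra_simps)
  also have "\<dots> = ce (lie_der x c) (y # ys)"
    by (simp add: ce_Cons contr_lie_der ce_lincomb2, simp add: lincomb2_def)
  finally show ?case .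
qed simp

text \<open>With \<iota> and \<theta> for contraction and Lie derivative, \<iota> d d = \<theta> d -
  d \<theta> + d d \<iota>: the first two terms cancel and the last is the induction
  hypothesis.\<close>

lemma ce_ce: "ce (ce c) xs = 0"
proof (induction xs arbitrary: c)
  case (Cons x xs)
  then show ?case
    by (simp add: ce_Cons contr_ce ce_diff lie_der_ce)
qed simp

subsection \<open>Alternating forms\<close>

text \<open>Adjacent swaps generate all permutations and suit induction on the prefix; arbitrary
  permutations follow in \<open>alternating_permute\<close>.\<close>

definition alternating :: "sv_form \<Rightarrow> bool" where
  "alternating c \<longleftrightarrow> (\<forall>us x y vs. c (us @ x # y # vs) = - c (us @ y # x # vs))"

lemma alternatingD: "alternating c \<Longrightarrow> c (us @ x # y # vs) = - c (us @ y # x # vs)"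
  unfolding alternating_def by blast

lemma alternating_swap: "alternating c \<Longrightarrow> c (x # y # vs) = - c (y # x # vs)"
  using alternatingD[of c "[]" x y vs] by simp

lemma alternating_contr: "alternating c \<Longrightarrow> alternating (contr x c)"
  unfolding alternating_def contr_def by (metis append_Cons)

lemma alternating_lincomb2: "alternating c \<Longrightarrow> alternating e \<Longrightarrow> alternating (lincomb2 a c b e)"
  unfolding alternating_def lincomb2_def by (metis add_uminus_conv_diff minus_add_distrib mult_minus_right)

lemma alternating_lie_der:
  assumes "alternating c" shows "alternating (lie_der z c)"
  unfolding alternating_def
proof (intro allI)
  fix us x y vs
  show "lie_der z c (us @ x # y # vs) = - lie_der z c (us @ y # x # vs)"
    using assms
  proof (induction us arbitrary: c)
    case Nil
    have 1: "c (mode_mult z x # y # vs) = - c (y # mode_mult z x # vs)"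
      "c (mode_mult z y # x # vs) = - c (x # mode_mult z y # vs)"
      using alternating_swap[OF Nil] by blast+
    have "contr y (contr x c) = lincomb2 (-1) (contr x (contr y c)) 0 c"
      by (rule ext) (simp add: contr_def lincomb2_def alternating_swap[OF Nil, of x y])
    then have "lie_der z (contr y (contr x c)) vs = - lie_der z (contr x (contr y c)) vs"
      by (simp add: lie_der_lincomb2) (simp add: lincomb2_def)
    then show ?case
      by (simp add: lie_der_Cons contr_apply 1)
  next
    case (Cons u us)
    then show ?case
      using alternatingD[OF Cons.prems, of "mode_mult z u # us" x y vs] Cons.IH[OF alternating_contr[OF Cons.prems, of u]]
      by (simp add: lie_der_Cons algebra_simps)
  qed
qed

text \<open>At the head, two Cartan steps leave two Lie derivative terms of opposite sign that the
  swap exchanges, a double contraction and a bracket term; the latter two are odd in the swapped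
  pair.\<close>

lemma alternating_ce:
  assumes "alternating c" shows "alternating (ce c)"
  unfolding alternating_def
proof (intro allI)
  fix us x y vs
  show "ce c (us @ x # y # vs) = - ce c (us @ y # x # vs)"
    using assms
  proof (induction us arbitrary: c)
    case Nil
    have "contr y (contr x c) = lincomb2 (-1) (contr x (contr y c)) 0 c"
      by (rule ext) (simp add: contr_def lincomb2_def alternating_swap[OF Nil, of x y])
    then have "ce (contr y (contr x c)) vs = - ce (contr x (contr y c)) vs"
      by (simp add: ce_lincomb2) (simp add: lincomb2_def)
    then show ?case
      using mode_coef_commute[of x y] mode_mult_commute[of x y]
      by (simp add: ce_Cons lie_der_Cons)
  next
    case (Cons u us)
    then show ?case
      using alternatingD[OF alternating_lie_der[OF Cons.prems], of u us x y vs] Cons.IH[OF alternating_contr[OF Cons.prems, of u]]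
      by (simp add: ce_Cons algebra_simps)
  qed
qed

section \<open>Alternating forms with finite support, the counterpart of polynomial values\<close>

definition forms :: "nat \<Rightarrow> sv_form set" where
  "forms n = {c. (\<forall>xs. length xs \<noteq> n \<longrightarrow> c xs = 0) \<and> alternating c \<and> finite {xs. c xs \<noteq> 0}}"

definition homogeneous :: "nat \<Rightarrow> sv_form \<Rightarrow> bool" where
  "homogeneous n c \<longleftrightarrow> (\<forall>xs. length xs \<noteq> n \<longrightarrow> c xs = 0)"

text \<open>For lists of fixed length over three generators, a bound on the exponents amounts to
  finite support; unlike the latter it passes easily through the recursions.\<close>

definition mode_bounded :: "nat \<Rightarrow> sv_form \<Rightarrow> bool" where
  "mode_bounded N c \<longleftrightarrow> (\<forall>xs. c xs \<noteq> 0 \<longrightarrow> (\<forall>x\<in>set xs. snd x \<le> N))"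

lemma homogeneous_contr: "homogeneous (Suc n) c \<Longrightarrow> homogeneous n (contr x c)"
  by (simp add: homogeneous_def contr_def)

lemma homogeneous_0_contr: "homogeneous 0 c \<Longrightarrow> contr x c = 0"
  by (rule ext) (simp add: homogeneous_def contr_def)

lemma homogeneous_lie_der: "homogeneous n c \<Longrightarrow> homogeneous n (lie_der x c)"
proof -
  have "length xs \<noteq> n \<Longrightarrow> lie_der x c xs = 0" if "homogeneous n c" for xs
    using that
  proof (induction xs arbitrary: n c)
    case (Cons y ys)
    show ?case
    proof (cases n)
      case 0
      then show ?thesis using Cons.prems by (simp add: lie_der_Cons homogeneous_0_contr lie_der_0) (simp add: homogeneous_def)
    next
      case (Suc m)
      then have "lie_der x (contr y c) ys = 0"
        using Cons.IH[of m "contr y c"] Cons.prems homogeneous_contr by auto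
      then show ?thesis using Cons.prems by (simp add: lie_der_Cons homogeneous_def)
    qed
  qed simp
  then show "homogeneous n c \<Longrightarrow> homogeneous n (lie_der x c)" by (simp add: homogeneous_def)
qed

lemma homogeneous_ce: "homogeneous n c \<Longrightarrow> homogeneous (Suc n) (ce c)"
proof -
  have "length xs \<noteq> Suc n \<Longrightarrow> ce c xs = 0" if "homogeneous n c" for xs
    using that
  proof (induction xs arbitrary: n c)
    case (Cons y ys)
    have 1: "lie_der y c ys = 0"
      using homogeneous_lie_der[OF Cons.prems(2), of y] Cons.prems(1) by (simp add: homogeneous_def)
    have 2: "ce (contr y c) ys = 0"
    proof (cases n)
      case 0
      then show ?thesis using Cons.prems by (simp add: homogeneous_0_contr ce_0)
    next
      case (Suc m)
      then show ?thesis
        using Cons.IH[of m "contr y c"] Cons.prems homogeneous_contr by auto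
    qed
    show ?case by (simp add: ce_Cons 1 2)
  qed simp
  then show "homogeneous n c \<Longrightarrow> homogeneous (Suc n) (ce c)" by (simp add: homogeneous_def)
qed

lemma mode_bounded_contr: "mode_bounded N c \<Longrightarrow> mode_bounded N (contr x c)"
  by (auto simp: mode_bounded_def contr_def)

text \<open>A nonzero term evaluates c at a bracket, whose exponent is one less than the sum of two
  exponents, so both are at most N + 1. The bound on x itself is needed for \<open>ce\<close>, where
  x is an argument too.\<close>

lemma lie_der_bounded:
  assumes "mode_bounded N c" "lie_der x c xs \<noteq> 0"
  shows "snd x \<le> Suc N" "\<forall>y\<in>set xs. snd y \<le> Suc N"
proof -
  have "snd x \<le> Suc N \<and> (\<forall>y\<in>set xs. snd y \<le> Suc N)" using assms
  proof (induction xs arbitrary: c)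
    case (Cons y ys)
    from Cons.prems(2) consider "lie_der x (contr y c) ys \<noteq> 0" | "c (mode_mult x y # ys) \<noteq> 0"
      unfolding lie_der_Cons by fastforce
    then show ?case
    proof cases
      case 1
      then have "contr y c \<noteq> 0" using lie_der_0[of x] by auto
      then obtain zs where "c (y # zs) \<noteq> 0" by (auto simp: contr_def fun_eq_iff)
      with Cons.prems(1) have "snd y \<le> N" by (auto simp: mode_bounded_def)
      with Cons.IH[OF mode_bounded_contr[OF Cons.prems(1)] 1] show ?thesis by simp
    next
      case 2
      with Cons.prems(1) show ?thesis by (force simp: mode_bounded_def mode_mult_def)
    qed
  qed simp
  then show "snd x \<le> Suc N" "\<forall>y\<in>set xs. snd y \<le> Suc N" by blast+
qed

lemma mode_bounded_lie_der: "mode_bounded N c \<Longrightarrow> mode_bounded (Suc N) (lie_der x c)"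
  using lie_der_bounded(2) by (simp add: mode_bounded_def[of "Suc N"])

lemma mode_bounded_ce:
  assumes "mode_bounded N c" shows "mode_bounded (Suc N) (ce c)"
proof -
  have "ce c xs \<noteq> 0 \<Longrightarrow> \<forall>x\<in>set xs. snd x \<le> Suc N" if "mode_bounded N c" for xs
    using that
  proof (induction xs arbitrary: c)
    case (Cons x xs)
    from Cons.prems(1) consider "lie_der x c xs \<noteq> 0" | "ce (contr x c) xs \<noteq> 0"
      unfolding ce_Cons by fastforce
    then show ?case
    proof cases
      case 1
      then show ?thesis using lie_der_bounded[OF Cons.prems(2) 1] by simp
    next
      case 2
      then have "contr x c \<noteq> 0" using ce_0 by auto
      then obtain zs where "c (x # zs) \<noteq> 0" by (auto simp: contr_def fun_eq_iff)
      with Cons.prems(2) have "snd x \<le> N" by (auto simp: mode_bounded_def)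
      with Cons.IH[OF 2 mode_bounded_contr[OF Cons.prems(2)]] show ?thesis by simp
    qed
  qed simp
  with assms show ?thesis by (simp add: mode_bounded_def[of "Suc N"])
qed

lemma finite_UNIV_sv_gen: "finite (UNIV :: sv_gen set)"
  by (simp add: UNIV_sv_gen)

lemma finite_support_iff_bounded:
  assumes "homogeneous n c"
  shows "finite {xs. c xs \<noteq> 0} \<longleftrightarrow> (\<exists>N. mode_bounded N c)"
proof
  assume fin: "finite {xs. c xs \<noteq> 0}"
  define S where "S = snd ` (\<Union>xs\<in>{xs. c xs \<noteq> 0}. set xs)"
  have "finite S" unfolding S_def using fin by blast
  then have "mode_bounded (Max S) c"
    by (auto simp: mode_bounded_def S_def intro!: Max_ge)
  then show "\<exists>N. mode_bounded N c" ..
next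
  assume "\<exists>N. mode_bounded N c"
  then obtain N where N: "mode_bounded N c" ..
  have "{xs. c xs \<noteq> 0} \<subseteq> {xs. set xs \<subseteq> UNIV \<times> {..N} \<and> length xs = n}"
    using N assms unfolding mode_bounded_def homogeneous_def by fastforce
  moreover have "finite \<dots>"
    by (rule finite_lists_length_eq) (simp add: finite_UNIV_sv_gen)
  ultimately show "finite {xs. c xs \<noteq> 0}" by (rule finite_subset)
qed

lemma forms_iff: "c \<in> forms n \<longleftrightarrow> homogeneous n c \<and> alternating c \<and> (\<exists>N. mode_bounded N c)"
  using finite_support_iff_bounded by (auto simp: forms_def homogeneous_def)

lemma forms_alternating: "c \<in> forms n \<Longrightarrow> alternating c"
  by (simp add: forms_iff)

lemma ce_in_forms: "c \<in> forms n \<Longrightarrow> ce c \<in> forms (Suc n)"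
  using homogeneous_ce mode_bounded_ce alternating_ce unfolding forms_iff by blast

lemma lie_der_in_forms: "c \<in> forms n \<Longrightarrow> lie_der x c \<in> forms n"
  using homogeneous_lie_der mode_bounded_lie_der alternating_lie_der unfolding forms_iff by blast

lemma contr_in_forms: "c \<in> forms (Suc n) \<Longrightarrow> contr x c \<in> forms n"
  using homogeneous_contr mode_bounded_contr alternating_contr unfolding forms_iff by blast

lemma forms_lincomb2: assumes "c \<in> forms n" "e \<in> forms n" shows "lincomb2 a c b e \<in> forms n"
proof -
  have "{xs. lincomb2 a c b e xs \<noteq> 0} \<subseteq> {xs. c xs \<noteq> 0} \<union> {xs. e xs \<noteq> 0}"
    by (auto simp: lincomb2_def)
  then have "finite {xs. lincomb2 a c b e xs \<noteq> 0}"
    by (rule finite_subset) (use assms in \<open>auto simp: forms_def\<close>)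
  moreover have "\<forall>xs. length xs \<noteq> n \<longrightarrow> lincomb2 a c b e xs = 0"
    using assms by (simp add: forms_def lincomb2_def)
  moreover have "alternating (lincomb2 a c b e)"
    using assms by (intro alternating_lincomb2) (auto simp: forms_def)
  ultimately show ?thesis by (simp add: forms_def)
qed

lemma forms_add: "c \<in> forms n \<Longrightarrow> e \<in> forms n \<Longrightarrow> c + e \<in> forms n"
  using forms_lincomb2[of c n e 1 1] by (simp add: lincomb2_def plus_fun_def)
lemma forms_diff: "c \<in> forms n \<Longrightarrow> e \<in> forms n \<Longrightarrow> c - e \<in> forms n"
  using forms_lincomb2[of c n e 1 "-1"] by (simp add: lincomb2_def fun_diff_def)
lemma forms_scale: "c \<in> forms n \<Longrightarrow> (\<lambda>xs. a * c xs) \<in> forms n"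
  using forms_lincomb2[of c n c a 0] by (simp add: lincomb2_def)
lemma forms_zero: "0 \<in> forms n"
  by (simp add: forms_def alternating_def)

section \<open>Reordering arguments up to an unspecified sign\<close>

lemma alternating_move_front:
  assumes "alternating c" shows "c (us @ x # vs) = c (x # us @ vs) \<or> c (us @ x # vs) = - c (x # us @ vs)"
  using assms
proof (induction us arbitrary: c)
  case (Cons u us)
  have "c (u # x # us @ vs) = - c (x # u # us @ vs)"
    by (rule alternating_swap[OF Cons.prems])
  then show ?case using Cons.IH[OF alternating_contr[OF Cons.prems], of u] by (simp add: contr_def) (metis minus_minus)
qed simp

lemma alternating_mset:
  assumes "alternating c" "mset xs = mset ys"
  shows "c xs = c ys \<or> c xs = - c ys"
  using assms
proof (induction xs arbitrary: c ys)
  case (Cons x xs)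
  from Cons.prems(2) have "x \<in> set ys" by (metis list.set_intros(1) mset_eq_setD)
  then obtain us vs where ys: "ys = us @ x # vs" by (meson split_list)
  with Cons.prems(2) have "mset xs = mset (us @ vs)" by simp
  from Cons.IH[OF alternating_contr[OF Cons.prems(1), of x] this]
  have "c (x # xs) = c (x # us @ vs) \<or> c (x # xs) = - c (x # us @ vs)" by (simp add: contr_def)
  then show ?case using alternating_move_front[OF Cons.prems(1), of us x vs] unfolding ys by (metis minus_minus)
qed simp

lemma alternating_not_distinct:
  assumes "alternating c" "\<not> distinct xs" shows "c xs = 0"
proof -
  obtain us vs ws x where "xs = us @ [x] @ vs @ [x] @ ws" using not_distinct_decomp[OF assms(2)] by blast
  then have "mset xs = mset (x # x # us @ vs @ ws)" by simp
  from alternating_mset[OF assms(1) this]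
  have "c xs = c (x # x # us @ vs @ ws) \<or> c xs = - c (x # x # us @ vs @ ws)" .
  moreover have "c (x # x # us @ vs @ ws) = 0"
    using alternating_swap[OF assms(1), of x x "us @ vs @ ws"]
    by (metis add.right_inverse mult_2 mult_eq_0_iff zero_neq_numeral)
  ultimately show ?thesis by auto
qed

subsection \<open>Weights\<close>

text \<open>Twice the \<open>L\<^sub>0\<close>-weight; the mode \<open>(SV_L, 1)\<close> is the grading element \<open>L\<^sub>0\<close>.\<close>

definition mode_wt :: "sv_mode \<Rightarrow> int" where
  "mode_wt x = 2 * int (snd x) - (case fst x of SV_L \<Rightarrow> 2 | SV_Y \<Rightarrow> 1 | SV_M \<Rightarrow> 0)"

definition weight :: "sv_mode list \<Rightarrow> int" where
  "weight xs = sum_list (map mode_wt xs)"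

text \<open>An operator diagonal in the weight. The indicator of 0 projects to weight 0; the
  function 2/w inverts the Lie derivative along the grading element on the other weights.\<close>

definition wscale :: "(int \<Rightarrow> complex) \<Rightarrow> sv_form \<Rightarrow> sv_form" where
  "wscale g c = (\<lambda>xs. g (weight xs) * c xs)"

lemma weight_simps [simp]: "weight [] = 0" "weight (x # xs) = mode_wt x + weight xs"
  by (simp_all add: weight_def)

lemma mode_wt_mult: "mode_coef x y \<noteq> 0 \<Longrightarrow> mode_wt (mode_mult x y) = mode_wt x + mode_wt y"
proof (cases "snd x + snd y = 0")
  case False
  then have "int (snd x + snd y - 1) = int (snd x) + int (snd y) - 1" by (subst of_nat_diff) auto
  then show "mode_coef x y \<noteq> 0 \<Longrightarrow> mode_wt (mode_mult x y) = mode_wt x + mode_wt y"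
    unfolding mode_mult_def mode_wt_def mode_coef_def by (cases "fst x"; cases "fst y"; simp)
qed (simp add: mode_coef_small)

lemma contr_wscale: "contr x (wscale g c) = wscale (\<lambda>w. g (mode_wt x + w)) (contr x c)"
  by (rule ext) (simp add: contr_def wscale_def)

lemma lie_der_wscale: "lie_der x (wscale g c) xs = g (mode_wt x + weight xs) * lie_der x c xs"
proof (induction xs arbitrary: c g)
  case (Cons y ys)
  have "mode_coef x y * wscale g c (mode_mult x y # ys) = g (mode_wt x + weight (y # ys)) * (mode_coef x y * c (mode_mult x y # ys))"
    by (cases "mode_coef x y = 0") (simp_all add: wscale_def mode_wt_mult add.assoc)
  then show ?case
    unfolding lie_der_Cons contr_wscale Cons.IH by (simp only: weight_simps right_diff_distrib add_ac)
qed simp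

lemma ce_wscale: "ce (wscale g c) = wscale g (ce c)"
proof
  fix xs show "ce (wscale g c) xs = wscale g (ce c) xs"
  proof (induction xs arbitrary: c g)
    case (Cons x xs)
    then show ?case
      by (simp add: ce_Cons contr_wscale lie_der_wscale) (simp add: wscale_def ce_Cons algebra_simps)
  qed (simp add: wscale_def)
qed

lemma lie_der_grading: "lie_der (SV_L, Suc 0) c xs = of_int (weight xs) / 2 * c xs"
proof (induction xs arbitrary: c)
  case (Cons y ys)
  have "mode_mult (SV_L, Suc 0) y = y" by (cases y) (simp add: mode_mult_def)
  moreover have "mode_coef (SV_L, Suc 0) y = - (of_int (mode_wt y) / 2)"
    by (cases "fst y") (simp_all add: mode_coef_def mode_wt_def field_simps)
  ultimately show ?case by (simp add: lie_der_Cons Cons.IH contr_def algebra_simps add_divide_distrib)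
qed (simp add: weight_def)

lemma wscale_in_forms: assumes "c \<in> forms n" shows "wscale g c \<in> forms n"
proof -
  have "alternating (wscale g c)"
    unfolding alternating_def
  proof (intro allI)
    fix us x y vs
    have "weight (us @ x # y # vs) = weight (us @ y # x # vs)" by (simp add: weight_def)
    then show "wscale g c (us @ x # y # vs) = - wscale g c (us @ y # x # vs)"
      using alternatingD[OF forms_alternating[OF assms], of us x y vs] by (simp add: wscale_def)
  qed
  moreover have "finite {xs. wscale g c xs \<noteq> 0}"
    by (rule finite_subset[of _ "{xs. c xs \<noteq> 0}"]) (use assms in \<open>auto simp: wscale_def forms_def\<close>)
  ultimately show ?thesis using assms by (simp add: forms_def wscale_def)
qed

definition wt0_part :: "sv_form \<Rightarrow> sv_form" where
  "wt0_part = wscale (\<lambda>w. if w = 0 then 1 else 0)"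

text \<open>On the weight w part of a cocycle, contraction with the grading element followed by d is
  multiplication by w/2, halved because weights are doubled. Hence 2/w times the contraction is a
  primitive of every part with w \<noteq> 0.\<close>

lemma cocycle_homotopic_wt0_part:
  assumes "c \<in> forms (Suc n)" "ce c = 0"
  obtains b where "b \<in> forms n" "c = wt0_part c + ce b"
proof
  let ?b = "wscale (\<lambda>w. if w = 0 then 0 else 2 / of_int w) (contr (SV_L, Suc 0) c)"
  show "?b \<in> forms n" by (intro wscale_in_forms contr_in_forms assms)
  have *: "ce (contr (SV_L, Suc 0) c) = lie_der (SV_L, Suc 0) c"
    using contr_ce[of "(SV_L, Suc 0)" c] assms(2) by (auto simp: contr_def fun_eq_iff)
  show "c = wt0_part c + ce ?b"
    unfolding ce_wscale * by (rule ext) (simp add: wscale_def wt0_part_def lie_der_grading)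
qed

subsection \<open>Elementary forms\<close>

text \<open>Exterior multiplication by the coordinate form of the mode \<open>s\<close>.\<close>

primrec wedge_list :: "sv_mode list \<Rightarrow> sv_mode \<Rightarrow> sv_form \<Rightarrow> complex" where
  "wedge_list [] s c = 0"
| "wedge_list (x # xs) s c = (if x = s then c xs else 0) - wedge_list xs s (\<lambda>zs. c (x # zs))"

definition wedge :: "sv_mode \<Rightarrow> sv_form \<Rightarrow> sv_form" where
  "wedge s c = (\<lambda>xs. wedge_list xs s c)"

definition elem_form :: "sv_mode list \<Rightarrow> sv_form" where
  "elem_form ss = foldr wedge ss (\<lambda>xs. if xs = [] then 1 else 0)"

lemma wedge_Nil [simp]: "wedge s c [] = 0"
  by (simp add: wedge_def)

lemma wedge_Cons: "wedge s c (x # xs) = (if x = s then c xs else 0) - wedge s (contr x c) xs"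
  by (simp add: wedge_def contr_def)

lemma wedge_lincomb2: "wedge s (lincomb2 a c b e) = lincomb2 a (wedge s c) b (wedge s e)"
proof
  fix xs show "wedge s (lincomb2 a c b e) xs = lincomb2 a (wedge s c) b (wedge s e) xs"
    by (induction xs arbitrary: c e)
      (simp_all add: wedge_Cons contr_lincomb2, simp_all add: lincomb2_def wedge_Cons algebra_simps)
qed

lemma wedge_0: "wedge s 0 = 0"
  using wedge_lincomb2[of s 0 0 0 0] by (simp add: lincomb2_def zero_fun_def)

lemma alternating_wedge:
  assumes "alternating c" shows "alternating (wedge s c)"
  unfolding alternating_def
proof (intro allI)
  fix us x y vs
  show "wedge s c (us @ x # y # vs) = - wedge s c (us @ y # x # vs)"
    using assms
  proof (induction us arbitrary: c)
    case Nil
    have "contr y (contr x c) = lincomb2 (-1) (contr x (contr y c)) 0 c"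
      by (rule ext) (simp add: contr_def lincomb2_def alternating_swap[OF Nil, of x y])
    then have "wedge s (contr y (contr x c)) vs = - wedge s (contr x (contr y c)) vs"
      by (simp add: wedge_lincomb2) (simp add: lincomb2_def)
    then show ?case by (simp add: wedge_Cons contr_apply)
  next
    case (Cons u us)
    then show ?case
      using alternatingD[OF Cons.prems, of us x y vs] Cons.IH[OF alternating_contr[OF Cons.prems, of u]]
      by (simp add: wedge_Cons)
  qed
qed

lemma homogeneous_wedge: assumes "homogeneous n c" shows "homogeneous (Suc n) (wedge s c)"
proof -
  have "length xs \<noteq> Suc n \<Longrightarrow> wedge s c xs = 0" for xs using assms
  proof (induction xs arbitrary: n c)
    case (Cons y ys)
    have "wedge s (contr y c) ys = 0"
    proof (cases n)
      case 0
      then show ?thesis using Cons.prems by (simp add: homogeneous_0_contr wedge_0)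
    next
      case (Suc m)
      then show ?thesis using Cons.IH[of m "contr y c"] Cons.prems homogeneous_contr by auto
    qed
    then show ?case using Cons.prems by (simp add: wedge_Cons homogeneous_def)
  qed simp
  then show ?thesis by (simp add: homogeneous_def)
qed

lemma mode_bounded_wedge:
  assumes "mode_bounded N c" shows "mode_bounded (max N (snd s)) (wedge s c)"
proof -
  have "wedge s c xs \<noteq> 0 \<Longrightarrow> \<forall>x\<in>set xs. snd x \<le> max N (snd s)" for xs using assms
  proof (induction xs arbitrary: c)
    case (Cons x xs)
    from Cons.prems(1) consider "x = s" "c xs \<noteq> 0" | "wedge s (contr x c) xs \<noteq> 0"
      unfolding wedge_Cons by (metis diff_self)
    then show ?case
    proof cases
      case 1
      then show ?thesis using Cons.prems(2) by (force simp: mode_bounded_def)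
    next
      case 2
      then have "contr x c \<noteq> 0" using wedge_0[of s] by auto
      then obtain zs where "c (x # zs) \<noteq> 0" by (auto simp: contr_def fun_eq_iff)
      with Cons.prems(2) have "snd x \<le> N" by (auto simp: mode_bounded_def)
      with Cons.IH[OF 2 mode_bounded_contr[OF Cons.prems(2)]] show ?thesis by auto
    qed
  qed simp
  then show ?thesis unfolding mode_bounded_def by blast
qed

lemma elem_form_simps: "elem_form [] = (\<lambda>xs. if xs = [] then 1 else 0)"
  "elem_form (s # ss) = wedge s (elem_form ss)"
  by (simp_all add: elem_form_def)

lemma elem_form_in_forms: "elem_form ss \<in> forms (length ss)"
proof (induction ss)
  case Nil
  show ?case by (auto simp: forms_iff elem_form_simps homogeneous_def alternating_def mode_bounded_def)
next
  case (Cons s ss)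
  then show ?case unfolding forms_iff elem_form_simps
    using alternating_wedge homogeneous_wedge mode_bounded_wedge by (metis length_Cons)
qed

lemma wedge_mset:
  assumes "wedge s c xs \<noteq> 0" "\<And>ys. c ys \<noteq> 0 \<Longrightarrow> mset ys = A"
  shows "mset xs = add_mset s A"
  using assms
proof (induction xs arbitrary: c A)
  case (Cons x xs)
  from Cons.prems(1) consider "x = s" "c xs \<noteq> 0" | "wedge s (contr x c) xs \<noteq> 0"
    unfolding wedge_Cons by (metis diff_self)
  then show ?case
  proof cases
    case 1
    then show ?thesis using Cons.prems(2) by simp
  next
    case 2
    then have "contr x c \<noteq> 0" using wedge_0[of s] by auto
    then obtain zs where "c (x # zs) \<noteq> 0" by (auto simp: contr_def fun_eq_iff)
    then have A: "A = add_mset x (mset zs)" using Cons.prems(2)[of "x # zs"] by simp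
    have "mset xs = add_mset s (mset zs)"
      by (rule Cons.IH[OF 2]) (use Cons.prems(2)[of "x # _"] A in \<open>auto simp: contr_def\<close>)
    then show ?thesis by (simp add: A)
  qed
qed simp

lemma elem_form_mset: "elem_form ss xs \<noteq> 0 \<Longrightarrow> mset xs = mset ss"
proof (induction ss arbitrary: xs)
  case (Cons s ss)
  then show ?case using wedge_mset[of s "elem_form ss" xs "mset ss"] by (simp add: elem_form_simps)
qed (auto simp: elem_form_simps split: if_splits)

lemma elem_form_self: "distinct ss \<Longrightarrow> elem_form ss ss = 1"
proof (induction ss)
  case (Cons s ss)
  have "contr s (elem_form ss) = 0"
  proof (rule ext, rule ccontr)
    fix xs assume "contr s (elem_form ss) xs \<noteq> (0 :: sv_form) xs"
    then have "mset (s # xs) = mset ss" using elem_form_mset[of ss "s # xs"] by (simp add: contr_def)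
    then have "s \<in> set ss" by (metis list.set_intros(1) mset_eq_setD)
    then show False using Cons.prems by simp
  qed
  then show ?case using Cons by (simp add: elem_form_simps wedge_Cons wedge_0)
qed (simp add: elem_form_simps)

lemma elem_form_other: "\<not> set ss \<subseteq> set xs \<Longrightarrow> elem_form ss xs = 0"
  using elem_form_mset[of ss xs] mset_eq_setD by blast

subsection \<open>Forms of weight zero\<close>

text \<open>The digit is the exponent, not the usual index: \<open>L0\<close>, \<open>L1\<close>,
  \<open>L2\<close> are L_{-1}, L_0, L_1 and \<open>Y0\<close>, \<open>Y1\<close>, \<open>Y2\<close>
  are Y_{-1/2}, Y_{1/2}, Y_{3/2}, whereas \<open>M0\<close>, \<open>M1\<close> are M_0, M_1.\<close>

abbreviation "L0 \<equiv> (SV_L, 0::nat)"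
abbreviation "L1 \<equiv> (SV_L, Suc 0)"
abbreviation "L2 \<equiv> (SV_L, Suc (Suc 0))"
abbreviation "Y0 \<equiv> (SV_Y, 0::nat)"
abbreviation "Y1 \<equiv> (SV_Y, Suc 0)"
abbreviation "Y2 \<equiv> (SV_Y, Suc (Suc 0))"
abbreviation "M0 \<equiv> (SV_M, 0::nat)"
abbreviation "M1 \<equiv> (SV_M, Suc 0)"

definition wt0 :: "sv_form \<Rightarrow> bool" where
  "wt0 c \<longleftrightarrow> (\<forall>xs. c xs \<noteq> 0 \<longrightarrow> weight xs = 0)"

text \<open>Only \<open>L0\<close> and \<open>Y0\<close> have negative weight, -2 and -1 in doubled
  weights. In a distinct list they contribute at least -3, so in total weight 0 no mode exceeds
  weight 3, which leaves eight modes.\<close>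

lemma wt0_mode_cases:
  assumes "distinct xs" "weight xs = 0" "x \<in> set xs"
  shows "x \<in> {L0, Y0, Y1, L2, M1, Y2, L1, M0}"
proof -
  have eq: "(\<Sum>y\<in>set xs. mode_wt y) = 0"
    using assms by (simp add: weight_def sum_list_distinct_conv_sum_set)
  have neg: "mode_wt y \<ge> 0 \<or> y = L0 \<or> y = Y0" for y
    by (cases y; cases "fst y"; cases "snd y") (auto simp: mode_wt_def)
  have "mode_wt x \<le> 3"
  proof (rule ccontr)
    assume "\<not> mode_wt x \<le> 3"
    then have x: "x \<notin> {L0, Y0}" by (auto simp: mode_wt_def)
    have "(\<Sum>y\<in>set xs. mode_wt y) = mode_wt x + (\<Sum>y\<in>set xs - {x}. mode_wt y)"
      using assms(3) by (simp add: sum.remove)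
    also have "(\<Sum>y\<in>set xs - {x}. mode_wt y) = (\<Sum>y\<in>set xs \<inter> {L0, Y0}. mode_wt y) + (\<Sum>y\<in>set xs - {x} - {L0, Y0}. mode_wt y)"
      using x by (subst sum.union_disjoint[symmetric]) (auto intro!: sum.cong)
    also have "(\<Sum>y\<in>set xs \<inter> {L0, Y0}. mode_wt y) \<ge> - 3"
      by (cases "L0 \<in> set xs"; cases "Y0 \<in> set xs") (auto simp: mode_wt_def Int_insert_right)
    moreover have "(\<Sum>y\<in>set xs - {x} - {L0, Y0}. mode_wt y) \<ge> 0"
      by (rule sum_nonneg) (use neg in blast)
    ultimately show False using eq \<open>\<not> mode_wt x \<le> 3\<close> by linarith
  qed
  moreover obtain X a where "x = (X, a)" by (cases x)
  ultimately have "(X = SV_L \<or> X = SV_Y) \<and> a \<le> 2 \<or> X = SV_M \<and> a \<le> 1"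
    by (cases X) (auto simp: mode_wt_def)
  then have "X = SV_L \<and> (a = 0 \<or> a = Suc 0 \<or> a = Suc (Suc 0)) \<or> X = SV_Y \<and> (a = 0 \<or> a = Suc 0 \<or> a = Suc (Suc 0)) \<or> X = SV_M \<and> (a = 0 \<or> a = Suc 0)"
    by auto
  then show ?thesis using \<open>x = (X, a)\<close> by auto
qed

text \<open>Seven sets of modes of nonzero weight have total weight 0 (the empty one included). Each
  may be joined by any subset of the weight 0 modes \<open>L1\<close> and \<open>M0\<close>, whence
  28 lists.\<close>

definition wt0_lists :: "sv_mode list list" where
  "wt0_lists = [[], [L1], [M0], [L0,L2], [L0,M1], [Y0,Y1], [L1,M0],
    [L0,Y0,Y2], [L0,L2,L1], [L0,L2,M0], [L0,M1,L1], [L0,M1,M0], [Y0,Y1,L1], [Y0,Y1,M0],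
    [L0,Y0,Y1,L2], [L0,Y0,Y1,M1], [L0,Y0,Y2,L1], [L0,Y0,Y2,M0], [L0,L2,L1,M0], [L0,M1,L1,M0], [Y0,Y1,L1,M0],
    [L0,Y0,Y1,L2,L1], [L0,Y0,Y1,L2,M0], [L0,Y0,Y1,M1,L1], [L0,Y0,Y1,M1,M0], [L0,Y0,Y2,L1,M0],
    [L0,Y0,Y1,L2,L1,M0], [L0,Y0,Y1,M1,L1,M0]]"

text \<open>A list with nonzero value is distinct and consists of the eight modes. Sorting changes
  the value at most by a sign, and evaluation over all sublists of the eight sorted modes shows that
  the result is one of the 28.\<close>

lemma wt0_form_eq_0:
  assumes "alternating c" "wt0 c" "\<And>xs. xs \<in> set wt0_lists \<Longrightarrow> c xs = 0"
  shows "c = 0"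
proof (rule ccontr)
  assume "c \<noteq> 0"
  then obtain xs where xs: "c xs \<noteq> 0" by (auto simp: fun_eq_iff)
  then have d: "distinct xs" using alternating_not_distinct[OF assms(1)] by blast
  have w: "weight xs = 0" using xs assms(2) by (auto simp: wt0_def)
  define ys where "ys = filter (\<lambda>x. x \<in> set xs) [L0, Y0, Y1, L2, M1, Y2, L1, M0]"
  have "set xs \<subseteq> set [L0, Y0, Y1, L2, M1, Y2, L1, M0]"
  proof
    fix x assume "x \<in> set xs"
    from wt0_mode_cases[OF d w this] show "x \<in> set [L0, Y0, Y1, L2, M1, Y2, L1, M0]" by simp
  qed
  then have "set ys = set xs" unfolding ys_def set_filter by blast
  moreover have "distinct ys" by (simp add: ys_def)
  ultimately have m: "mset ys = mset xs" using d set_eq_iff_mset_eq_distinct by metis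
  then have "c ys \<noteq> 0" using alternating_mset[OF assms(1) m] xs by auto
  moreover have "weight ys = 0" using assms(2) \<open>c ys \<noteq> 0\<close> by (auto simp: wt0_def)
  moreover have "filter P zs \<in> set (subseqs zs)" for P :: "sv_mode \<Rightarrow> bool" and zs
    by (induction zs) (auto simp: Let_def)
  then have "ys \<in> set (subseqs [L0, Y0, Y1, L2, M1, Y2, L1, M0])" unfolding ys_def .
  moreover have "\<forall>ys \<in> set (subseqs [L0, Y0, Y1, L2, M1, Y2, L1, M0]). weight ys = 0 \<longrightarrow> ys \<in> set wt0_lists"
    by code_simp
  ultimately show False using assms(3) by blast
qed

text \<open>The position of a mode in the order used in \<open>wt0_lists\<close>.\<close>

definition mode_rank :: "sv_mode \<Rightarrow> nat" where
  "mode_rank x = (case fst x of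
     SV_L \<Rightarrow> if snd x = 0 then 0 else if snd x = 1 then 6 else 3
   | SV_Y \<Rightarrow> if snd x = 0 then 1 else if snd x = 1 then 2 else 5
   | SV_M \<Rightarrow> if snd x = 0 then 7 else 4)"

text \<open>Oriented by rank, the swaps form a terminating rewrite system that sorts arguments; the
  five positions cover lists of length at most six.\<close>

lemma alternating_sort:
  assumes "alternating c" "mode_rank y < mode_rank x"
  shows "c (x # y # vs) = - c (y # x # vs)"
    "c (a # x # y # vs) = - c (a # y # x # vs)"
    "c (a # b # x # y # vs) = - c (a # b # y # x # vs)"
    "c (a # b # d # x # y # vs) = - c (a # b # d # y # x # vs)"
    "c (a # b # d # e # x # y # vs) = - c (a # b # d # e # y # x # vs)"
  using alternatingD[OF assms(1), of "[]" x y vs] alternatingD[OF assms(1), of "[a]" x y vs]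
    alternatingD[OF assms(1), of "[a, b]" x y vs] alternatingD[OF assms(1), of "[a, b, d]" x y vs]
    alternatingD[OF assms(1), of "[a, b, d, e]" x y vs]
  by simp_all

text \<open>The matrix of the differential in weight 0, found by expanding Cartan's recursion,
  dropping repeated modes and sorting. Rows for lists of length at most 1 are omitted, as
  \<open>ce\<close> vanishes on them.\<close>

lemma ce_wt0_lists:
  assumes "alternating c"
  shows "ce c [L0,L2] = 2 * c [L1]"
    "ce c [L0,M1] = c [M0]"
    "ce c [Y0,Y1] = c [M0]"
    "ce c [L1,M0] = 0"
    "ce c [L0,Y0,Y2] = - 2 * c [L0,M1] + 2 * c [Y0,Y1]"
    "ce c [L0,L2,L1] = 0"
    "ce c [L0,L2,M0] = 2 * c [L1,M0]"
    "ce c [L0,M1,L1] = - c [L1,M0]"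
    "ce c [L0,M1,M0] = 0"
    "ce c [Y0,Y1,L1] = - c [L1,M0]"
    "ce c [Y0,Y1,M0] = 0"
    "ce c [L0,Y0,Y1,L2] = c [L0,L2,M0] + 2 * c [Y0,Y1,L1]"
    "ce c [L0,Y0,Y1,M1] = c [L0,M1,M0] + c [Y0,Y1,M0]"
    "ce c [L0,Y0,Y2,L1] = - 2 * c [L0,M1,L1] + 2 * c [Y0,Y1,L1]"
    "ce c [L0,Y0,Y2,M0] = - 2 * c [L0,M1,M0] + 2 * c [Y0,Y1,M0]"
    "ce c [L0,L2,L1,M0] = 0"
    "ce c [L0,M1,L1,M0] = 0"
    "ce c [Y0,Y1,L1,M0] = 0"
    "ce c [L0,Y0,Y1,L2,L1] = - c [L0,L2,L1,M0]"
    "ce c [L0,Y0,Y1,L2,M0] = 2 * c [Y0,Y1,L1,M0]"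
    "ce c [L0,Y0,Y1,M1,L1] = - c [L0,M1,L1,M0] - c [Y0,Y1,L1,M0]"
    "ce c [L0,Y0,Y1,M1,M0] = 0"
    "ce c [L0,Y0,Y2,L1,M0] = - 2 * c [L0,M1,L1,M0] + 2 * c [Y0,Y1,L1,M0]"
    "ce c [L0,Y0,Y1,L2,L1,M0] = 0"
    "ce c [L0,Y0,Y1,M1,L1,M0] = 0"
proof -
  have d: "c xs = 0" if "\<not> distinct xs" for xs
    by (rule alternating_not_distinct[OF assms that])
  show "ce c [L0,L2] = 2 * c [L1]"
    "ce c [L0,M1] = c [M0]"
    "ce c [Y0,Y1] = c [M0]"
    "ce c [L1,M0] = 0"
    "ce c [L0,Y0,Y2] = - 2 * c [L0,M1] + 2 * c [Y0,Y1]"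
    "ce c [L0,L2,L1] = 0"
    "ce c [L0,L2,M0] = 2 * c [L1,M0]"
    "ce c [L0,M1,L1] = - c [L1,M0]"
    "ce c [L0,M1,M0] = 0"
    "ce c [Y0,Y1,L1] = - c [L1,M0]"
    "ce c [Y0,Y1,M0] = 0"
    "ce c [L0,Y0,Y1,L2] = c [L0,L2,M0] + 2 * c [Y0,Y1,L1]"
    "ce c [L0,Y0,Y1,M1] = c [L0,M1,M0] + c [Y0,Y1,M0]"
    "ce c [L0,Y0,Y2,L1] = - 2 * c [L0,M1,L1] + 2 * c [Y0,Y1,L1]"
    "ce c [L0,Y0,Y2,M0] = - 2 * c [L0,M1,M0] + 2 * c [Y0,Y1,M0]"
    "ce c [L0,L2,L1,M0] = 0"
    "ce c [L0,M1,L1,M0] = 0"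
    "ce c [Y0,Y1,L1,M0] = 0"
    "ce c [L0,Y0,Y1,L2,L1] = - c [L0,L2,L1,M0]"
    "ce c [L0,Y0,Y1,L2,M0] = 2 * c [Y0,Y1,L1,M0]"
    "ce c [L0,Y0,Y1,M1,L1] = - c [L0,M1,L1,M0] - c [Y0,Y1,L1,M0]"
    "ce c [L0,Y0,Y1,M1,M0] = 0"
    "ce c [L0,Y0,Y2,L1,M0] = - 2 * c [L0,M1,L1,M0] + 2 * c [Y0,Y1,L1,M0]"
    "ce c [L0,Y0,Y1,L2,L1,M0] = 0"
    "ce c [L0,Y0,Y1,M1,L1,M0] = 0"
    by (simp_all add: ce_Cons lie_der_Cons contr_apply mode_coef_def mode_mult_def
        alternating_sort[OF assms] d mode_rank_def)
qed


subsection \<open>Basic cohomology\<close>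

text \<open>Meant for positive degrees. The constants, which form the basic cohomology in degree 0,
  are accounted for separately in \<open>red_dim\<close>.\<close>

definition betti :: "nat \<Rightarrow> nat" where
  "betti n = (if n = 3 then 1 else if n = 5 \<or> n = 6 then 2 else 0)"

text \<open>Functionals that vanish on coboundaries and separate the cohomology classes; they were found by
  row reduction of the differential on the forms of weight 0, which is listed in \<open>ce_wt0_lists\<close>.\<close>

definition class_coord :: "nat \<Rightarrow> nat \<Rightarrow> sv_form \<Rightarrow> complex" where
  "class_coord n i c =
    (if n = 3 then c [L0,L2,L1]
     else if n = 5 then
       if i = 0 then c [L0,Y0,Y1,M1,M0]
       else c [L0,Y0,Y2,L1,M0] - 2 * c [L0,Y0,Y1,M1,L1] - 2 * c [L0,Y0,Y1,L2,M0]
     else if i = 0 then c [L0,Y0,Y1,L2,L1,M0] else c [L0,Y0,Y1,M1,L1,M0])"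

lemma class_coord_lincomb2:
  "class_coord n i (lincomb2 a c b e) = a * class_coord n i c + b * class_coord n i e"
  by (simp add: class_coord_def lincomb2_def algebra_simps)

text \<open>The second functional in degree 5 is the linear relation among the three rows of the
  matrix that involve c on [L0,M1,L1,M0] or [Y0,Y1,L1,M0]; each of the other functionals is a zero
  row.\<close>

lemma class_coord_ce:
  assumes "c \<in> forms n" "i < betti (Suc n)" shows "class_coord (Suc n) i (ce c) = 0"
  using assms(2) ce_wt0_lists[OF forms_alternating[OF assms(1)]]
  by (auto simp: class_coord_def betti_def split: if_splits)

lemma wt0_ce: "wt0 c \<Longrightarrow> wt0 (ce c)"
proof -
  assume "wt0 c"
  then have "wscale (\<lambda>w. if w = 0 then 1 else 0) c = c" by (auto simp: wscale_def wt0_def fun_eq_iff)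
  then have *: "wscale (\<lambda>w. if w = 0 then 1 else 0) (ce c) = ce c" by (metis ce_wscale)
  show "wt0 (ce c)" unfolding wt0_def
  proof (intro allI impI)
    fix xs assume "ce c xs \<noteq> 0"
    with fun_cong[OF *, of xs] show "weight xs = 0" by (auto simp: wscale_def split: if_splits)
  qed
qed

lemma wt0_elem_form: "weight ss = 0 \<Longrightarrow> wt0 (elem_form ss)"
  unfolding wt0_def
proof (intro allI impI)
  fix xs assume "weight ss = 0" "elem_form ss xs \<noteq> 0"
  from elem_form_mset[OF this(2)] have "sum_mset (image_mset mode_wt (mset xs)) = sum_mset (image_mset mode_wt (mset ss))"
    by simp
  then have "weight xs = weight ss"
    by (simp only: weight_def sum_mset_sum_list mset_map[symmetric])
  with \<open>weight ss = 0\<close> show "weight xs = 0" by simp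
qed

definition form_of :: "(complex \<times> sv_mode list) list \<Rightarrow> sv_form" where
  "form_of cs = (\<lambda>xs. \<Sum>(a, ss)\<leftarrow>cs. a * elem_form ss xs)"

lemma form_of_simps: "form_of [] = 0" "form_of ((a, ss) # cs) = lincomb2 a (elem_form ss) 1 (form_of cs)"
  by (auto simp: form_of_def lincomb2_def fun_eq_iff)

lemma form_of_in_forms: "\<forall>(a, ss)\<in>set cs. length ss = n \<Longrightarrow> form_of cs \<in> forms n"
  using elem_form_in_forms by (induction cs) (auto simp: form_of_simps forms_zero intro!: forms_lincomb2)

lemma wt0_form_of: "\<forall>(a, ss)\<in>set cs. weight ss = 0 \<Longrightarrow> wt0 (form_of cs)"
proof (induction cs)
  case (Cons p cs)
  obtain a ss where "p = (a, ss)" by (cases p)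
  with Cons wt0_elem_form[of ss] show ?case
    by (auto simp: form_of_simps wt0_def lincomb2_def) (metis add_cancel_right_right mult_zero_right)
qed (simp add: form_of_simps wt0_def)

lemma form_of_eval: "form_of cs xs = (\<Sum>(a, ss)\<leftarrow>cs. a * elem_form ss xs)"
  by (simp add: form_of_def)

text \<open>Both c and the differential of the witness have weight 0, so they are equal once they
  agree on the 28 lists.\<close>

lemma wt0_coboundaryI:
  assumes "c \<in> forms (Suc n)" "wt0 c" "\<forall>(a, ss)\<in>set cs. length ss = n \<and> weight ss = 0"
    and "\<And>xs. xs \<in> set wt0_lists \<Longrightarrow> length xs = Suc n \<Longrightarrow> c xs = ce (form_of cs) xs"
  shows "\<exists>b\<in>forms n. ce b = c"
proof
  show b: "form_of cs \<in> forms n" by (rule form_of_in_forms) (use assms(3) in auto)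
  have w: "wt0 (ce (form_of cs))" by (intro wt0_ce wt0_form_of) (use assms(3) in auto)
  have f: "c - ce (form_of cs) \<in> forms (Suc n)" by (intro forms_diff assms(1) ce_in_forms b)
  have "c - ce (form_of cs) = 0"
  proof (rule wt0_form_eq_0)
    show "alternating (c - ce (form_of cs))" using f by (rule forms_alternating)
    show "wt0 (c - ce (form_of cs))" using assms(2) w unfolding wt0_def minus_apply by (metis diff_self)
    fix xs assume "xs \<in> set wt0_lists"
    then show "(c - ce (form_of cs)) xs = 0"
      using assms(4)[of xs] f by (cases "length xs = Suc n") (auto simp: forms_def)
  qed
  then show "ce (form_of cs) = c" by simp
qed

text \<open>Here n is the degree of the primitive. Its coefficients are read off from some rows of
  \<open>ce_wt0_lists\<close>; the other rows agree by the cocycle equations and the vanishing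
  coordinates. In degree 1 the cocycle equations already force c = 0.\<close>

lemma wt0_cocycle_exact:
  assumes c: "c \<in> forms (Suc n)" "wt0 c" "ce c = 0" and z: "\<And>i. i < betti (Suc n) \<Longrightarrow> class_coord (Suc n) i c = 0"
  shows "\<exists>b\<in>forms n. ce b = c"
proof -
  have alt: "alternating c" using c(1) by (rule forms_alternating)
  note eqs = ce_wt0_lists[OF alt, unfolded c(3) zero_fun_def]
  let ?I = "\<lambda>cs. \<forall>(a, ss)\<in>set cs. length ss = n \<and> weight ss = 0"
  have alts: "alternating (form_of cs)" if "?I cs" for cs
    using form_of_in_forms[of cs n] that by (auto intro: forms_alternating)
  note ev = ce_wt0_lists[OF alts] form_of_eval elem_form_self elem_form_other
  have "n = 0 \<or> n = 1 \<or> n = 2 \<or> n = 3 \<or> n = 4 \<or> n = 5 \<or> n \<ge> 6" by linarith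
  then consider "n = 0" | "n = 1" | "n = 2" | "n = 3" | "n = 4" | "n = 5" | "n \<ge> 6" by blast
  then show ?thesis
  proof cases
    case 1
    show ?thesis
      by (rule wt0_coboundaryI[OF c(1,2), of "[]"])
        (use eqs in \<open>auto simp: 1 wt0_lists_def form_of_simps ce_0\<close>)
  next
    case 2
    show ?thesis
      \<comment> \<open>The rows of [L0,M1] and [Y0,Y1] both prescribe the value on
        \<open>M0\<close>; they are consistent by the cocycle equation at [L0,Y0,Y2].\<close>
      by (rule wt0_coboundaryI[OF c(1,2), of "[(c [L0,L2] / 2, [L1]), (c [L0,M1], [M0])]"])
        (use eqs in \<open>auto simp: 2 wt0_lists_def mode_wt_def ev\<close>)
  next
    case 3
    show ?thesis
      \<comment> \<open>Only the difference of the values on [L0,M1] and [Y0,Y1] enters the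
        differential; the value on [Y0,Y1] is chosen to be 0.\<close>
      by (rule wt0_coboundaryI[OF c(1,2), of "[(- c [L0,Y0,Y2] / 2, [L0,M1]), (- c [Y0,Y1,L1], [L1,M0])]"])
        (use eqs z in \<open>auto simp: 3 wt0_lists_def mode_wt_def ev betti_def class_coord_def eq_neg_iff_add_eq_0\<close>)
  next
    case 4
    show ?thesis
      \<comment> \<open>The values u on [L0,M1,M0] and v on [Y0,Y1,M0] solve the system with
        left-hand sides u + v and -2u + 2v. The value on [Y0,Y1,L1] is chosen to be 0, which
        decouples the other two.\<close>
      by (rule wt0_coboundaryI[OF c(1,2), of "[(c [L0,Y0,Y1,L2], [L0,L2,M0]),
            (c [L0,Y0,Y1,M1] / 2 - c [L0,Y0,Y2,M0] / 4, [L0,M1,M0]),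
            (c [L0,Y0,Y1,M1] / 2 + c [L0,Y0,Y2,M0] / 4, [Y0,Y1,M0]),
            (- c [L0,Y0,Y2,L1] / 2, [L0,M1,L1])]"])
        (use eqs z in \<open>auto simp: 4 wt0_lists_def mode_wt_def ev betti_def class_coord_def\<close>)
  next
    case 5
    show ?thesis
      \<comment> \<open>Three rows determine the three values. The row of [L0,Y0,Y2,L1,M0] then
        agrees because coordinate 1 vanishes, and the entry at [L0,Y0,Y1,M1,M0] is coordinate
        0.\<close>
      by (rule wt0_coboundaryI[OF c(1,2), of "[(- c [L0,Y0,Y1,L2,L1], [L0,L2,L1,M0]),
            (c [L0,Y0,Y1,L2,M0] / 2, [Y0,Y1,L1,M0]),
            (- c [L0,Y0,Y1,M1,L1] - c [L0,Y0,Y1,L2,M0] / 2, [L0,M1,L1,M0])]"])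
        (use z[of 0] z[of 1] in \<open>auto simp: 5 wt0_lists_def mode_wt_def ev betti_def class_coord_def diff_eq_eq\<close>)
  next
    case 6
    show ?thesis
      by (rule wt0_coboundaryI[OF c(1,2), of "[]"])
        (use z[of 0] z[of 1] in \<open>auto simp: 6 wt0_lists_def form_of_simps ce_0 betti_def class_coord_def\<close>)
  next
    case 7
    show ?thesis
      by (rule wt0_coboundaryI[OF c(1,2), of "[]"])
        (use 7 in \<open>auto simp: wt0_lists_def\<close>)
  qed
qed

text \<open>Parts of nonzero weight are exact, and removing them keeps the coordinates, which vanish
  on coboundaries.\<close>

lemma cocycle_exact:
  assumes c: "c \<in> forms (Suc n)" "ce c = 0" and z: "\<And>i. i < betti (Suc n) \<Longrightarrow> class_coord (Suc n) i c = 0"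
  shows "\<exists>b\<in>forms n. ce b = c"
proof -
  from cocycle_homotopic_wt0_part[OF c] obtain b where b: "b \<in> forms n" "c = wt0_part c + ce b" .
  have f: "wt0_part c \<in> forms (Suc n)" unfolding wt0_part_def by (rule wscale_in_forms[OF c(1)])
  have "ce (wt0_part c) = 0" unfolding wt0_part_def ce_wscale c(2) by (simp add: wscale_def fun_eq_iff)
  moreover have "wt0 (wt0_part c)" by (simp add: wt0_def wt0_part_def wscale_def)
  moreover have "class_coord (Suc n) i (wt0_part c) = 0" if "i < betti (Suc n)" for i
  proof -
    have "wt0_part c = lincomb2 1 c (- 1) (ce b)" using b(2) by (auto simp: lincomb2_def fun_eq_iff algebra_simps)
    then show ?thesis using z[OF that] class_coord_ce[OF b(1) that] by (simp add: class_coord_lincomb2)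
  qed
  ultimately obtain a where "a \<in> forms n" "ce a = wt0_part c"
    using wt0_cocycle_exact[OF f] by blast
  then have "a + b \<in> forms n" "ce (a + b) = c" using b by (simp_all add: forms_add ce_add)
  then show ?thesis by blast
qed

lemma wt0_cocycleI:
  assumes "c \<in> forms n" "wt0 c" "\<And>xs. xs \<in> set wt0_lists \<Longrightarrow> length xs = Suc n \<Longrightarrow> ce c xs = 0"
  shows "ce c = 0"
proof (rule wt0_form_eq_0)
  show "alternating (ce c)" using assms(1) by (intro alternating_ce forms_alternating)
  show "wt0 (ce c)" by (rule wt0_ce[OF assms(2)])
  fix xs assume "xs \<in> set wt0_lists"
  then show "ce c xs = 0"
    using assms(3)[of xs] ce_in_forms[OF assms(1)] by (cases "length xs = Suc n") (auto simp: forms_def)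
qed

text \<open>The chosen elementary forms are dual to the coordinates. They are closed: the value at
  [L0,L2,L1] occurs in no row of the differential, and in weight 0 all forms of degree 5 or 6 are
  cocycles.\<close>

lemma cocycle_realize:
  "\<exists>c\<in>forms n. ce c = 0 \<and> (\<forall>i<betti n. class_coord n i c = v i)"
proof -
  have *: "\<exists>c\<in>forms n. ce c = 0 \<and> (\<forall>i<betti n. class_coord n i c = v i)"
    if cs: "\<forall>(a, ss)\<in>set cs. length ss = n \<and> weight ss = 0"
      and cls: "\<And>xs. xs \<in> set wt0_lists \<Longrightarrow> length xs = Suc n \<Longrightarrow> ce (form_of cs) xs = 0"
      and co: "\<And>i. i < betti n \<Longrightarrow> class_coord n i (form_of cs) = v i" for cs
  proof
    show f: "form_of cs \<in> forms n" by (rule form_of_in_forms) (use cs in auto)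
    have "wt0 (form_of cs)" by (rule wt0_form_of) (use cs in auto)
    from wt0_cocycleI[OF f this cls] co
    show "ce (form_of cs) = 0 \<and> (\<forall>i<betti n. class_coord n i (form_of cs) = v i)" by blast
  qed
  have alts: "alternating (form_of cs)" if "\<forall>(a, ss)\<in>set cs. length ss = m" for cs m
    using form_of_in_forms[of cs m] that by (auto intro: forms_alternating)
  consider "n = 3" | "n = 5" | "n = 6" | "betti n = 0" by (force simp: betti_def)
  then show ?thesis
  proof cases
    case 1
    have alt: "alternating (form_of [(v 0, [L0,L2,L1])])" by (rule alts[of _ 3]) simp
    show ?thesis
      by (rule *[of "[(v 0, [L0,L2,L1])]"])
        (auto simp: 1 mode_wt_def wt0_lists_def ce_wt0_lists[OF alt] form_of_eval elem_form_self elem_form_other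
          betti_def class_coord_def)
  next
    case 2
    let ?cs = "[(v 0, [L0,Y0,Y1,M1,M0]), (v (Suc 0), [L0,Y0,Y2,L1,M0])]"
    have alt: "alternating (form_of ?cs)" by (rule alts[of _ 5]) simp
    show ?thesis
      by (rule *[of ?cs])
        (auto simp: 2 mode_wt_def wt0_lists_def ce_wt0_lists[OF alt] form_of_eval elem_form_self elem_form_other
          betti_def class_coord_def less_2_cases_iff)
  next
    case 3
    show ?thesis
      by (rule *[of "[(v 0, [L0,Y0,Y1,L2,L1,M0]), (v 1, [L0,Y0,Y1,M1,L1,M0])]"])
        (auto simp: 3 mode_wt_def wt0_lists_def form_of_eval elem_form_self elem_form_other
          betti_def class_coord_def less_2_cases_iff)
  next
    case 4
    then show ?thesis by (intro bexI[of _ 0]) (auto simp: ce_0 forms_zero)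
  qed
qed

section \<open>Reduced cohomology of forms\<close>

text \<open>Multiplication of cochains by \<open>\<lambda>\<^sub>1 + \<dots> + \<lambda>\<^sub>n\<close> becomes the Lie derivative along \<open>L\<^sub>-\<^sub>1\<close>.\<close>

abbreviation "trans_der \<equiv> lie_der L0"

text \<open>Preimages, among forms, of the cocycles and (below) coboundaries of the quotient
  complex; both therefore contain the image of \<open>trans_der\<close>.\<close>

definition red_cocycles :: "nat \<Rightarrow> sv_form set" where
  "red_cocycles q = {c \<in> forms q. \<exists>b\<in>forms (Suc q). ce c = trans_der b}"

fun red_coboundaries :: "nat \<Rightarrow> sv_form set" where
  "red_coboundaries 0 = {0}"
| "red_coboundaries (Suc p) = {ce a + trans_der b |a b. a \<in> forms p \<and> b \<in> forms (Suc p)}"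

definition red_dim :: "nat \<Rightarrow> nat" where
  "red_dim q = (if q = 0 then 1 else betti q + betti (Suc q))"

text \<open>For every generator, bracketing L_{-1} with exponent e gives -e times exponent e - 1;
  the sign cancels the one in the Lie derivative.\<close>

lemma trans_der_Cons: "trans_der c ((X, e) # ys) = trans_der (contr (X, e) c) ys + of_nat e * c ((X, e - 1) # ys)"
  by (cases X) (simp_all add: lie_der_Cons mode_coef_def mode_mult_def)

text \<open>Let e be the largest exponent for which (X, e) heads a list with nonzero value. With
  head (X, e + 1) only the head contributes to the derivative, and it contributes e + 1 times the
  value of c with head (X, e).\<close>

lemma trans_der_eq_0_iff:
  assumes "c \<in> forms (Suc n)" shows "trans_der c = 0 \<longleftrightarrow> c = 0"
proof
  assume t: "trans_der c = 0"
  show "c = 0"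
  proof (rule ccontr)
    assume "c \<noteq> 0"
    then obtain xs where xs: "c xs \<noteq> 0" by (auto simp: fun_eq_iff)
    with assms have "length xs = Suc n" by (auto simp: forms_def)
    then obtain X e0 ws0 where xs_eq: "xs = (X, e0) # ws0" by (cases xs) auto
    obtain N where N: "mode_bounded N c" using assms by (auto simp: forms_iff)
    define P where "P e \<longleftrightarrow> (\<exists>ws. c ((X, e) # ws) \<noteq> 0)" for e
    have P: "P e0" using xs xs_eq by (auto simp: P_def)
    have bd: "e \<le> N" if "P e" for e using that N by (auto simp: P_def mode_bounded_def)
    define e where "e = (GREATEST e. P e)"
    have "P e" unfolding e_def by (rule GreatestI_nat[where b = N, of P, OF P bd])
    then obtain ws where ws: "c ((X, e) # ws) \<noteq> 0" by (auto simp: P_def)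
    have "\<not> P (Suc e)"
      using Greatest_le_nat[of P "Suc e" N] bd unfolding e_def by auto
    then have "contr (X, Suc e) c = 0" by (auto simp: P_def contr_def fun_eq_iff)
    then have "trans_der c ((X, Suc e) # ws) = of_nat (Suc e) * c ((X, e) # ws)"
      by (simp add: trans_der_Cons lie_der_0)
    with t ws show False by (simp del: of_nat_Suc)
  qed
qed (simp add: lie_der_0)

lemma trans_der_inj:
  assumes "b \<in> forms (Suc n)" "b' \<in> forms (Suc n)" "trans_der b = trans_der b'"
  shows "b = b'"
  using trans_der_eq_0_iff[OF forms_diff[OF assms(1,2)]] assms(3) by (simp add: lie_der_diff)

lemma trans_der_degree_0: "b \<in> forms 0 \<Longrightarrow> trans_der b = 0"
proof
  fix xs assume "b \<in> forms 0"
  then show "trans_der b xs = (0 :: sv_form) xs"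
    using lie_der_in_forms[of b 0 L0] by (cases xs) (auto simp: forms_def)
qed

lemma trans_der_ce: "trans_der (ce c) = ce (trans_der c)"
  by (rule ext) (rule lie_der_ce)

lemma ce_contr: "ce (contr x c) = lie_der x c - contr x (ce c)"
  by (simp add: contr_ce)

text \<open>The form b with d c = \<partial> b. It is a function of the reduced cocycle c because
  \<partial> is injective in positive degree; uniqueness also makes it linear in c.\<close>

definition primitive :: "nat \<Rightarrow> sv_form \<Rightarrow> sv_form" where
  "primitive q c = (THE b. b \<in> forms (Suc q) \<and> ce c = trans_der b)"

lemma primitive_eq: "b \<in> forms (Suc q) \<Longrightarrow> ce c = trans_der b \<Longrightarrow> primitive q c = b"
  unfolding primitive_def by (rule the_equality) (auto intro: trans_der_inj)

text \<open>Closedness holds since \<partial> d b = d \<partial> b = d d c = 0 and \<partial> is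
  injective.\<close>

lemma primitive:
  assumes "c \<in> red_cocycles q"
  shows "primitive q c \<in> forms (Suc q)" "ce c = trans_der (primitive q c)" "ce (primitive q c) = 0"
proof -
  from assms obtain b where b: "b \<in> forms (Suc q)" "ce c = trans_der b" by (auto simp: red_cocycles_def)
  then have p: "primitive q c = b" by (rule primitive_eq)
  have "trans_der (ce b) = 0"
    unfolding trans_der_ce b(2)[symmetric] by (rule ext) (simp add: ce_ce)
  then show "primitive q c \<in> forms (Suc q)" "ce c = trans_der (primitive q c)" "ce (primitive q c) = 0"
    using b trans_der_eq_0_iff[OF ce_in_forms[OF b(1)]] by (simp_all add: p)
qed

lemma lincomb2_red_cocycles:
  assumes "c \<in> red_cocycles q" "e \<in> red_cocycles q"
  shows "lincomb2 r c s e \<in> red_cocycles q"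
    "primitive q (lincomb2 r c s e) = lincomb2 r (primitive q c) s (primitive q e)"
proof -
  let ?b = "lincomb2 r (primitive q c) s (primitive q e)"
  have b: "?b \<in> forms (Suc q)" using assms by (intro forms_lincomb2 primitive)
  have eq: "ce (lincomb2 r c s e) = trans_der ?b"
    unfolding ce_lincomb2 lie_der_lincomb2 using primitive(2)[OF assms(1)] primitive(2)[OF assms(2)] by simp
  show "primitive q (lincomb2 r c s e) = ?b" using b eq by (rule primitive_eq)
  show "lincomb2 r c s e \<in> red_cocycles q"
    using b eq assms by (auto simp: red_cocycles_def intro: forms_lincomb2)
qed

text \<open>A reduced cocycle \<open>c\<close> with \<open>d c = \<partial> b\<close> splits into the basic cocycles \<open>c - \<iota> b\<close> and
  \<open>b\<close>, where \<open>\<iota>\<close> is the contraction with \<open>L\<^sub>-\<^sub>1\<close>, since \<open>d \<iota> b = \<partial> b\<close>.\<close>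

definition red_coord :: "nat \<Rightarrow> sv_form \<Rightarrow> nat \<Rightarrow> complex" where
  "red_coord q c i =
    (if q = 0 then c []
     else if i < betti q then class_coord q i (c - contr L0 (primitive q c))
     else class_coord (Suc q) (i - betti q) (primitive q c))"

lemma red_coord_lincomb2:
  assumes "c \<in> red_cocycles q" "e \<in> red_cocycles q"
  shows "red_coord q (lincomb2 r c s e) i = r * red_coord q c i + s * red_coord q e i"
proof -
  have "lincomb2 r c s e - lincomb2 r (contr L0 (primitive q c)) s (contr L0 (primitive q e))
    = lincomb2 r (c - contr L0 (primitive q c)) s (e - contr L0 (primitive q e))"
    by (auto simp: lincomb2_def fun_eq_iff algebra_simps)
  then show ?thesis
    unfolding red_coord_def lincomb2_red_cocycles(2)[OF assms] contr_lincomb2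
    by (simp add: class_coord_lincomb2) (simp add: lincomb2_def)
qed

lemma red_coboundaries_sub: "red_coboundaries q \<subseteq> red_cocycles q"
proof
  fix c assume c: "c \<in> red_coboundaries q"
  show "c \<in> red_cocycles q"
  proof (cases q)
    case 0
    with c show ?thesis by (auto simp: red_cocycles_def forms_zero ce_0 lie_der_0 intro!: bexI[of _ 0])
  next
    case (Suc p)
    with c obtain a b where ab: "a \<in> forms p" "b \<in> forms (Suc p)" "c = ce a + trans_der b" by auto
    have "ce c = trans_der (ce b)"
      unfolding ab(3) ce_add trans_der_ce by (rule ext) (simp add: ce_ce)
    then show ?thesis using ab ce_in_forms[OF ab(2)] unfolding Suc red_cocycles_def
      by (auto intro!: forms_add ce_in_forms lie_der_in_forms)
  qed
qed

text \<open>Put z = c - \<iota> b. If z = d e and b = d a, then \<iota> d a = \<partial> a - d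
  \<iota> a gives c = d (e - \<iota> a) + \<partial> a. Conversely c = d e + \<partial> a has b = d
  a by uniqueness and z = d (e + \<iota> a).\<close>

lemma red_coord_kernel:
  assumes c: "c \<in> red_cocycles q"
  shows "(\<forall>i<red_dim q. red_coord q c i = 0) \<longleftrightarrow> c \<in> red_coboundaries q"
proof (cases q)
  case 0
  have "c = 0" if "c [] = 0"
  proof
    fix xs show "c xs = (0 :: sv_form) xs"
      using that c 0 by (cases xs) (auto simp: red_cocycles_def forms_def)
  qed
  then show ?thesis by (auto simp: 0 red_dim_def red_coord_def)
next
  case (Suc p)
  define b where "b = primitive q c"
  have b: "b \<in> forms (Suc q)" "ce c = trans_der b" "ce b = 0"
    using primitive[OF c] by (simp_all add: b_def)
  have cf: "c \<in> forms q" using c by (simp add: red_cocycles_def)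
  define z where "z = c - contr L0 b"
  have zf: "z \<in> forms q" unfolding z_def using cf b(1) by (intro forms_diff contr_in_forms)
  have z0: "ce z = 0" unfolding z_def ce_diff ce_contr b by (rule ext) (simp add: contr_def)
  show ?thesis
  proof
    assume all: "\<forall>i<red_dim q. red_coord q c i = 0"
    have "class_coord q i z = 0" if "i < betti q" for i
      using all[rule_format, of i] that by (simp add: Suc red_dim_def red_coord_def z_def b_def)
    then obtain e where e: "e \<in> forms p" "ce e = z"
      using cocycle_exact[of z p] zf z0 Suc by auto
    have "class_coord (Suc q) i b = 0" if "i < betti (Suc q)" for i
      using all[rule_format, of "betti q + i"] that by (simp add: Suc red_dim_def red_coord_def b_def)
    then obtain a where a: "a \<in> forms q" "ce a = b"
      using cocycle_exact[of b q] b by auto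
    have "c = ce (e - contr L0 a) + trans_der a"
      unfolding ce_diff ce_contr a(2) e(2) z_def by simp
    moreover have "e - contr L0 a \<in> forms p" using e(1) a(1) Suc by (intro forms_diff contr_in_forms) auto
    ultimately show "c \<in> red_coboundaries q" using a(1) Suc by auto
  next
    assume "c \<in> red_coboundaries q"
    then obtain e a where ea: "e \<in> forms p" "a \<in> forms q" "c = ce e + trans_der a" using Suc by auto
    have "ce c = trans_der (ce a)"
      unfolding ea(3) ce_add trans_der_ce by (rule ext) (simp add: ce_ce)
    then have b_eq: "b = ce a" unfolding b_def by (intro primitive_eq ce_in_forms ea(2))
    have z_eq: "z = ce (e + contr L0 a)"
      unfolding z_def b_eq ea(3) ce_add ce_contr by (simp add: algebra_simps)
    have "e + contr L0 a \<in> forms p" using ea Suc by (intro forms_add contr_in_forms) auto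
    then have "class_coord q i z = 0" if "i < betti q" for i
      unfolding z_eq Suc using that Suc by (intro class_coord_ce) auto
    moreover have "class_coord (Suc q) i b = 0" if "i < betti (Suc q)" for i
      unfolding b_eq by (rule class_coord_ce[OF ea(2) that])
    ultimately show "\<forall>i<red_dim q. red_coord q c i = 0"
      by (auto simp: Suc red_dim_def red_coord_def z_def b_def)
  qed
qed

text \<open>The splitting is inverted by u + \<iota> b, for basic cocycles u and b with the
  prescribed coordinates.\<close>

lemma red_coord_surj: "\<exists>c\<in>red_cocycles q. \<forall>i<red_dim q. red_coord q c i = v i"
proof (cases q)
  case 0
  define c :: sv_form where "c = (\<lambda>xs. if xs = [] then v 0 else 0)"
  have "c \<in> forms 0" by (auto simp: c_def forms_iff homogeneous_def alternating_def mode_bounded_def)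
  moreover have "ce c = 0"
  proof
    fix xs
    have "contr x c = 0" for x by (rule ext) (simp add: contr_def c_def)
    moreover have "lie_der x c ys = 0" for x ys
      using lie_der_in_forms[OF \<open>c \<in> forms 0\<close>, of x] by (cases ys) (auto simp: forms_def)
    ultimately show "ce c xs = (0 :: sv_form) xs" by (cases xs) (simp_all add: ce_Cons ce_0)
  qed
  ultimately have "c \<in> red_cocycles 0"
    by (auto simp: red_cocycles_def forms_zero lie_der_0 intro!: bexI[of _ 0])
  then show ?thesis by (intro bexI[of _ c]) (auto simp: 0 red_dim_def red_coord_def c_def)
next
  case (Suc p)
  obtain u where u: "u \<in> forms q" "ce u = 0" "\<forall>i<betti q. class_coord q i u = v i"
    using cocycle_realize by blast
  obtain b where b: "b \<in> forms (Suc q)" "ce b = 0" "\<forall>i<betti (Suc q). class_coord (Suc q) i b = v (betti q + i)"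
    using cocycle_realize[of "Suc q" "\<lambda>i. v (betti q + i)"] by blast
  define c where "c = u + contr L0 b"
  have eq: "ce c = trans_der b" unfolding c_def ce_add ce_contr u b by (rule ext) (simp add: contr_def)
  have cf: "c \<in> forms q" unfolding c_def by (intro forms_add contr_in_forms u b)
  have "c \<in> red_cocycles q" using cf eq b(1) by (auto simp: red_cocycles_def)
  moreover have "primitive q c = b" by (rule primitive_eq[OF b(1) eq])
  then have "red_coord q c i = v i" if "i < red_dim q" for i
    using that u(3) b(3)[rule_format, of "i - betti q"] by (auto simp: red_coord_def red_dim_def Suc c_def)
  ultimately show ?thesis by blast
qed

section \<open>Quotient modules and their dimension\<close>

text \<open>A module whose elements are named by representatives in Z, via P. Forming a quotient
  changes only P, so cosets of cosets are still handled through plain cochains. The module axioms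
  for V are not assumed but obtained in \<open>dim_by_coordinates\<close>.\<close>

locale presented_module =
  fixes scl :: "complex \<Rightarrow> 'g::ab_group_add \<Rightarrow> 'g" and Z :: "'g set"
    and V :: "(complex, 'v) module" and P :: "'g \<Rightarrow> 'v"
  assumes scl_add: "scl c (x + y) = scl c x + scl c y"
    and Z_0: "0 \<in> Z" and Z_add: "x \<in> Z \<Longrightarrow> y \<in> Z \<Longrightarrow> x + y \<in> Z" and Z_scl: "x \<in> Z \<Longrightarrow> scl c x \<in> Z"
    and carrier_eq: "carrier V = P ` Z"
    and P_add: "x \<in> Z \<Longrightarrow> y \<in> Z \<Longrightarrow> P x \<oplus>\<^bsub>V\<^esub> P y = P (x + y)"
    and P_scl: "x \<in> Z \<Longrightarrow> c \<odot>\<^bsub>V\<^esub> P x = P (scl c x)"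
    and P_0: "\<zero>\<^bsub>V\<^esub> = P 0"
begin

definition coset_of :: "'g set \<Rightarrow> 'g \<Rightarrow> 'v set" where
  "coset_of B z = (\<lambda>b. P (b + z)) ` B"

context
  fixes B :: "'g set"
  assumes B_Z: "B \<subseteq> Z" and B_0: "0 \<in> B" and B_add: "x \<in> B \<Longrightarrow> y \<in> B \<Longrightarrow> x + y \<in> B"
    and B_scl: "x \<in> B \<Longrightarrow> scl c x \<in> B"
begin

lemma coset_of_eq: "z \<in> Z \<Longrightarrow> (P ` B) +>\<^bsub>V\<^esub> P z = coset_of B z"
  using B_Z by (auto simp: a_r_coset_def' coset_of_def P_add subset_iff image_iff)

lemma coset_of_add:
  assumes "x \<in> Z" "y \<in> Z" shows "coset_of B x <+>\<^bsub>V\<^esub> coset_of B y = coset_of B (x + y)"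
proof -
  have eq: "P (b + x) \<oplus>\<^bsub>V\<^esub> P (b' + y) = P (b + b' + (x + y))" if "b \<in> B" "b' \<in> B" for b b'
  proof -
    have "b + x \<in> Z" "b' + y \<in> Z" using that B_Z assms Z_add by blast+
    then show ?thesis by (simp add: P_add algebra_simps)
  qed
  show ?thesis
  proof (intro equalityI subsetI)
    fix w assume "w \<in> coset_of B x <+>\<^bsub>V\<^esub> coset_of B y"
    then obtain b b' where "b \<in> B" "b' \<in> B" "w = P (b + x) \<oplus>\<^bsub>V\<^esub> P (b' + y)"
      by (auto simp: set_add_def' coset_of_def)
    then show "w \<in> coset_of B (x + y)" using eq B_add by (auto simp: coset_of_def)
  next
    fix w assume "w \<in> coset_of B (x + y)"
    then obtain b where b: "b \<in> B" "w = P (b + (x + y))" by (auto simp: coset_of_def)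
    then have "w = P (b + x) \<oplus>\<^bsub>V\<^esub> P (0 + y)" using eq[OF b(1) B_0] by simp
    then show "w \<in> coset_of B x <+>\<^bsub>V\<^esub> coset_of B y"
      using b(1) B_0 unfolding set_add_def' coset_of_def by blast
  qed
qed

lemma coset_of_scl:
  assumes "x \<in> Z"
  shows "(\<Union>X\<in>coset_of B x. (P ` B) +>\<^bsub>V\<^esub> (c \<odot>\<^bsub>V\<^esub> X)) = coset_of B (scl c x)"
proof -
  have eq: "(P ` B) +>\<^bsub>V\<^esub> (c \<odot>\<^bsub>V\<^esub> P (b + x)) = coset_of B (scl c b + scl c x)" if "b \<in> B" for b
  proof -
    have "b + x \<in> Z" using that B_Z assms Z_add by blast
    then show ?thesis by (simp add: P_scl coset_of_eq Z_scl flip: scl_add)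
  qed
  show ?thesis
  proof (intro equalityI subsetI)
    fix w assume "w \<in> (\<Union>X\<in>coset_of B x. (P ` B) +>\<^bsub>V\<^esub> (c \<odot>\<^bsub>V\<^esub> X))"
    then obtain b b' where "b \<in> B" "b' \<in> B" "w = P (b' + (scl c b + scl c x))"
      using eq by (auto simp: coset_of_def)
    then show "w \<in> coset_of B (scl c x)"
      using B_add[OF _ B_scl, of b' b c] unfolding coset_of_def
      by (auto simp: add.assoc intro!: image_eqI[of _ _ "b' + scl c b"])
  next
    fix w assume "w \<in> coset_of B (scl c x)"
    then have "w \<in> coset_of B (scl c 0 + scl c x)" by (simp flip: scl_add)
    then have "w \<in> (P ` B) +>\<^bsub>V\<^esub> (c \<odot>\<^bsub>V\<^esub> P (0 + x))" using eq[OF B_0] by simp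
    then show "w \<in> (\<Union>X\<in>coset_of B x. (P ` B) +>\<^bsub>V\<^esub> (c \<odot>\<^bsub>V\<^esub> X))"
      using B_0 unfolding coset_of_def by blast
  qed
qed

lemma presented_module_quot: "presented_module scl Z (quot_module V (P ` B)) (coset_of B)"
proof
  show "carrier (quot_module V (P ` B)) = coset_of B ` Z"
    by (auto simp: quot_module_def A_RCOSETS_def' carrier_eq coset_of_eq)
qed (auto simp: scl_add Z_0 Z_add Z_scl quot_module_def coset_of_add coset_of_scl, auto simp: coset_of_def)

text \<open>Equality of cosets in V lifts to representatives only up to the kernel of P, hence the
  condition that B contains this kernel.\<close>

lemma coset_of_eq_iff:
  assumes "x \<in> Z" "y \<in> Z" and ker: "\<And>x y. x \<in> Z \<Longrightarrow> y \<in> Z \<Longrightarrow> P x = P y \<Longrightarrow> x - y \<in> B"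
    and B_minus: "\<And>x. x \<in> B \<Longrightarrow> - x \<in> B"
  shows "coset_of B x = coset_of B y \<longleftrightarrow> x - y \<in> B"
proof
  assume "coset_of B x = coset_of B y"
  then have "P (0 + x) \<in> coset_of B y" using B_0 unfolding coset_of_def by blast
  then obtain b where b: "b \<in> B" "P (b + y) = P x" by (auto simp: coset_of_def)
  then have "x - (b + y) \<in> B" using ker[of x "b + y"] assms(1,2) B_Z Z_add by force
  from B_add[OF this b(1)] show "x - y \<in> B" by (simp add: algebra_simps)
next
  have *: "coset_of B x \<subseteq> coset_of B y" if "x - y \<in> B" for x y
  proof
    fix w assume "w \<in> coset_of B x"
    then obtain b where b: "b \<in> B" "w = P (b + x)" by (auto simp: coset_of_def)
    then have "w = P ((b + (x - y)) + y)" by (simp add: algebra_simps)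
    then show "w \<in> coset_of B y" using B_add[OF b(1) that] unfolding coset_of_def by blast
  qed
  assume "x - y \<in> B"
  moreover from B_minus[OF this] have "y - x \<in> B" by simp
  ultimately show "coset_of B x = coset_of B y" using * by blast
qed

end

lemma presented_submodule:
  assumes "Z' \<subseteq> Z" "0 \<in> Z'" "\<And>x y. x \<in> Z' \<Longrightarrow> y \<in> Z' \<Longrightarrow> x + y \<in> Z'" "\<And>c x. x \<in> Z' \<Longrightarrow> scl c x \<in> Z'"
  shows "presented_module scl Z' (V\<lparr>carrier := P ` Z'\<rparr>) P"
  by standard (use assms P_0 in \<open>auto simp: scl_add P_add P_scl subset_iff\<close>)

text \<open>The coordinates identify V with n-dimensional column vectors; their inverse g transports
  the vector space axioms, finite dimensionality and the dimension to V.\<close>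

lemma dim_by_coordinates:
  fixes f :: "'g \<Rightarrow> nat \<Rightarrow> complex"
  assumes f_add: "\<And>x y i. x \<in> Z \<Longrightarrow> y \<in> Z \<Longrightarrow> f (x + y) i = f x i + f y i"
    and f_scl: "\<And>c x i. x \<in> Z \<Longrightarrow> f (scl c x) i = c * f x i"
    and surj: "\<And>v. \<exists>z\<in>Z. \<forall>i<n. f z i = v i"
    and ker: "\<And>x y. x \<in> Z \<Longrightarrow> y \<in> Z \<Longrightarrow> P x = P y \<longleftrightarrow> (\<forall>i<n. f x i = f y i)"
  shows "vectorspace class_ring V \<and> vectorspace.fin_dim class_ring V \<and> vectorspace.dim class_ring V = n"
proof -
  define r where "r v = (SOME z. z \<in> Z \<and> (\<forall>i<n. f z i = v $ i))" for v :: "complex vec"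
  define g where "g v = P (r v)" for v
  have r: "r v \<in> Z \<and> (\<forall>i<n. f (r v) i = v $ i)" for v
    unfolding r_def by (rule someI_ex) (use surj[of "\<lambda>i. v $ i"] in blast)
  \<comment> \<open>The choice r need not be linear, but P z depends only on the first n coordinates
    of z; this makes g linear.\<close>
  have gP: "g v = P z" if "z \<in> Z" "\<forall>i<n. f z i = v $ i" for v z
    unfolding g_def using ker[of "r v" z] r that by auto
  have g_add: "g v \<oplus>\<^bsub>V\<^esub> g w = g (v + w)" if "v \<in> carrier_vec n" "w \<in> carrier_vec n" for v w
    using r[of v] r[of w] that gP[of "r v + r w" "v + w"] by (simp add: g_def P_add Z_add f_add)
  have g_scl: "c \<odot>\<^bsub>V\<^esub> g v = g (c \<cdot>\<^sub>v v)" if "v \<in> carrier_vec n" for c v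
    using r[of v] that gP[of "scl c (r v)" "c \<cdot>\<^sub>v v"] by (simp add: g_def P_scl Z_scl f_scl)
  have f0: "f 0 i = 0" for i using f_add[OF Z_0 Z_0, of i] by simp
  have g_0: "\<zero>\<^bsub>V\<^esub> = g (0\<^sub>v n)"
    using gP[of 0 "0\<^sub>v n"] f0 Z_0 by (simp add: P_0)
  have carr: "carrier V = g ` carrier_vec n"
  proof
    show "g ` carrier_vec n \<subseteq> carrier V" using r by (auto simp: g_def carrier_eq)
    show "carrier V \<subseteq> g ` carrier_vec n"
    proof
      fix x assume "x \<in> carrier V"
      then obtain z where z: "z \<in> Z" "x = P z" by (auto simp: carrier_eq)
      then have "x = g (vec n (f z))" using gP[of z "vec n (f z)"] by simp
      then show "x \<in> g ` carrier_vec n" by auto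
    qed
  qed
  have g_inj: "inj_on g (carrier_vec n)"
  proof (rule inj_onI)
    fix v w assume "v \<in> carrier_vec n" "w \<in> carrier_vec n" "g v = g w"
    then show "v = w" using r[of v] r[of w] ker[of "r v" "r w"] by (intro eq_vecI) (auto simp: g_def)
  qed
  have ag: "abelian_group V"
  proof (rule abelian_groupI)
    show "\<zero>\<^bsub>V\<^esub> \<in> carrier V" unfolding carr g_0 by auto
    fix x assume "x \<in> carrier V"
    then obtain v where v: "v \<in> carrier_vec n" "x = g v" unfolding carr by auto
    show "\<zero>\<^bsub>V\<^esub> \<oplus>\<^bsub>V\<^esub> x = x" using v by (simp add: g_0 g_add)
    show "\<exists>y\<in>carrier V. y \<oplus>\<^bsub>V\<^esub> x = \<zero>\<^bsub>V\<^esub>"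
      unfolding carr g_0 using v by (intro bexI[of _ "g (- v)"]) (auto simp: g_add)
    fix y assume "y \<in> carrier V"
    then obtain w where w: "w \<in> carrier_vec n" "y = g w" unfolding carr by auto
    show "x \<oplus>\<^bsub>V\<^esub> y \<in> carrier V" unfolding carr using v w by (auto simp: g_add)
    show "x \<oplus>\<^bsub>V\<^esub> y = y \<oplus>\<^bsub>V\<^esub> x" using v w by (simp add: g_add comm_add_vec)
    fix z assume "z \<in> carrier V"
    then obtain u where u: "u \<in> carrier_vec n" "z = g u" unfolding carr by auto
    show "x \<oplus>\<^bsub>V\<^esub> y \<oplus>\<^bsub>V\<^esub> z = x \<oplus>\<^bsub>V\<^esub> (y \<oplus>\<^bsub>V\<^esub> z)" using v w u by (simp add: g_add)
  qed
  have "Module.module class_ring V"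
  proof (intro Module.module.intro)
    show "cring (class_ring :: complex ring)" using class_field[where ?'a = complex] by (simp add: field_def domain_def)
    show "abelian_group V" by (rule ag)
    show "module_axioms class_ring V"
    proof
      fix a b :: complex and x y assume xy: "x \<in> carrier V" "y \<in> carrier V"
      then obtain v w where v: "v \<in> carrier_vec n" "x = g v" and w: "w \<in> carrier_vec n" "y = g w" unfolding carr by auto
      show "a \<odot>\<^bsub>V\<^esub> x \<in> carrier V" using v by (auto simp: carr g_scl)
      show "(a \<oplus>\<^bsub>class_ring\<^esub> b) \<odot>\<^bsub>V\<^esub> x = a \<odot>\<^bsub>V\<^esub> x \<oplus>\<^bsub>V\<^esub> b \<odot>\<^bsub>V\<^esub> x"
        using v by (simp add: g_scl g_add class_ring_simps add_smult_distrib_vec)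
      show "a \<odot>\<^bsub>V\<^esub> (x \<oplus>\<^bsub>V\<^esub> y) = a \<odot>\<^bsub>V\<^esub> x \<oplus>\<^bsub>V\<^esub> a \<odot>\<^bsub>V\<^esub> y"
        using v w by (simp add: g_scl g_add smult_add_distrib_vec)
      show "(a \<otimes>\<^bsub>class_ring\<^esub> b) \<odot>\<^bsub>V\<^esub> x = a \<odot>\<^bsub>V\<^esub> (b \<odot>\<^bsub>V\<^esub> x)"
        using v by (simp add: g_scl class_ring_simps smult_smult_assoc)
      show "\<one>\<^bsub>class_ring\<^esub> \<odot>\<^bsub>V\<^esub> x = x" using v by (simp add: g_scl class_ring_simps)
    qed
  qed
  then have vs: "vectorspace class_ring V"
    unfolding vectorspace_def using class_field by blast
  interpret C: vec_space "TYPE(complex)" n .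
  have hom: "g \<in> LinearCombinations.module_hom class_ring (module_vec TYPE(complex) n) V"
    unfolding LinearCombinations.module_hom_def by (auto simp: carr module_vec_simps g_add g_scl)
  interpret lm: linear_map class_ring "module_vec TYPE(complex) n" V g
    unfolding linear_map_def mod_hom_def mod_hom_axioms_def
    using vs hom vec_vs vec_module \<open>Module.module class_ring V\<close> by blast
  have "C.fin_dim" by (rule C.fin_dim)
  have im: "g ` carrier (module_vec TYPE(complex) n) = carrier V" by (simp add: carr module_vec_simps)
  have inj: "inj_on g (carrier (module_vec TYPE(complex) n))" using g_inj by (simp add: module_vec_simps)
  have "vectorspace.dim class_ring V = n"
    using lm.dim_eq[OF C.fin_dim inj im] C.dim_is_n by simp
  moreover have "vectorspace.fin_dim class_ring V" using lm.surj_fin_dim[OF C.fin_dim im] .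
  ultimately show ?thesis using vs by simp
qed

end

section \<open>Divided-power coefficients of polynomials\<close>

lemma mp_const_add: "mp_const (a + b) = mp_const a + mp_const b"
  and mp_const_mult: "mp_const (a * b) = mp_const a * mp_const b"
  and mp_const_0 [simp]: "mp_const 0 = 0" and mp_const_1 [simp]: "mp_const 1 = 1"
  and mp_const_minus: "mp_const (- a) = - mp_const a"
  by (simp_all add: mp_const_def single_add mult_single single_uminus)

lemma mp_const_single: "mp_const c * Poly_Mapping.single m d = Poly_Mapping.single m (c * d)"
  by (simp add: mp_const_def mult_single)

lemma mpol_sum_single: "(p :: mpol) = (\<Sum>m\<in>Poly_Mapping.keys p. Poly_Mapping.single m (Poly_Mapping.lookup p m))"
  by (rule poly_mapping_eqI)
    (auto simp: lookup_sum lookup_single when_def in_keys_iff if_distrib[of "\<lambda>f. f _"] cong: if_cong)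

lemma lam_power: "lam k ^ v = Poly_Mapping.single (Poly_Mapping.single k v) 1"
  by (induction v) (simp_all add: lam_def mult_single flip: single_add)

lemma mp_vars_add: "mp_vars (p + q) \<subseteq> mp_vars p \<union> mp_vars q"
  using keys_add[of p q] unfolding mp_vars_def by blast

lemma mp_vars_mult: "mp_vars (p * q) \<subseteq> mp_vars p \<union> mp_vars q"
proof
  fix i assume "i \<in> mp_vars (p * q)"
  then obtain m where m: "m \<in> Poly_Mapping.keys (p * q)" "i \<in> Poly_Mapping.keys m" by (auto simp: mp_vars_def)
  from m(1) keys_mult[of p q] obtain a b where ab: "m = a + b" "a \<in> Poly_Mapping.keys p" "b \<in> Poly_Mapping.keys q" by blast
  with m(2) keys_add[of a b] show "i \<in> mp_vars p \<union> mp_vars q" by (auto simp: mp_vars_def)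
qed

lemma mp_vars_const [simp]: "mp_vars (mp_const c) = {}"
  by (simp add: mp_vars_def mp_const_def)

lemma mp_vars_lam [simp]: "mp_vars (lam k) = {k}"
  by (simp add: mp_vars_def lam_def)

lemma mp_vars_0 [simp]: "mp_vars 0 = {}" and mp_vars_1 [simp]: "mp_vars 1 = {}"
  by (simp_all add: mp_vars_def)

lemma mp_vars_minus [simp]: "mp_vars (- p) = mp_vars p"
  by (simp add: mp_vars_def)

lemma mp_vars_sum: "(\<And>x. x \<in> A \<Longrightarrow> mp_vars (f x) \<subseteq> M) \<Longrightarrow> mp_vars (sum f A) \<subseteq> M"
  by (induction A rule: infinite_finite_induct) (use mp_vars_add in fastforce)+

lemma mp_vars_prod: "(\<And>x. x \<in> A \<Longrightarrow> mp_vars (f x) \<subseteq> M) \<Longrightarrow> mp_vars (prod f A) \<subseteq> M"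
  by (induction A rule: infinite_finite_induct) (use mp_vars_mult in fastforce)+

lemma mp_vars_power: "mp_vars (p ^ n) \<subseteq> mp_vars p"
  by (induction n) (use mp_vars_mult in fastforce)+

text \<open>Additive identities between polynomials need checking only for constants and under
  multiplication by a variable; the bound on the variables is carried along.\<close>

lemma mpol_vars_induct [consumes 1, case_names const add lam]:
  assumes vars: "mp_vars p \<subseteq> M"
    and const: "\<And>c. P (mp_const c)"
    and add: "\<And>p q. mp_vars p \<subseteq> M \<Longrightarrow> mp_vars q \<subseteq> M \<Longrightarrow> P p \<Longrightarrow> P q \<Longrightarrow> P (p + q)"
    and lam: "\<And>k q. k \<in> M \<Longrightarrow> mp_vars q \<subseteq> M \<Longrightarrow> P q \<Longrightarrow> P (lam k * q)"
  shows "P p"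
proof -
  have vlam: "mp_vars (lam k * q) \<subseteq> M" if "k \<in> M" "mp_vars q \<subseteq> M" for k q
    using that mp_vars_mult[of "lam k" q] by auto
  have pow: "P (lam k ^ v * q) \<and> mp_vars (lam k ^ v * q) \<subseteq> M" if "k \<in> M" "mp_vars q \<subseteq> M" "P q" for k v q
    using that by (induction v) (auto simp: mult.assoc intro: lam vlam[THEN subsetD])
  have mon: "P (Poly_Mapping.single m c)" if "Poly_Mapping.keys m \<subseteq> M" for m :: "nat \<Rightarrow>\<^sub>0 nat" and c
    using that
  proof (induction m rule: update_induct)
    case const
    then show ?case using assms(2)[of c] by (simp add: mp_const_def)
  next
    case (update m k v)
    have ku: "Poly_Mapping.keys (Poly_Mapping.update k v m) = insert k (Poly_Mapping.keys m)"
      using update by (simp add: keys_update)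
    have "Poly_Mapping.update k v m = Poly_Mapping.single k v + m"
      using update(1) by (intro poly_mapping_eqI) (auto simp: lookup_update lookup_add lookup_single when_def in_keys_iff)
    then have "Poly_Mapping.single (Poly_Mapping.update k v m) c = lam k ^ v * Poly_Mapping.single m c"
      by (simp add: lam_power mult_single)
    moreover have "mp_vars (Poly_Mapping.single m c) \<subseteq> M"
      using update.prems ku by (auto simp: mp_vars_def split: if_splits)
    ultimately show ?case using pow[of k "Poly_Mapping.single m c" v] update.IH update.prems ku by auto
  qed
  have "P (\<Sum>m\<in>A. Poly_Mapping.single m (Poly_Mapping.lookup p m)) \<and>
      mp_vars (\<Sum>m\<in>A. Poly_Mapping.single m (Poly_Mapping.lookup p m)) \<subseteq> M"
    if "finite A" "A \<subseteq> Poly_Mapping.keys p" for A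
    using that
  proof (induction A)
    case empty
    show ?case using const[of 0] by (simp add: mp_vars_def)
  next
    case (insert m A)
    have k: "Poly_Mapping.keys m \<subseteq> M" using insert.prems vars by (auto simp: mp_vars_def)
    then have v: "mp_vars (Poly_Mapping.single m (Poly_Mapping.lookup p m)) \<subseteq> M" by (auto simp: mp_vars_def split: if_splits)
    let ?f = "Poly_Mapping.single m (Poly_Mapping.lookup p m)"
      and ?g = "\<Sum>m\<in>A. Poly_Mapping.single m (Poly_Mapping.lookup p m)"
    have "P ?g" "mp_vars ?g \<subseteq> M" using insert by auto
    with add[OF v _ mon[OF k], of ?g] mp_vars_add[of ?f ?g] v insert.hyps show ?case by auto
  qed
  from this[of "Poly_Mapping.keys p"] show ?thesis using mpol_sum_single[of p] by simp
qed

lemma mpol_induct [case_names const add lam]: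
  assumes "\<And>c. P (mp_const c)" "\<And>p q. P p \<Longrightarrow> P q \<Longrightarrow> P (p + q)" "\<And>k q. P q \<Longrightarrow> P (lam k * q)"
  shows "P p"
  by (rule mpol_vars_induct[of p UNIV]) (use assms in auto)

section \<open>Substitution as a ring homomorphism\<close>

definition mon_subst :: "(nat \<Rightarrow> mpol) \<Rightarrow> (nat \<Rightarrow>\<^sub>0 nat) \<Rightarrow> mpol" where
  "mon_subst \<sigma> m = (\<Prod>i\<in>Poly_Mapping.keys m. \<sigma> i ^ Poly_Mapping.lookup m i)"

lemma mon_subst_superset:
  "finite A \<Longrightarrow> Poly_Mapping.keys m \<subseteq> A \<Longrightarrow> mon_subst \<sigma> m = (\<Prod>i\<in>A. \<sigma> i ^ Poly_Mapping.lookup m i)"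
  unfolding mon_subst_def by (rule prod.mono_neutral_left) (auto simp: in_keys_iff)

lemma mon_subst_add: "mon_subst \<sigma> (m + m') = mon_subst \<sigma> m * mon_subst \<sigma> m'"
  using keys_add[of m m']
  by (simp add: mon_subst_superset[of "Poly_Mapping.keys m \<union> Poly_Mapping.keys m'"] lookup_add power_add prod.distrib)

lemma mp_subst_superset:
  "finite A \<Longrightarrow> Poly_Mapping.keys p \<subseteq> A \<Longrightarrow>
    mp_subst \<sigma> p = (\<Sum>m\<in>A. mp_const (Poly_Mapping.lookup p m) * mon_subst \<sigma> m)"
  unfolding mp_subst_def mon_subst_def[symmetric] by (rule sum.mono_neutral_left) (auto simp: in_keys_iff)

lemma mp_subst_add: "mp_subst \<sigma> (p + q) = mp_subst \<sigma> p + mp_subst \<sigma> q"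
  using keys_add[of p q]
  by (simp add: mp_subst_superset[of "Poly_Mapping.keys p \<union> Poly_Mapping.keys q"] lookup_add mp_const_add
      distrib_right sum.distrib)

lemma mp_subst_single: "mp_subst \<sigma> (Poly_Mapping.single m c) = mp_const c * mon_subst \<sigma> m"
  by (simp add: mp_subst_superset[of "{m}"])

lemma mp_subst_const [simp]: "mp_subst \<sigma> (mp_const c) = mp_const c"
  unfolding mp_const_def[of c] by (simp add: mp_subst_single) (simp add: mon_subst_def mp_const_def)

lemma mp_subst_lam_mult: "mp_subst \<sigma> (lam k * p) = \<sigma> k * mp_subst \<sigma> p"
proof -
  have "mp_subst \<sigma> (lam k * (\<Sum>m\<in>A. Poly_Mapping.single m (Poly_Mapping.lookup p m))) =
    \<sigma> k * mp_subst \<sigma> (\<Sum>m\<in>A. Poly_Mapping.single m (Poly_Mapping.lookup p m))" if "finite A" for A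
    using that
  proof (induction A)
    case empty
    then show ?case by (simp add: mp_subst_def)
  next
    case (insert m A)
    have "mp_subst \<sigma> (lam k * Poly_Mapping.single m c) = \<sigma> k * mp_subst \<sigma> (Poly_Mapping.single m c)" for c
      by (simp add: lam_def mult_single mp_subst_single mon_subst_add) (simp add: mon_subst_def)
    with insert show ?case by (simp add: distrib_left mp_subst_add)
  qed
  from this[of "Poly_Mapping.keys p"] mpol_sum_single[of p] show ?thesis by simp
qed

lemma mp_subst_0 [simp]: "mp_subst \<sigma> 0 = 0" and mp_subst_1 [simp]: "mp_subst \<sigma> 1 = 1"
  using mp_subst_const[of \<sigma> 0] mp_subst_const[of \<sigma> 1] by simp_all

lemma mp_subst_lam [simp]: "mp_subst \<sigma> (lam k) = \<sigma> k"
  using mp_subst_lam_mult[of \<sigma> k 1] by simp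

lemma mp_subst_const_mult: "mp_subst \<sigma> (mp_const c * p) = mp_const c * mp_subst \<sigma> p"
  by (induction p rule: mpol_induct)
    (simp_all add: mp_subst_add distrib_left mp_subst_lam_mult mult.left_commute flip: mp_const_mult)

lemma mp_subst_mult: "mp_subst \<sigma> (p * q) = mp_subst \<sigma> p * mp_subst \<sigma> q"
  by (induction p rule: mpol_induct)
    (simp_all add: mp_subst_add distrib_right mp_subst_lam_mult mult.assoc mp_subst_const_mult)

lemma mp_subst_uminus: "mp_subst \<sigma> (- p) = - mp_subst \<sigma> p"
  using mp_subst_add[of \<sigma> p "- p"] by (simp add: add_eq_0_iff)

lemma mp_subst_power: "mp_subst \<sigma> (p ^ n) = mp_subst \<sigma> p ^ n"
  by (induction n) (simp_all add: mp_subst_mult)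

lemma mp_subst_sum: "mp_subst \<sigma> (sum f A) = (\<Sum>x\<in>A. mp_subst \<sigma> (f x))"
  by (induction A rule: infinite_finite_induct) (simp_all add: mp_subst_add)

lemma mp_subst_prod: "mp_subst \<sigma> (prod f A) = (\<Prod>x\<in>A. mp_subst \<sigma> (f x))"
  by (induction A rule: infinite_finite_induct) (simp_all add: mp_subst_mult)

lemma mp_subst_cong: "(\<And>i. i \<in> mp_vars p \<Longrightarrow> \<sigma> i = \<tau> i) \<Longrightarrow> mp_subst \<sigma> p = mp_subst \<tau> p"
proof -
  assume *: "\<And>i. i \<in> mp_vars p \<Longrightarrow> \<sigma> i = \<tau> i"
  have "\<sigma> i = \<tau> i" if "m \<in> Poly_Mapping.keys p" "i \<in> Poly_Mapping.keys m" for m i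
    using that by (intro *) (auto simp: mp_vars_def)
  then show ?thesis unfolding mp_subst_def by simp
qed

lemma mp_vars_subst: "(\<And>i. i \<in> mp_vars p \<Longrightarrow> mp_vars (\<sigma> i) \<subseteq> M) \<Longrightarrow> mp_vars (mp_subst \<sigma> p) \<subseteq> M"
  unfolding mp_subst_def
  by (intro mp_vars_sum order_trans[OF mp_vars_mult] Un_least mp_vars_prod order_trans[OF mp_vars_power])
    (auto simp: mp_vars_def[of p])

text \<open>Taylor coefficients \<open>\<partial>\<^sup>e p (0)\<close>: with this normalization multiplication by a variable acts by
  \<open>e\<^sub>i\<close> times a shift, and the substitution of \<open>\<lambda>\<^sub>i + \<lambda>\<^sub>j\<close> for a variable adds two exponents, without
  binomial coefficients.\<close>

definition dcoef :: "mpol \<Rightarrow> nat list \<Rightarrow> complex" where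
  "dcoef p es = (\<Prod>k<length es. fact (es ! k)) * Poly_Mapping.lookup p (Poly_Mapping.nth es)"

lemma dcoef_add: "dcoef (p + q) es = dcoef p es + dcoef q es"
  by (simp add: dcoef_def lookup_add distrib_left)

lemma dcoef_const_mult: "dcoef (mp_const c * p) es = c * dcoef p es"
proof -
  have "Poly_Mapping.lookup (mp_const c * p) m = c * Poly_Mapping.lookup p m" for m
    by (subst (1 2) mpol_sum_single[of p])
      (simp add: sum_distrib_left mp_const_single lookup_sum lookup_single when_def if_distrib cong: if_cong)
  then show ?thesis by (simp add: dcoef_def)
qed

lemma dcoef_0 [simp]: "dcoef 0 es = 0" by (simp add: dcoef_def)

lemma dcoef_uminus: "dcoef (- p) es = - dcoef p es"
  by (simp add: dcoef_def)

lemma dcoef_sum: "dcoef (sum f A) es = (\<Sum>x\<in>A. dcoef (f x) es)"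
  by (induction A rule: infinite_finite_induct) (simp_all add: dcoef_add)

declare Poly_Mapping.lookup_nth [simp del]

lemma lookup_nth_list: "Poly_Mapping.lookup (Poly_Mapping.nth es) i = (if i < length es then es ! i else 0)"
  by (simp add: Poly_Mapping.lookup_nth nth_default_def)

text \<open>The factor arises from e! = e (e - 1)!; for e = 0 both sides vanish, so the truncated
  subtraction is harmless.\<close>

lemma dcoef_lam:
  assumes "i < length es"
  shows "dcoef (lam i * p) es = of_nat (es ! i) * dcoef p (es[i := es ! i - 1])"
proof -
  have single: "dcoef (lam i * Poly_Mapping.single m c) es = of_nat (es ! i) * dcoef (Poly_Mapping.single m c) (es[i := es ! i - 1])" for m c
  proof (cases "es ! i")
    case 0
    have "Poly_Mapping.single i 1 + m \<noteq> Poly_Mapping.nth es"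
    proof
      assume "Poly_Mapping.single i 1 + m = Poly_Mapping.nth es"
      then have "Poly_Mapping.lookup (Poly_Mapping.single i 1 + m) i = Poly_Mapping.lookup (Poly_Mapping.nth es) i" by simp
      then show False using 0 assms by (simp add: lookup_add lookup_nth_list)
    qed
    then show ?thesis using 0 by (simp add: dcoef_def lam_def mult_single lookup_single when_def)
  next
    case (Suc e)
    have eq: "Poly_Mapping.single i 1 + m = Poly_Mapping.nth es \<longleftrightarrow> m = Poly_Mapping.nth (es[i := e])"
      using Suc assms
      by (auto simp: poly_mapping_eq_iff fun_eq_iff lookup_add lookup_nth_list lookup_single when_def nth_list_update split: if_splits)
    have "(\<Prod>k<length es. fact (es ! k) :: complex) = fact (Suc e) * (\<Prod>k\<in>{..<length es} - {i}. fact (es ! k))"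
      using assms Suc by (subst prod.remove[of _ i]) auto
    moreover have "(\<Prod>k<length es. fact (es[i := e] ! k) :: complex) = fact e * (\<Prod>k\<in>{..<length es} - {i}. fact (es ! k))"
      using assms by (subst prod.remove[of _ i]) (auto intro!: prod.cong)
    ultimately show ?thesis
      using eq by (simp add: dcoef_def lam_def mult_single lookup_single when_def Suc)
  qed
  show ?thesis
    by (subst (1 2) mpol_sum_single[of p]) (simp add: sum_distrib_left dcoef_sum single)
qed

lemma dcoef_const: "dcoef (mp_const c) es = (if \<forall>e\<in>set es. e = 0 then c else 0)"
proof -
  have "Poly_Mapping.nth es = 0 \<longleftrightarrow> (\<forall>e\<in>set es. e = 0)"
    by (auto simp: poly_mapping_eq_iff fun_eq_iff lookup_nth_list all_set_conv_all_nth)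
  moreover have "(\<Prod>k<length es. fact (es ! k) :: complex) = 1" if "\<forall>e\<in>set es. e = 0"
    using that by (intro prod.neutral) (auto simp: all_set_conv_all_nth)
  ultimately show ?thesis by (auto simp: dcoef_def mp_const_def lookup_single when_def)
qed

lemma mpol_eqI_dcoef:
  assumes "mp_vars p \<subseteq> {..<n}" "mp_vars q \<subseteq> {..<n}" "\<And>es. length es = n \<Longrightarrow> dcoef p es = dcoef q es"
  shows "p = q"
proof (rule poly_mapping_eqI)
  fix m
  show "Poly_Mapping.lookup p m = Poly_Mapping.lookup q m"
  proof (cases "Poly_Mapping.keys m \<subseteq> {..<n}")
    case True
    have "Poly_Mapping.nth (map (Poly_Mapping.lookup m) [0..<n]) = m"
      using True by (intro poly_mapping_eqI) (auto simp: lookup_nth_list in_keys_iff subset_iff)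
    moreover have "(\<Prod>k<n. fact (map (Poly_Mapping.lookup m) [0..<n] ! k) :: complex) \<noteq> 0" by simp
    ultimately show ?thesis
      using assms(3)[of "map (Poly_Mapping.lookup m) [0..<n]"] by (simp add: dcoef_def)
  next
    case False
    then have "m \<notin> Poly_Mapping.keys p" "m \<notin> Poly_Mapping.keys q" using assms(1,2) by (auto simp: mp_vars_def)
    then show ?thesis by (simp add: in_keys_iff)
  qed
qed

text \<open>Differentiating f(\<lambda>_i + \<lambda>_j) in either variable differentiates f, so the
  orders add up. In the induction, multiplication by \<lambda>_i + \<lambda>_j lowers e_i + e_j by
  one with factor e_i + e_j.\<close>

lemma dcoef_subst_diag:
  assumes "distinct (i # j # ks)" "set (i # j # ks) = {..<length es}" "mp_vars p \<subseteq> {..<Suc (length ks)}"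
  shows "dcoef (mp_subst (\<lambda>k. ((lam i + lam j) # map lam ks) ! k) p) es =
    dcoef p ((es ! i + es ! j) # map ((!) es) ks)"
  using assms(3,2)
proof (induction p arbitrary: es rule: mpol_vars_induct)
  case (const c)
  have "(\<forall>e\<in>set es. e = 0) \<longleftrightarrow> (\<forall>e\<in>set ((es ! i + es ! j) # map ((!) es) ks). e = 0)"
  proof -
    have "set es = (!) es ` set (i # j # ks)" unfolding const by (auto simp: set_conv_nth)
    then show ?thesis by auto
  qed
  then show ?case by (simp add: dcoef_const)
next
  case (add p q)
  then show ?case by (simp add: mp_subst_add dcoef_add)
next
  case (lam k q)
  have IH: "dcoef (mp_subst (\<lambda>k. ((lam i + lam j) # map lam ks) ! k) q) es' =
      dcoef q ((es' ! i + es' ! j) # map ((!) es') ks)" if "length es' = length es" for es'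
    by (rule lam.IH) (simp only: lam.prems that)
  have mem: "x < length es" if "x \<in> set (i # j # ks)" for x
    using that by (simp only: lam.prems lessThan_iff)
  have len: "i < length es" "j < length es" "\<And>k. k < length ks \<Longrightarrow> ks ! k < length es"
    by (rule mem, simp)+
  show ?case
  proof (cases k)
    case 0
    have m: "map ((!) (es[l := v])) ks = map ((!) es) ks" if "l = i \<or> l = j" for l v
      using assms(1) that by (auto intro!: nth_list_update_neq)
    \<comment> \<open>For exponent 0 the two truncated sums may differ, but then the factor in front
      is 0.\<close>
    have c1: "of_nat (es ! i) * dcoef q ((es ! i - Suc 0 + es ! j) # ls) =
        of_nat (es ! i) * dcoef q ((es ! i + es ! j - Suc 0) # ls)" for ls
      by (cases "es ! i") simp_all
    have c2: "of_nat (es ! j) * dcoef q ((es ! i + (es ! j - Suc 0)) # ls) =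
        of_nat (es ! j) * dcoef q ((es ! i + es ! j - Suc 0) # ls)" for ls
      by (cases "es ! j") simp_all
    have "i \<noteq> j" using assms(1) by auto
    then show ?thesis
      using len(1,2)
      by (simp add: 0 mp_subst_lam_mult distrib_right dcoef_add dcoef_lam IH m c1 c2)
  next
    case (Suc l)
    with lam.hyps have l: "l < length ks" by simp
    have neq: "ks ! l \<noteq> i" "ks ! l \<noteq> j" using assms(1) l by auto
    have "map ((!) (es[ks ! l := v])) ks = (map ((!) es) ks)[l := v]" for v
      using assms(1) l len by (intro nth_equalityI) (auto simp: nth_list_update nth_eq_iff_index_eq)
    then show ?thesis
      using neq len(3)[OF l] l by (simp add: Suc mp_subst_lam_mult dcoef_lam IH)
  qed
qed

lemma dcoef_subst_permute:
  assumes "\<pi> permutes {..<n}" "mp_vars p \<subseteq> {..<n}" "length es = n"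
  shows "dcoef (mp_subst (\<lambda>k. lam (\<pi> k)) p) es = dcoef p (permute_list \<pi> es)"
  using assms(2,3)
proof (induction p arbitrary: es rule: mpol_vars_induct)
  case (const c)
  then show ?case using assms(1) set_permute_list[of \<pi> es] by (simp add: dcoef_const)
next
  case (add p q)
  then show ?case by (simp add: mp_subst_add dcoef_add)
next
  case (lam k q)
  have perm: "\<pi> permutes {..<length es}" using assms(1) lam.prems by simp
  have im: "\<pi> l < length es" if "l < length es" for l
    using permutes_in_image[OF perm, of l] that by simp
  have k: "k < length es" "\<pi> k < length es" using lam.hyps lam.prems im by simp_all
  have "permute_list \<pi> (es[\<pi> k := v]) = (permute_list \<pi> es)[k := v]" for v
  proof (rule nth_equalityI)
    fix l assume "l < length (permute_list \<pi> (es[\<pi> k := v]))"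
    then have l: "l < length es" by simp
    then show "permute_list \<pi> (es[\<pi> k := v]) ! l = (permute_list \<pi> es)[k := v] ! l"
      using im[OF l] k inj_eq[OF permutes_inj[OF perm], of k l]
      by (simp add: permute_list_nth perm nth_list_update)
  qed simp
  then show ?case
    using k lam.prems permute_list_nth[OF perm k(1)] by (simp add: mp_subst_lam_mult dcoef_lam lam.IH)
qed

section \<open>Alternating forms under permutations\<close>

lemma alternating_move:
  "alternating c \<Longrightarrow> c (us @ vs @ x # ws) = (- 1) ^ length vs * c (us @ x # vs @ ws)"
proof (induction vs arbitrary: us)
  case (Cons v vs)
  have "c (us @ (v # vs) @ x # ws) = (- 1) ^ length vs * c ((us @ [v]) @ x # vs @ ws)"
    using Cons.IH[of "us @ [v]"] Cons.prems by simp
  also have "c ((us @ [v]) @ x # vs @ ws) = - c (us @ x # v # vs @ ws)"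
    using alternatingD[OF Cons.prems, of us v x "vs @ ws"] by simp
  finally show ?case by simp
qed simp

text \<open>Both sides reduce to the adjacent case by moving an entry across the same block, so the
  sign of the block cancels.\<close>

lemma alternating_swap_far:
  assumes "alternating c"
  shows "c (us @ y # vs @ x # ws) = - c (us @ x # vs @ y # ws)"
proof -
  have "c (us @ y # vs @ x # ws) = (- 1) ^ length vs * c (us @ y # x # vs @ ws)"
    using alternating_move[OF assms, of "us @ [y]" vs x ws] by simp
  moreover have "c (us @ x # vs @ y # ws) = (- 1) ^ length vs * c (us @ x # y # vs @ ws)"
    using alternating_move[OF assms, of "us @ [x]" vs y ws] by simp
  moreover have "c (us @ y # x # vs @ ws) = - c (us @ x # y # vs @ ws)"
    by (rule alternatingD[OF assms])
  ultimately show ?thesis by simp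
qed

lemma permute_list_transpose:
  assumes "i < length xs" "j < length xs"
  shows "permute_list (Transposition.transpose i j) xs = xs[i := xs ! j, j := xs ! i]"
proof (rule nth_equalityI)
  fix k assume "k < length (permute_list (Transposition.transpose i j) xs)"
  then have k: "k < length xs" by simp
  have "permute_list (Transposition.transpose i j) xs ! k = xs ! Transposition.transpose i j k"
    using assms k by (intro permute_list_nth permutes_swap_id) auto
  then show "permute_list (Transposition.transpose i j) xs ! k = xs[i := xs ! j, j := xs ! i] ! k"
    using assms k by (auto simp: Transposition.transpose_def nth_list_update)
qed simp

lemma permute_list_transpose_append:
  "permute_list (Transposition.transpose (length us) (Suc (length us + length vs))) (us @ x # vs @ y # ws) =
    us @ y # vs @ x # ws"
  by (subst permute_list_transpose) (simp_all add: list_update_append nth_append)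

lemma alternating_transpose:
  assumes "alternating c" "i < length xs" "j < length xs" "i \<noteq> j"
  shows "c (permute_list (Transposition.transpose i j) xs) = - c xs"
proof -
  have *: "c (permute_list (Transposition.transpose i j) xs) = - c xs" if ij: "i < j" "j < length xs" for i j
  proof -
    define us where "us = take i xs"
    define vs where "vs = take (j - Suc i) (drop (Suc i) xs)"
    define ws where "ws = drop (Suc j) xs"
    have "drop (Suc i) xs = vs @ drop (j - Suc i) (drop (Suc i) xs)"
      unfolding vs_def by (rule append_take_drop_id[symmetric])
    also have "drop (j - Suc i) (drop (Suc i) xs) = xs ! j # ws"
      using ij Cons_nth_drop_Suc[of j xs] by (simp add: ws_def)
    finally have xs: "xs = us @ xs ! i # vs @ xs ! j # ws"
      using ij id_take_nth_drop[of i xs] by (simp add: us_def)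
    have "i = length us" "j = Suc (length us + length vs)" using ij by (simp_all add: us_def vs_def)
    then have "permute_list (Transposition.transpose i j) xs = us @ xs ! j # vs @ xs ! i # ws"
      using permute_list_transpose_append[of us vs "xs ! i" "xs ! j" ws] xs by simp
    then show ?thesis
      using alternating_swap_far[OF assms(1), of us "xs ! j" vs "xs ! i" ws] xs by simp
  qed
  consider "i < j" | "j < i" using assms(4) by linarith
  then show ?thesis
  proof cases
    case 1
    show ?thesis by (rule *[OF 1 assms(3)])
  next
    case 2
    show ?thesis using *[OF 2 assms(2)] by (simp only: transpose_commute[of i j])
  qed
qed

lemma alternating_permute:
  assumes "alternating c" "\<pi> permutes {..<length xs}"
  shows "c (permute_list \<pi> xs) = of_int (sign \<pi>) * c xs"
proof -
  \<comment> \<open>All lists of length n are quantified because the induction step applies the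
    hypothesis to the transposed list.\<close>
  have "\<forall>xs. length xs = n \<longrightarrow> c (permute_list \<pi> xs) = of_int (sign \<pi>) * c xs" if "\<pi> permutes {..<n}" for n
    using that finite_lessThan[of n]
  proof (induction \<pi> rule: permutes_induct)
    case id
    then show ?case by simp
  next
    case (swap a b p)
    show ?case
    proof (intro allI impI)
      fix xs :: "sv_mode list" assume len: "length xs = n"
      have "permutation p" using swap permutes_imp_permutation by blast
      then have "sign (Transposition.transpose a b \<circ> p) = - sign p"
        using swap(3) by (simp add: sign_compose permutation_swap_id sign_swap_id)
      moreover have "c (permute_list (Transposition.transpose a b \<circ> p) xs) = of_int (sign p) * c (permute_list (Transposition.transpose a b) xs)"
        using swap.IH swap(4,5) len by (subst permute_list_compose) auto
      ultimately show "c (permute_list (Transposition.transpose a b \<circ> p) xs) = of_int (sign (Transposition.transpose a b \<circ> p)) * c xs"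
        using alternating_transpose[OF assms(1), of a xs b] swap len by simp
    qed
  qed
  with assms(2) show ?thesis by blast
qed

section \<open>Cochains as forms\<close>

text \<open>The conditions on a cochain that are checked one argument at a time. The differential
  preserves them summand by summand, while skew-symmetry concerns the whole sum and is recovered
  from forms.\<close>

definition sesqui :: "nat \<Rightarrow> sv cochain \<Rightarrow> bool" where
  "sesqui n \<gamma> \<longleftrightarrow> (\<forall>as. length as \<noteq> n \<longrightarrow> \<gamma> as = 0) \<and>
    (\<forall>as i. length as = n \<longrightarrow> i < n \<longrightarrow>
      (\<forall>x y. \<gamma> (as[i := x + y]) = \<gamma> (as[i := x]) + \<gamma> (as[i := y])) \<and>
      (\<forall>c x. \<gamma> (as[i := sv_scl c x]) = mp_const c * \<gamma> (as[i := x])) \<and>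
      (\<forall>x. \<gamma> (as[i := sv_D x]) = - lam i * \<gamma> (as[i := x])))"

lemma is_cochain_iff:
  "sv.is_cochain n \<gamma> \<longleftrightarrow> sesqui n \<gamma> \<and>
     (\<forall>as. length as = n \<longrightarrow> mp_vars (\<gamma> as) \<subseteq> {..<n} \<and>
       (\<forall>\<pi>. \<pi> permutes {..<n} \<longrightarrow>
         cochain_at \<gamma> (permute_list \<pi> (map lam [0..<n])) (permute_list \<pi> as) = of_int (sign \<pi>) * \<gamma> as))"
    (is "?A \<longleftrightarrow> ?B")
proof
  assume A: ?A
  have "\<gamma> (as[i := sv_D x]) = - lam i * \<gamma> (as[i := x])" if "length as = n" "i < n" for as i x
  proof -
    have "\<gamma> ((as[i := x])[i := sv_D ((as[i := x]) ! i)]) = - lam i * \<gamma> (as[i := x])"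
      using A that unfolding sv.is_cochain_def by (metis length_list_update)
    then show ?thesis using that by simp
  qed
  with A show ?B unfolding sv.is_cochain_def sesqui_def by blast
next
  assume B: ?B
  have "\<gamma> (as[i := sv_D (as ! i)]) = - lam i * \<gamma> as" if "length as = n" "i < n" for as i
    using B that unfolding sesqui_def by (metis list_update_id)
  with B show ?A unfolding sv.is_cochain_def sesqui_def by blast
qed

lemma sesquiD:
  assumes "sesqui n \<gamma>"
  shows "length as \<noteq> n \<Longrightarrow> \<gamma> as = 0"
    and "length as = n \<Longrightarrow> i < n \<Longrightarrow> \<gamma> (as[i := x + y]) = \<gamma> (as[i := x]) + \<gamma> (as[i := y])"
    and "length as = n \<Longrightarrow> i < n \<Longrightarrow> \<gamma> (as[i := sv_scl c x]) = mp_const c * \<gamma> (as[i := x])"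
    and "length as = n \<Longrightarrow> i < n \<Longrightarrow> \<gamma> (as[i := sv_D x]) = - lam i * \<gamma> (as[i := x])"
  using assms unfolding sesqui_def by blast+

lemma sv_sesqui_linear_eq_0:
  fixes F :: "sv \<Rightarrow> mpol"
  assumes add: "\<And>x y. F (x + y) = F x + F y" and scl: "\<And>c x. F (sv_scl c x) = mp_const c * F x"
    and D: "\<And>x. F (sv_D x) = l * F x" and elt: "\<And>X. F (sv_elt X) = 0"
  shows "F x = 0"
proof -
  define comp :: "sv_gen \<Rightarrow> complex poly \<Rightarrow> sv" where "comp X p = (\<lambda>Y. if Y = X then p else 0)" for X p
  have "F (comp X p) = 0" for X p
  proof (induction p)
    case 0
    have "comp X 0 = 0" by (auto simp: comp_def)
    moreover have "F 0 = 0" using add[of 0 0] by (simp only: add_0_left add_cancel_right_right)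
    ultimately show ?case by (simp only:)
  next
    case (pCons a p)
    have eq: "comp X (pCons a p) = sv_scl a (sv_elt X) + sv_D (comp X p)"
      by (auto simp: comp_def sv_scl_def sv_elt_def sv_D_def fun_eq_iff)
    show ?case unfolding eq add scl D elt pCons.IH by simp
  qed
  moreover have "x = comp SV_L (x SV_L) + (comp SV_M (x SV_M) + comp SV_Y (x SV_Y))"
  proof
    fix Y show "x Y = (comp SV_L (x SV_L) + (comp SV_M (x SV_M) + comp SV_Y (x SV_Y))) Y"
      by (cases Y) (simp_all add: comp_def)
  qed
  then have "F x = F (comp SV_L (x SV_L)) + (F (comp SV_M (x SV_M)) + F (comp SV_Y (x SV_Y)))"
    by (simp only: flip: add)
  ultimately show ?thesis by simp
qed

lemma sesqui_eq_0:
  assumes "sesqui n \<gamma>" "\<And>Xs. length Xs = n \<Longrightarrow> \<gamma> (map sv_elt Xs) = 0"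
  shows "\<gamma> as = 0"
proof -
  \<comment> \<open>The first k arguments are arbitrary and the others are generators; each step
    frees one more argument.\<close>
  have *: "\<forall>as. length as = n \<longrightarrow> (\<forall>i. k \<le> i \<longrightarrow> i < n \<longrightarrow> as ! i \<in> range sv_elt) \<longrightarrow> \<gamma> as = 0" if "k \<le> n" for k
    using that
  proof (induction k)
    case 0
    show ?case
    proof (intro allI impI)
      fix as :: "sv list" assume as: "length as = n" "\<forall>i. 0 \<le> i \<longrightarrow> i < n \<longrightarrow> as ! i \<in> range sv_elt"
      have "\<forall>i\<in>{..<n}. \<exists>X. as ! i = sv_elt X" using as(2) by auto
      from bchoice[OF this] obtain g where g: "\<forall>i\<in>{..<n}. as ! i = sv_elt (g i)" ..
      have "as = map sv_elt (map g [0..<n])" by (rule nth_equalityI) (simp_all add: as(1) g)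
      then show "\<gamma> as = 0" using assms(2)[of "map g [0..<n]"] by simp
    qed
  next
    case (Suc k)
    show ?case
    proof (intro allI impI)
      fix as :: "sv list" assume as: "length as = n" "\<forall>i. Suc k \<le> i \<longrightarrow> i < n \<longrightarrow> as ! i \<in> range sv_elt"
      have k: "k < n" using Suc.prems by simp
      have "\<gamma> (as[k := x]) = 0" for x
      proof (rule sv_sesqui_linear_eq_0)
        fix X
        have "\<forall>i. k \<le> i \<longrightarrow> i < n \<longrightarrow> as[k := sv_elt X] ! i \<in> range sv_elt"
        proof (intro allI impI)
          fix i assume i: "k \<le> i" "i < n"
          then show "as[k := sv_elt X] ! i \<in> range sv_elt" using as k by (cases "i = k") auto
        qed
        with Suc.IH as k show "\<gamma> (as[k := sv_elt X]) = 0" by simp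
      qed (use sesquiD(2-4)[OF assms(1) as(1) k] in blast)+
      from this[of "as ! k"] show "\<gamma> as = 0" by simp
    qed
  qed
  show ?thesis using *[of n] sesquiD(1)[OF assms(1), of as] by (cases "length as = n") auto
qed

lemma sesqui_diff: "sesqui n \<gamma> \<Longrightarrow> sesqui n \<delta> \<Longrightarrow> sesqui n (\<gamma> - \<delta>)"
  unfolding sesqui_def by (simp add: algebra_simps)

definition cochain_form :: "sv cochain \<Rightarrow> sv_form" where
  "cochain_form \<gamma> = (\<lambda>xs. dcoef (\<gamma> (map (sv_elt \<circ> fst) xs)) (map snd xs))"

lemma cochain_form_add: "cochain_form (\<gamma> + \<delta>) = cochain_form \<gamma> + cochain_form \<delta>"
  by (simp add: cochain_form_def fun_eq_iff dcoef_add)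

lemma cochain_form_scale: "cochain_form (\<lambda>as. mp_const c * \<gamma> as) = (\<lambda>xs. c * cochain_form \<gamma> xs)"
  by (simp add: cochain_form_def fun_eq_iff dcoef_const_mult)

lemma sesqui_eqI:
  assumes "sesqui n \<gamma>" "sesqui n \<delta>"
    and "\<And>Xs. length Xs = n \<Longrightarrow> mp_vars (\<gamma> (map sv_elt Xs)) \<subseteq> {..<n}"
    and "\<And>Xs. length Xs = n \<Longrightarrow> mp_vars (\<delta> (map sv_elt Xs)) \<subseteq> {..<n}"
    and "cochain_form \<gamma> = cochain_form \<delta>"
  shows "\<gamma> = \<delta>"
proof -
  have "(\<gamma> - \<delta>) as = 0" for as
  proof (rule sesqui_eq_0[OF sesqui_diff[OF assms(1,2)]])
    fix Xs :: "sv_gen list" assume len: "length Xs = n"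
    have "\<gamma> (map sv_elt Xs) = \<delta> (map sv_elt Xs)"
    proof (rule mpol_eqI_dcoef[OF assms(3,4)[OF len]])
      fix es :: "nat list" assume "length es = n"
      moreover have "map (sv_elt \<circ> fst) (zip Xs es) = map sv_elt (map fst (zip Xs es))" by simp
      ultimately show "dcoef (\<gamma> (map sv_elt Xs)) es = dcoef (\<delta> (map sv_elt Xs)) es"
        using fun_cong[OF assms(5), of "zip Xs es"] len by (simp add: cochain_form_def del: map_map)
    qed
    then show "(\<gamma> - \<delta>) (map sv_elt Xs) = 0" by simp
  qed
  then show ?thesis by (auto simp: fun_eq_iff)
qed

lemma cochain_form_permute:
  assumes "sv.is_cochain n \<gamma>" "length xs = n" "\<pi> permutes {..<n}"
  shows "cochain_form \<gamma> (permute_list \<pi> xs) = of_int (sign \<pi>) * cochain_form \<gamma> xs"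
proof -
  let ?as = "map (sv_elt \<circ> fst) xs"
  have perm: "\<pi> permutes {..<length xs}" using assms by simp
  have v: "mp_vars (\<gamma> (permute_list \<pi> ?as)) \<subseteq> {..<n}" and
    p: "cochain_at \<gamma> (permute_list \<pi> (map lam [0..<n])) (permute_list \<pi> ?as) = of_int (sign \<pi>) * \<gamma> ?as"
    using assms unfolding is_cochain_iff by simp_all
  have "cochain_form \<gamma> (permute_list \<pi> xs) = dcoef (\<gamma> (permute_list \<pi> ?as)) (permute_list \<pi> (map snd xs))"
    using perm by (simp add: cochain_form_def permute_list_map)
  also have "\<dots> = dcoef (mp_subst (\<lambda>k. lam (\<pi> k)) (\<gamma> (permute_list \<pi> ?as))) (map snd xs)"
    by (rule dcoef_subst_permute[symmetric, OF assms(3) v]) (simp add: assms)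
  also have "mp_subst (\<lambda>k. lam (\<pi> k)) (\<gamma> (permute_list \<pi> ?as)) = of_int (sign \<pi>) * \<gamma> ?as"
  proof -
    have "permute_list \<pi> (map lam [0..<n]) ! k = lam (\<pi> k)" if "k < n" for k
      using that assms(3) permutes_in_image[OF assms(3), of k] by (subst permute_list_nth) auto
    then have "mp_subst (\<lambda>k. lam (\<pi> k)) (\<gamma> (permute_list \<pi> ?as)) = cochain_at \<gamma> (permute_list \<pi> (map lam [0..<n])) (permute_list \<pi> ?as)"
      unfolding cochain_at_def using v by (intro mp_subst_cong) auto
    then show ?thesis using p by simp
  qed
  also have "dcoef (of_int (sign \<pi>) * \<gamma> ?as) (map snd xs) = of_int (sign \<pi>) * cochain_form \<gamma> xs"
    by (cases \<pi> rule: sign_cases) (simp_all add: cochain_form_def dcoef_uminus)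
  finally show ?thesis .
qed

lemma alternating_cochain_form:
  assumes "sv.is_cochain n \<gamma>" shows "alternating (cochain_form \<gamma>)"
  unfolding alternating_def
proof (intro allI)
  fix us vs and x y :: sv_mode
  let ?xs = "us @ y # x # vs" and ?\<pi> = "Transposition.transpose (length us) (Suc (length us))"
  have ps: "permute_list ?\<pi> ?xs = us @ x # y # vs"
    using permute_list_transpose_append[of us "[]" y x vs] by simp
  show "cochain_form \<gamma> (us @ x # y # vs) = - cochain_form \<gamma> (us @ y # x # vs)"
  proof (cases "length ?xs = n")
    case True
    have "?\<pi> permutes {..<n}" by (rule permutes_swap_id) (use True in auto)
    from cochain_form_permute[OF assms True this] show ?thesis
      unfolding ps by (simp add: sign_swap_id)
  next
    case False
    then show ?thesis using sesquiD(1)[of n \<gamma>] assms by (simp add: cochain_form_def is_cochain_iff)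
  qed
qed

lemma cochain_form_in_forms:
  assumes "sv.is_cochain n \<gamma>" shows "cochain_form \<gamma> \<in> forms n"
proof -
  have z: "cochain_form \<gamma> xs = 0" if "length xs \<noteq> n" for xs
    using assms sesquiD(1)[of n \<gamma>] that by (simp add: cochain_form_def is_cochain_iff)
  let ?S = "\<Union>Xs\<in>{Xs. set Xs \<subseteq> UNIV \<and> length Xs = n}. \<Union>m\<in>Poly_Mapping.keys (\<gamma> (map sv_elt Xs)).
    {zip Xs (map (Poly_Mapping.lookup m) [0..<n])}"
  have "{xs. cochain_form \<gamma> xs \<noteq> 0} \<subseteq> ?S"
  proof
    fix xs assume "xs \<in> {xs. cochain_form \<gamma> xs \<noteq> 0}"
    then have ne: "cochain_form \<gamma> xs \<noteq> 0" by simp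
    with z have len: "length xs = n" by blast
    let ?m = "Poly_Mapping.nth (map snd xs)"
    have "?m \<in> Poly_Mapping.keys (\<gamma> (map sv_elt (map fst xs)))"
      using ne by (auto simp: cochain_form_def dcoef_def in_keys_iff)
    moreover have "zip (map fst xs) (map (Poly_Mapping.lookup ?m) [0..<n]) = xs"
      using len by (intro nth_equalityI) (auto simp: lookup_nth_list)
    ultimately show "xs \<in> ?S" using len by (intro UN_I[of "map fst xs"] UN_I[of ?m]) auto
  qed
  moreover have "finite ?S"
    by (intro finite_UN_I finite_lists_length_eq finite_UNIV_sv_gen) auto
  ultimately have "finite {xs. cochain_form \<gamma> xs \<noteq> 0}" by (rule finite_subset)
  with z alternating_cochain_form[OF assms] show ?thesis by (simp add: forms_def)
qed

section \<open>Reconstruction of a cochain from its form\<close>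

definition poly_ev :: "complex poly \<Rightarrow> mpol \<Rightarrow> mpol" where
  "poly_ev p l = poly (map_poly mp_const p) l"

lemma poly_ev_0 [simp]: "poly_ev 0 l = 0" by (simp add: poly_ev_def)

lemma poly_ev_pCons [simp]: "poly_ev (pCons a p) l = mp_const a + l * poly_ev p l"
  by (simp add: poly_ev_def map_poly_pCons)

lemma poly_ev_add: "poly_ev (p + q) l = poly_ev p l + poly_ev q l"
  by (induction p q rule: poly_induct2) (simp_all add: mp_const_add algebra_simps)

lemma poly_ev_smult: "poly_ev (Polynomial.smult c p) l = mp_const c * poly_ev p l"
  by (induction p) (simp_all add: mp_const_mult algebra_simps)

lemma mp_subst_poly_ev: "mp_subst \<sigma> (poly_ev p l) = poly_ev p (mp_subst \<sigma> l)"
  by (induction p) (simp_all add: mp_subst_add mp_subst_mult)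

lemma mp_vars_poly_ev: "mp_vars (poly_ev p l) \<subseteq> mp_vars l"
proof (induction p)
  case (pCons a p)
  then show ?case
    using mp_vars_add[of "mp_const a" "l * poly_ev p l"] mp_vars_mult[of l "poly_ev p l"] by auto
qed simp

text \<open>One factor of the generating function below: a divided power of l, times the coordinate
  of a with \<partial> replaced by -l, as sesquilinearity demands.\<close>

definition mode_val :: "sv \<Rightarrow> sv_mode \<Rightarrow> mpol \<Rightarrow> mpol" where
  "mode_val a x l = poly_ev (a (fst x)) (- l) * (mp_const (1 / fact (snd x)) * l ^ snd x)"

text \<open>The cochain whose value on generators is the generating function
  \<open>\<Sum>\<^sub>e c(X\<^sub>1,e\<^sub>1; \<dots>) \<Prod>\<^sub>k \<lambda>\<^sub>k\<^bsup>e\<^sub>k\<^esup>/e\<^sub>k!\<close>, extended sesquilinearly.\<close>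

definition form_cochain :: "nat \<Rightarrow> sv_form \<Rightarrow> sv cochain" where
  "form_cochain n c = (\<lambda>as. if length as = n then
     \<Sum>xs\<in>{xs. c xs \<noteq> 0}. mp_const (c xs) * (\<Prod>k<n. mode_val (as ! k) (xs ! k) (lam k)) else 0)"

lemma mode_val_add: "mode_val (a + b) x l = mode_val a x l + mode_val b x l"
  by (simp add: mode_val_def poly_ev_add distrib_right)

lemma mode_val_scl: "mode_val (sv_scl r a) x l = mp_const r * mode_val a x l"
  by (simp add: mode_val_def sv_scl_def poly_ev_smult mult.assoc)

lemma mode_val_D: "mode_val (sv_D a) x l = - l * mode_val a x l"
  by (simp add: mode_val_def sv_D_def mult.assoc)

lemma mode_val_elt: "mode_val (sv_elt X) x l = (if X = fst x then mp_const (1 / fact (snd x)) * l ^ snd x else 0)"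
  by (auto simp: mode_val_def sv_elt_def one_pCons)

lemma mp_subst_mode_val: "mp_subst \<sigma> (mode_val a x l) = mode_val a x (mp_subst \<sigma> l)"
  by (simp add: mode_val_def mp_subst_mult mp_subst_poly_ev mp_subst_uminus mp_subst_power)

lemma mp_vars_mode_val: "mp_vars (mode_val a x l) \<subseteq> mp_vars l"
  unfolding mode_val_def
  using mp_vars_poly_ev[of "a (fst x)" "- l"] mp_vars_power[of l "snd x"]
  by (intro order_trans[OF mp_vars_mult] Un_least) auto

lemma sesqui_form_cochain: "sesqui n (form_cochain n c)"
proof -
  let ?P = "\<lambda>as xs. \<Prod>k<n. mode_val (as ! k) (xs ! k) (lam k)"
  have P: "?P (as[i := x]) xs = mode_val x (xs ! i) (lam i) * (\<Prod>k\<in>{..<n} - {i}. mode_val (as ! k) (xs ! k) (lam k))"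
    if "length as = n" "i < n" for as i x xs
    using that by (subst prod.remove[of _ i]) (auto intro!: prod.cong)
  show ?thesis
    unfolding sesqui_def form_cochain_def
    by (auto simp: P mode_val_add mode_val_scl mode_val_D sum.distrib sum_distrib_left algebra_simps sum_negf)
qed

lemma mp_vars_form_cochain: "mp_vars (form_cochain n c as) \<subseteq> {..<n}"
proof -
  have "mp_vars (mode_val a x (lam k)) \<subseteq> {..<n}" if "k < n" for a x k
    using mp_vars_mode_val[of a x "lam k"] that by auto
  then have "mp_vars (\<Sum>xs\<in>{xs. c xs \<noteq> 0}. mp_const (c xs) * (\<Prod>k<n. mode_val (as ! k) (xs ! k) (lam k))) \<subseteq> {..<n}"
    by (intro mp_vars_sum order_trans[OF mp_vars_mult] Un_least mp_vars_prod) simp_all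
  then show ?thesis by (simp add: form_cochain_def)
qed

lemma form_cochain_is_cochain:
  assumes "c \<in> forms n" shows "sv.is_cochain n (form_cochain n c)"
  unfolding is_cochain_iff
proof (intro conjI allI impI)
  show "sesqui n (form_cochain n c)" by (rule sesqui_form_cochain)
  fix as :: "sv list" assume len: "length as = n"
  show "mp_vars (form_cochain n c as) \<subseteq> {..<n}" by (rule mp_vars_form_cochain)
  fix \<pi> assume \<pi>: "\<pi> permutes {..<n}"
  have lens: "length xs = n" if "c xs \<noteq> 0" for xs using that assms by (auto simp: forms_def)
  let ?P = "\<lambda>xs. \<Prod>k<n. mode_val (as ! k) (xs ! k) (lam k)"
  have im: "\<pi> k < n" if "k < n" for k using permutes_in_image[OF \<pi>, of k] that by simp
  have "cochain_at (form_cochain n c) (permute_list \<pi> (map lam [0..<n])) (permute_list \<pi> as) =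
    (\<Sum>xs\<in>{xs. c xs \<noteq> 0}. mp_const (c xs) * (\<Prod>k<n. mode_val (as ! \<pi> k) (xs ! k) (lam (\<pi> k))))"
    unfolding cochain_at_def form_cochain_def using len \<pi> im
    by (simp add: mp_subst_sum mp_subst_const_mult mp_subst_prod mp_subst_mode_val permute_list_nth)
  also have "\<dots> = (\<Sum>xs\<in>{xs. c xs \<noteq> 0}. mp_const (c (permute_list \<pi> xs)) *
      (\<Prod>k<n. mode_val (as ! \<pi> k) (permute_list \<pi> xs ! k) (lam (\<pi> k))))"
  \<comment> \<open>Permuting arguments maps the support of c onto itself, because values change
    only by a sign.\<close>
  proof (rule sum.reindex_bij_witness[of _ "permute_list \<pi>" "permute_list (inv_into UNIV \<pi>)"])
    have inv: "inv_into UNIV \<pi> permutes {..<n}" by (rule permutes_inv[OF \<pi>])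
    fix xs assume "xs \<in> {xs. c xs \<noteq> 0}"
    then have l: "length xs = n" and ne: "c xs \<noteq> 0" using lens by auto
    have e1: "permute_list \<pi> (permute_list (inv_into UNIV \<pi>) xs) = xs"
      using \<pi> l by (subst permute_list_compose[symmetric]) (simp_all add: permutes_inv_o)
    have e2: "permute_list (inv_into UNIV \<pi>) (permute_list \<pi> xs) = xs"
      using inv l \<pi> by (subst permute_list_compose[symmetric]) (simp_all add: permutes_inv_o)
    have s: "sign p \<noteq> 0" for p :: "nat \<Rightarrow> nat" by simp
    show "permute_list \<pi> (permute_list (inv_into UNIV \<pi>) xs) = xs" by (rule e1)
    show "permute_list (inv_into UNIV \<pi>) (permute_list \<pi> xs) = xs" by (rule e2)
    show "permute_list \<pi> xs \<in> {xs. c xs \<noteq> 0}" "permute_list (inv_into UNIV \<pi>) xs \<in> {xs. c xs \<noteq> 0}"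
      using alternating_permute[OF forms_alternating[OF assms], of \<pi> xs]
        alternating_permute[OF forms_alternating[OF assms], of "inv_into UNIV \<pi>" xs] \<pi> inv l ne by simp_all
    show "mp_const (c (permute_list \<pi> (permute_list (inv_into UNIV \<pi>) xs))) *
        (\<Prod>k<n. mode_val (as ! \<pi> k) (permute_list \<pi> (permute_list (inv_into UNIV \<pi>) xs) ! k) (lam (\<pi> k))) =
      mp_const (c xs) * (\<Prod>k<n. mode_val (as ! \<pi> k) (xs ! k) (lam (\<pi> k)))"
      unfolding e1 ..
  qed
  also have "\<dots> = (\<Sum>xs\<in>{xs. c xs \<noteq> 0}. of_int (sign \<pi>) * (mp_const (c xs) * ?P xs))"
  proof (rule sum.cong[OF refl])
    fix xs assume "xs \<in> {xs. c xs \<noteq> 0}"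
    then have l: "length xs = n" using lens by auto
    have "(\<Prod>k<n. mode_val (as ! \<pi> k) (permute_list \<pi> xs ! k) (lam (\<pi> k))) =
        (\<Prod>k<n. mode_val (as ! \<pi> k) (xs ! \<pi> k) (lam (\<pi> k)))"
      using l \<pi> by (intro prod.cong) (simp_all add: permute_list_nth)
    also have "\<dots> = ?P xs"
      by (rule prod.permute[OF \<pi>, of "\<lambda>k. mode_val (as ! k) (xs ! k) (lam k)", unfolded o_def, symmetric])
    moreover have "mp_const (c (permute_list \<pi> xs)) = of_int (sign \<pi>) * mp_const (c xs)"
      using alternating_permute[OF forms_alternating[OF assms], of \<pi> xs] l \<pi>
      by (cases \<pi> rule: sign_cases) (simp_all add: mp_const_minus)
    ultimately show "mp_const (c (permute_list \<pi> xs)) * (\<Prod>k<n. mode_val (as ! \<pi> k) (permute_list \<pi> xs ! k) (lam (\<pi> k))) =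
        of_int (sign \<pi>) * (mp_const (c xs) * ?P xs)" by (simp add: mult.assoc)
  qed
  also have "\<dots> = of_int (sign \<pi>) * form_cochain n c as"
    using len by (simp add: form_cochain_def sum_distrib_left)
  finally show "cochain_at (form_cochain n c) (permute_list \<pi> (map lam [0..<n])) (permute_list \<pi> as) =
    of_int (sign \<pi>) * form_cochain n c as" .
qed

lemma dcoef_monomial:
  assumes "length es = n" "length fs = n"
  shows "dcoef (\<Prod>k<n. mp_const (1 / fact (fs ! k)) * lam k ^ (fs ! k)) es = (if es = fs then 1 else 0)"
proof -
  have "(\<Prod>k<n. mp_const (1 / fact (fs ! k)) * lam k ^ (fs ! k)) =
      Poly_Mapping.single (\<Sum>k<n. Poly_Mapping.single k (fs ! k)) (\<Prod>k<n. 1 / fact (fs ! k))"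
    by (induction n) (simp_all add: lam_power mp_const_single mult_single mult.commute add.commute)
  moreover have "(\<Sum>k<n. Poly_Mapping.single k (fs ! k)) = Poly_Mapping.nth fs"
    using assms by (intro poly_mapping_eqI) (auto simp: lookup_sum lookup_single lookup_nth_list when_def)
  moreover have "Poly_Mapping.nth fs = Poly_Mapping.nth es \<longleftrightarrow> es = fs"
  proof
    assume e: "Poly_Mapping.nth fs = Poly_Mapping.nth es"
    show "es = fs"
    proof (rule nth_equalityI)
      fix k assume "k < length es"
      then show "es ! k = fs ! k"
        using arg_cong[OF e, of "\<lambda>m. Poly_Mapping.lookup m k"] assms by (simp add: lookup_nth_list)
    qed (simp add: assms)
  qed simp
  moreover have "(\<Prod>k<n. fact (fs ! k)) * (\<Prod>k<n. 1 / fact (fs ! k)) = (1 :: complex)"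
    by (subst prod.distrib[symmetric]) simp
  ultimately show ?thesis
    using assms by (simp add: dcoef_def lookup_single when_def)
qed

lemma cochain_form_form_cochain:
  assumes "c \<in> forms n" shows "cochain_form (form_cochain n c) = c"
proof
  fix xs
  show "cochain_form (form_cochain n c) xs = c xs"
  proof (cases "length xs = n")
    case False
    then show ?thesis using assms by (simp add: cochain_form_def form_cochain_def forms_def)
  next
    case True
    have fin: "finite {ys. c ys \<noteq> 0}" using assms by (simp add: forms_def)
    have key: "dcoef (\<Prod>k<n. mode_val (map (sv_elt \<circ> fst) xs ! k) (ys ! k) (lam k)) (map snd xs) = (if ys = xs then 1 else 0)"
      if len: "length ys = n" for ys
    proof (cases "map fst ys = map fst xs")
      case False
      then obtain k where k: "k < n" "fst (ys ! k) \<noteq> fst (xs ! k)"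
        using len True by (auto simp: list_eq_iff_nth_eq)
      then have "mode_val (map (sv_elt \<circ> fst) xs ! k) (ys ! k) (lam k) = 0" using True by (auto simp: mode_val_elt)
      then have z: "(\<Prod>k<n. mode_val (map (sv_elt \<circ> fst) xs ! k) (ys ! k) (lam k)) = 0"
        using k(1) by (intro prod_zero) auto
      show ?thesis unfolding z using False by auto
    next
      case eq: True
      have "mode_val (map (sv_elt \<circ> fst) xs ! k) (ys ! k) (lam k) =
          mp_const (1 / fact (map snd ys ! k)) * lam k ^ (map snd ys ! k)" if "k < n" for k
        using that True len arg_cong[OF eq, of "\<lambda>zs. zs ! k"] by (simp add: mode_val_elt)
      then have "(\<Prod>k<n. mode_val (map (sv_elt \<circ> fst) xs ! k) (ys ! k) (lam k)) =
          (\<Prod>k<n. mp_const (1 / fact (map snd ys ! k)) * lam k ^ (map snd ys ! k))" by (intro prod.cong) auto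
      moreover have "map snd xs = map snd ys \<longleftrightarrow> ys = xs"
        using eq pair_list_eqI[of ys xs] by auto
      ultimately show ?thesis using True len by (simp only: dcoef_monomial length_map)
    qed
    have "cochain_form (form_cochain n c) xs = (\<Sum>ys\<in>{ys. c ys \<noteq> 0}. c ys *
        dcoef (\<Prod>k<n. mode_val (map (sv_elt \<circ> fst) xs ! k) (ys ! k) (lam k)) (map snd xs))"
      by (simp add: cochain_form_def form_cochain_def True dcoef_sum dcoef_const_mult)
    also have "\<dots> = (\<Sum>ys\<in>{ys. c ys \<noteq> 0}. c ys * (if ys = xs then 1 else 0))"
    proof (rule sum.cong[OF refl])
      fix ys assume "ys \<in> {ys. c ys \<noteq> 0}"
      then have "length ys = n" using assms by (auto simp: forms_def)
      from key[OF this] show "c ys * dcoef (\<Prod>k<n. mode_val (map (sv_elt \<circ> fst) xs ! k) (ys ! k) (lam k)) (map snd xs) =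
        c ys * (if ys = xs then 1 else 0)" by (simp only:)
    qed
    also have "\<dots> = c xs" using fin by (simp add: if_distrib cong: if_cong)
    finally show ?thesis .
  qed
qed

text \<open>Such a map is determined by its form, so it equals the cochain rebuilt from that form,
  which is skew-symmetric. This avoids permuting the double sum in the differential.\<close>

lemma is_cochainI:
  assumes "sesqui n \<gamma>" "\<And>Xs. length Xs = n \<Longrightarrow> mp_vars (\<gamma> (map sv_elt Xs)) \<subseteq> {..<n}" "cochain_form \<gamma> \<in> forms n"
  shows "sv.is_cochain n \<gamma>"
proof -
  have "\<gamma> = form_cochain n (cochain_form \<gamma>)"
    by (rule sesqui_eqI[OF assms(1) sesqui_form_cochain assms(2) mp_vars_form_cochain])
      (simp_all add: cochain_form_form_cochain assms(3))
  then show ?thesis using form_cochain_is_cochain[OF assms(3)] by simp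
qed

lemma cochain_form_inj:
  assumes "sv.is_cochain n \<gamma>" "sv.is_cochain n \<delta>" "cochain_form \<gamma> = cochain_form \<delta>" shows "\<gamma> = \<delta>"
  by (rule sesqui_eqI[of n]) (use assms in \<open>auto simp: is_cochain_iff\<close>)

lemma cochain_form_D:
  assumes "sv.is_cochain n \<gamma>" shows "cochain_form (cochain_D \<gamma>) = trans_der (cochain_form \<gamma>)"
proof
  fix xs
  \<comment> \<open>Summed over positions, one exponent e at a time is lowered with factor e, which
    is the effect of a variable in \<open>dcoef_lam\<close>.\<close>
  have gen: "trans_der c ys = (\<Sum>i<length ys. of_nat (snd (ys ! i)) * c (ys[i := (fst (ys ! i), snd (ys ! i) - 1)]))" for c ys
  proof (induction ys arbitrary: c)
    case (Cons y ys)
    obtain X e where y: "y = (X, e)" by (cases y)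
    show ?case unfolding y trans_der_Cons
      by (simp add: Cons.IH contr_apply sum.lessThan_Suc_shift del: sum.lessThan_Suc)
  qed simp
  show "cochain_form (cochain_D \<gamma>) xs = trans_der (cochain_form \<gamma>) xs"
    unfolding gen cochain_form_def cochain_D_def
    by (auto simp: sum_distrib_right dcoef_sum dcoef_lam map_update intro!: sum.cong)
      (metis fst_conv list_update_id map_update nth_map comp_apply)
qed

lemma cochain_D_is_cochain:
  assumes "sv.is_cochain n \<gamma>" shows "sv.is_cochain n (cochain_D \<gamma>)"
proof (rule is_cochainI)
  have s: "sesqui n \<gamma>" and v: "\<And>as. length as = n \<Longrightarrow> mp_vars (\<gamma> as) \<subseteq> {..<n}" using assms by (auto simp: is_cochain_iff)
  show "sesqui n (cochain_D \<gamma>)"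
    using s unfolding sesqui_def cochain_D_def by (simp add: distrib_left mult.left_commute)
  fix Xs :: "sv_gen list" assume "length Xs = n"
  then show "mp_vars (cochain_D \<gamma> (map sv_elt Xs)) \<subseteq> {..<n}"
    unfolding cochain_D_def using v
    by (intro order_trans[OF mp_vars_mult] Un_least mp_vars_sum) auto
next
  show "cochain_form (cochain_D \<gamma>) \<in> forms n"
    unfolding cochain_form_D[OF assms] by (intro lie_der_in_forms cochain_form_in_forms assms)
qed

section \<open>The differential in coordinates\<close>

lemma nths_remove: "nths ys (- {j}) = take j ys @ drop (Suc j) ys"
proof (induction ys arbitrary: j)
  case (Cons y ys)
  show ?case
  proof (cases j)
    case 0
    have "{i. Suc i \<in> - {0}} = UNIV" by auto
    then show ?thesis by (simp add: 0 nths_Cons nths_all)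
  next
    case (Suc k)
    have "{i. Suc i \<in> - {Suc k}} = - {k}" by auto
    then show ?thesis by (simp add: Suc nths_Cons Cons.IH)
  qed
qed simp

lemma lie_der_sum:
  "lie_der x c ys = (\<Sum>j<length ys. - (mode_coef x (ys ! j) * c (ys[j := mode_mult x (ys ! j)])))"
proof (induction ys arbitrary: c)
  case (Cons y ys)
  show ?case
    by (simp add: lie_der_Cons Cons.IH contr_apply sum.lessThan_Suc_shift del: sum.lessThan_Suc)
qed simp

text \<open>The Lie derivative along the first argument x gives the pairs containing position 0,
  signed by moving the bracket to the front. The contraction gives the pairs in the tail, where
  exchanging the bracket with x absorbs the minus sign of Cartan's formula.\<close>

lemma ce_sum:
  assumes "alternating c"
  shows "ce c xs = (\<Sum>j<length xs. \<Sum>i<j. (- 1) ^ (i + j) *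
    (mode_coef (xs ! i) (xs ! j) * c (mode_mult (xs ! i) (xs ! j) # nths xs (- {i, j}))))"
  using assms
proof (induction xs arbitrary: c)
  case (Cons x ys)
  have n0: "nths (x # ys) (- {0, Suc j}) = nths ys (- {j})" for j
  proof -
    have "{i. Suc i \<in> - {0, Suc j}} = - {j}" by auto
    then show ?thesis by (simp add: nths_Cons)
  qed
  have n1: "nths (x # ys) (- {Suc i, Suc j}) = x # nths ys (- {i, j})" for i j
  proof -
    have "{k. Suc k \<in> - {Suc i, Suc j}} = - {i, j}" by auto
    then show ?thesis by (simp add: nths_Cons)
  qed
  have mv: "c (ys[j := m]) = (- 1) ^ j * c (m # nths ys (- {j}))" if "j < length ys" for j m
    using alternating_move[OF Cons.prems, of "[]" "take j ys" m "drop (Suc j) ys"] that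
    by (simp add: upd_conv_take_nth_drop nths_remove)
  have sw: "c (m # x # zs) = - contr x c (m # zs)" for m zs
    using alternating_swap[OF Cons.prems, of m x zs] by (simp add: contr_def)
  have A: "lie_der x c ys = (\<Sum>j<length ys. (- 1) ^ Suc j * (mode_coef x (ys ! j) * c (mode_mult x (ys ! j) # nths ys (- {j}))))"
    unfolding lie_der_sum by (intro sum.cong) (simp_all add: mv mult.left_commute)
  have B: "- ce (contr x c) ys = (\<Sum>j<length ys. \<Sum>i<j. (- 1) ^ (Suc i + Suc j) *
      (mode_coef (ys ! i) (ys ! j) * c (mode_mult (ys ! i) (ys ! j) # nths (x # ys) (- {Suc i, Suc j}))))"
    unfolding Cons.IH[OF alternating_contr[OF Cons.prems]] n1 sw by (simp add: sum_negf)
  have "ce c (x # ys) = lie_der x c ys + - ce (contr x c) ys" by (simp add: ce_Cons)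
  also have "\<dots> = (\<Sum>j<length ys. \<Sum>i<Suc j. (- 1) ^ (i + Suc j) *
    (mode_coef ((x # ys) ! i) (ys ! j) * c (mode_mult ((x # ys) ! i) (ys ! j) # nths (x # ys) (- {i, Suc j}))))"
    unfolding A B sum.distrib[symmetric] sum.lessThan_Suc_shift n0[symmetric] by simp
  also have "\<dots> = (\<Sum>j<length (x # ys). \<Sum>i<j. (- 1) ^ (i + j) *
    (mode_coef ((x # ys) ! i) ((x # ys) ! j) * c (mode_mult ((x # ys) ! i) ((x # ys) ! j) # nths (x # ys) (- {i, j}))))"
    by (simp add: sum.lessThan_Suc_shift[of _ "length ys"] del: sum.lessThan_Suc)
  finally show ?case .
qed simp

text \<open>The sum in \<open>poly_op\<close> stops at the actual degree, which is not additive; as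
  f 0 = 0, any larger bound serves as well.\<close>

lemma poly_op_bound:
  assumes "f 0 = 0" "degree P \<le> N"
  shows "poly_op (\<lambda>p. l * p) f P = (\<Sum>k\<le>N. l ^ k * (f (coeff P k) :: mpol))"
proof -
  have "((\<lambda>p. l * p) ^^ k) y = l ^ k * y" for k and y :: mpol
    by (induction k) (simp_all add: mult.assoc)
  then have "poly_op (\<lambda>p. l * p) f P = (\<Sum>k\<le>degree P. l ^ k * f (coeff P k))" by (simp add: poly_op_def)
  also have "\<dots> = (\<Sum>k\<le>N. l ^ k * f (coeff P k))"
    by (rule sum.mono_neutral_left) (use assms in \<open>auto simp: coeff_eq_0\<close>)
  finally show ?thesis .
qed

lemma poly_op_pCons:
  fixes f :: "'a::zero \<Rightarrow> mpol" assumes "f 0 = 0"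
  shows "poly_op (\<lambda>p. l * p) f (pCons a P) = f a + l * poly_op (\<lambda>p. l * p) f P"
proof -
  have "degree (pCons a P) \<le> Suc (degree P)" by (rule degree_pCons_le)
  from poly_op_bound[of f "pCons a P" "Suc (degree P)" l, OF assms this] poly_op_bound[of f P "degree P" l, OF assms order_refl]
  show ?thesis
    by (simp add: sum.atMost_Suc_shift sum_distrib_left mult.assoc del: sum.atMost_Suc)
qed

lemma poly_op_0: fixes f :: "'a::zero \<Rightarrow> mpol" shows "f 0 = 0 \<Longrightarrow> poly_op (\<lambda>p. l * p) f 0 = 0"
  by (simp add: poly_op_def)

lemma poly_op_fun_0: "poly_op (\<lambda>p. l * p) (\<lambda>x. 0 :: mpol) P = 0"
  using poly_op_bound[of "\<lambda>x. 0" P "degree P" l] by simp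

lemma poly_op_add_poly:
  fixes f :: "'a::comm_monoid_add \<Rightarrow> mpol"
  assumes "f 0 = 0" "\<And>x y. f (x + y) = f x + f y"
  shows "poly_op (\<lambda>p. l * p) f (P + Q) = poly_op (\<lambda>p. l * p) f P + poly_op (\<lambda>p. l * p) f Q"
  by (induction P Q rule: poly_induct2) (simp_all add: poly_op_0 poly_op_pCons assms distrib_left add_ac)

lemma poly_op_map_poly:
  fixes f :: "'a::comm_monoid_add \<Rightarrow> mpol"
  assumes "f 0 = 0" "g 0 = 0" "\<And>x. f (g x) = r * f x"
  shows "poly_op (\<lambda>p. l * p) f (map_poly g P) = r * poly_op (\<lambda>p. l * p) f P"
  by (induction P) (simp_all add: poly_op_0 poly_op_pCons map_poly_pCons assms distrib_left mult.left_commute)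

lemma poly_op_uminus:
  fixes f :: "'a::ab_group_add \<Rightarrow> mpol"
  assumes "f 0 = 0" "\<And>x y. f (x + y) = f x + f y"
  shows "poly_op (\<lambda>p. l * p) f (- P) = - poly_op (\<lambda>p. l * p) f P"
  using poly_op_add_poly[of f l P "- P", OF assms] poly_op_0[of f l] assms(1) by (simp add: add_eq_0_iff)

lemma poly_op_fun_add:
  fixes f g :: "'a::comm_monoid_add \<Rightarrow> mpol"
  shows "f 0 = 0 \<Longrightarrow> g 0 = 0 \<Longrightarrow> poly_op (\<lambda>p. l * p) (\<lambda>x. f x + g x) P = poly_op (\<lambda>p. l * p) f P + poly_op (\<lambda>p. l * p) g P"
  by (induction P) (simp_all add: poly_op_0 poly_op_pCons distrib_left add_ac)

lemma poly_op_fun_mult: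
  fixes f :: "'a::comm_monoid_add \<Rightarrow> mpol"
  shows "f 0 = 0 \<Longrightarrow> poly_op (\<lambda>p. l * p) (\<lambda>x. r * f x) P = r * poly_op (\<lambda>p. l * p) f P"
  by (induction P) (simp_all add: poly_op_0 poly_op_pCons distrib_left mult.left_commute)

section \<open>Sesquilinearity of the differential\<close>

lemma cochain_at_sesqui:
  assumes "sesqui n \<gamma>" "length as = n" "m < n"
  shows "cochain_at \<gamma> ps (as[m := x + y]) = cochain_at \<gamma> ps (as[m := x]) + cochain_at \<gamma> ps (as[m := y])"
    and "cochain_at \<gamma> ps (as[m := sv_scl c x]) = mp_const c * cochain_at \<gamma> ps (as[m := x])"
    and "cochain_at \<gamma> ps (as[m := sv_D x]) = - (ps ! m) * cochain_at \<gamma> ps (as[m := x])"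
  using sesquiD(2-4)[OF assms(1-3)]
  by (simp_all add: cochain_at_def mp_subst_add mp_subst_const_mult mp_subst_uminus mp_subst_lam_mult)

lemma cochain_at_Cons:
  assumes "sesqui (Suc n) \<gamma>" "length ys = n"
  shows "cochain_at \<gamma> ps ((x + y) # ys) = cochain_at \<gamma> ps (x # ys) + cochain_at \<gamma> ps (y # ys)"
    and "cochain_at \<gamma> ps (sv_scl c x # ys) = mp_const c * cochain_at \<gamma> ps (x # ys)"
    and "cochain_at \<gamma> ps (sv_D x # ys) = - (ps ! 0) * cochain_at \<gamma> ps (x # ys)"
    and "cochain_at \<gamma> ps (0 # ys) = 0"
proof -
  show a: "cochain_at \<gamma> ps ((x + y) # ys) = cochain_at \<gamma> ps (x # ys) + cochain_at \<gamma> ps (y # ys)" for x y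
    using cochain_at_sesqui(1)[OF assms(1), of "x # ys" 0 ps x y] assms(2) by simp
  show "cochain_at \<gamma> ps (sv_scl c x # ys) = mp_const c * cochain_at \<gamma> ps (x # ys)"
    using cochain_at_sesqui(2)[OF assms(1), of "x # ys" 0 ps c x] assms(2) by simp
  show "cochain_at \<gamma> ps (sv_D x # ys) = - (ps ! 0) * cochain_at \<gamma> ps (x # ys)"
    using cochain_at_sesqui(3)[OF assms(1), of "x # ys" 0 ps x] assms(2) by simp
  show "cochain_at \<gamma> ps (0 # ys) = 0"
    using a[of 0 0] by (simp only: add_0_left add_cancel_right_right)
qed

text \<open>One summand of the differential, with the surviving indices as a list ks instead of a
  complement, so that variables and arguments are both images of ks.\<close>

definition diff_term :: "sv cochain \<Rightarrow> nat \<Rightarrow> nat \<Rightarrow> nat list \<Rightarrow> sv list \<Rightarrow> mpol" where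
  "diff_term \<gamma> i j ks as = poly_op (\<lambda>p. lam i * p)
     (\<lambda>x. cochain_at \<gamma> ((lam i + lam j) # map lam ks) (x # map ((!) as) ks)) (sv_br (as ! i) (as ! j))"

text \<open>For s = i the bracket itself yields -\<lambda>_i. For s = j it yields \<partial> +
  \<lambda>_i, where \<partial> acts as -(\<lambda>_i + \<lambda>_j), leaving -\<lambda>_j. For s in
  ks the cochain is sesquilinear in the slot that carries \<lambda>_s.\<close>

lemma diff_term_sesqui:
  assumes \<gamma>: "sesqui (Suc n) \<gamma>" and len: "length as = Suc (Suc n)" "length ks = n"
    and dist: "distinct (i # j # ks)" and set: "set (i # j # ks) = {..<Suc (Suc n)}" and s: "s < Suc (Suc n)"
  shows "diff_term \<gamma> i j ks (as[s := x + y]) = diff_term \<gamma> i j ks (as[s := x]) + diff_term \<gamma> i j ks (as[s := y])"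
    and "diff_term \<gamma> i j ks (as[s := sv_scl c x]) = mp_const c * diff_term \<gamma> i j ks (as[s := x])"
    and "diff_term \<gamma> i j ks (as[s := sv_D x]) = - lam s * diff_term \<gamma> i j ks (as[s := x])"
proof -
  let ?ps = "(lam i + lam j) # map lam ks"
  have ij: "i < Suc (Suc n)" "j < Suc (Suc n)" "i \<noteq> j" "i \<notin> set ks" "j \<notin> set ks"
  proof -
    have "i \<in> set (i # j # ks)" "j \<in> set (i # j # ks)" by simp_all
    then show "i < Suc (Suc n)" "j < Suc (Suc n)" unfolding set by simp_all
  qed (use dist in auto)
  define F where "F = (\<lambda>ys x. cochain_at \<gamma> ?ps (x # ys))"
  have F: "F ys (x + y) = F ys x + F ys y" "F ys (sv_scl c x) = mp_const c * F ys x"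
    "F ys (sv_D x) = - (lam i + lam j) * F ys x" "F ys 0 = 0" if "length ys = n" for ys x y c
    unfolding F_def using cochain_at_Cons[OF \<gamma> that, of ?ps] by simp_all
  have z: "sv_scl c 0 = 0" "sv_D 0 = 0" for c by (auto simp: sv_scl_def sv_D_def)
  have dt: "diff_term \<gamma> i j ks as = poly_op (\<lambda>p. lam i * p) (F (map ((!) as) ks)) (sv_br (as ! i) (as ! j))" for as
    by (simp add: diff_term_def F_def)
  have "s \<in> set (i # j # ks)" unfolding set using s by simp
  then consider "s = i" | "s = j" | m where "m < n" "s = ks ! m"
    using len(2) by (auto simp: in_set_conv_nth)
  then have "diff_term \<gamma> i j ks (as[s := x + y]) = diff_term \<gamma> i j ks (as[s := x]) + diff_term \<gamma> i j ks (as[s := y]) \<and>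
    diff_term \<gamma> i j ks (as[s := sv_scl c x]) = mp_const c * diff_term \<gamma> i j ks (as[s := x]) \<and>
    diff_term \<gamma> i j ks (as[s := sv_D x]) = - lam s * diff_term \<gamma> i j ks (as[s := x])"
  proof cases
    case 1
    have m: "map ((!) (as[i := v])) ks = map ((!) as) ks" for v
      using ij(4) by (auto intro!: nth_list_update_neq)
    have [simp]: "as[i := v] ! i = v" "as[i := v] ! j = as ! j" for v using ij len by simp_all
    have l: "length (map ((!) as) ks) = n" using len by simp
    show ?thesis unfolding dt 1 m
      by (simp add: sv.br_add_left sv.br_scl_left sv.br_D_left poly_op_add_poly[of "F (map ((!) as) ks)", OF F(4,1)[OF l]]
          poly_op_uminus[of "F (map ((!) as) ks)", OF F(4,1)[OF l]] poly_op_pCons[of "F (map ((!) as) ks)", OF F(4)[OF l]] poly_op_map_poly[of "F (map ((!) as) ks)", OF F(4)[OF l] z(1) F(2)[OF l]] F(4)[OF l])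
  next
    case 2
    have m: "map ((!) (as[j := v])) ks = map ((!) as) ks" for v
      using ij(5) by (auto intro!: nth_list_update_neq)
    have [simp]: "as[j := v] ! j = v" "as[j := v] ! i = as ! i" for v using ij len by simp_all
    have l: "length (map ((!) as) ks) = n" using len by simp
    show ?thesis unfolding dt 2 m
      by (simp add: sv.br_add_right sv.br_scl_right sv.br_D_right poly_op_add_poly[of "F (map ((!) as) ks)", OF F(4,1)[OF l]]
          poly_op_pCons[of "F (map ((!) as) ks)", OF F(4)[OF l]] poly_op_map_poly[of "F (map ((!) as) ks)", OF F(4)[OF l] z(1) F(2)[OF l]]
          poly_op_map_poly[of "F (map ((!) as) ks)", OF F(4)[OF l] z(2) F(3)[OF l]] F(4)[OF l] distrib_right left_diff_distrib)
  next
    case (3 m)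
    have ne: "i \<noteq> s" "j \<noteq> s" using ij 3 len(2) nth_mem by blast+
    have mp: "map ((!) (as[s := v])) ks = (map ((!) as) ks)[m := v]" for v
      using dist 3 len s by (intro nth_equalityI) (auto simp: nth_list_update nth_eq_iff_index_eq)
    have l: "length ((map ((!) as) ks)[m := v]) = n" for v using len by simp
    let ?Y = "\<lambda>v. (map ((!) as) ks)[m := v]"
    have G: "F (?Y (x + y)) = (\<lambda>u. F (?Y x) u + F (?Y y) u)"
      "F (?Y (sv_scl c x)) = (\<lambda>u. mp_const c * F (?Y x) u)"
      "F (?Y (sv_D x)) = (\<lambda>u. - lam s * F (?Y x) u)"
      unfolding F_def using cochain_at_sesqui[OF \<gamma>, of "_ # map ((!) as) ks" "Suc m" ?ps] len 3 by simp_all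
    have nn: "as[s := v] ! i = as ! i" "as[s := v] ! j = as ! j" for v using ne by simp_all
    show ?thesis unfolding dt mp nn G
      by (intro conjI poly_op_fun_add poly_op_fun_mult F(4) l)
  qed
  then show "diff_term \<gamma> i j ks (as[s := x + y]) = diff_term \<gamma> i j ks (as[s := x]) + diff_term \<gamma> i j ks (as[s := y])"
    and "diff_term \<gamma> i j ks (as[s := sv_scl c x]) = mp_const c * diff_term \<gamma> i j ks (as[s := x])"
    and "diff_term \<gamma> i j ks (as[s := sv_D x]) = - lam s * diff_term \<gamma> i j ks (as[s := x])" by blast+
qed

lemma complement_indices:
  assumes "i < j" "j < N"
  defines "ks \<equiv> nths [0..<N] (- {i, j})"
  shows "distinct (i # j # ks)" "set (i # j # ks) = {..<N}" "length ks = N - 2"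
    and "length as = N \<Longrightarrow> nths as (- {i, j}) = map ((!) as) ks"
proof -
  have set: "set ks = {..<N} - {i, j}"
  proof (rule Set.set_eqI)
    fix x show "x \<in> set ks \<longleftrightarrow> x \<in> {..<N} - {i, j}"
      unfolding ks_def set_nths by (auto intro!: exI[of _ x])
  qed
  have d: "distinct ks" unfolding ks_def by simp
  show "distinct (i # j # ks)" using d assms(1) by (simp add: set)
  show "set (i # j # ks) = {..<N}" unfolding list.set set using assms(1,2) by auto
  have "length ks = card ({..<N} - {i, j})" using distinct_card[OF d] set by simp
  then show "length ks = N - 2" using assms(1,2) by (simp add: card_Diff_subset)
  show "length as = N \<Longrightarrow> nths as (- {i, j}) = map ((!) as) ks"
    using nths_map[of "(!) as" "[0..<N]" "- {i, j}"] map_nth[of as] by (simp add: ks_def)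
qed

lemma differential_eq:
  assumes "length as = N"
  shows "sv.differential \<gamma> as = (\<Sum>j<N. \<Sum>i<j. (- 1) ^ (i + j) * diff_term \<gamma> i j (nths [0..<N] (- {i, j})) as)"
  unfolding sv.differential_def diff_term_def assms
  by (intro sum.cong refl) (simp add: complement_indices(4)[OF _ _ assms] nths_map)

lemma sesqui_differential:
  assumes "sesqui n \<gamma>" shows "sesqui (Suc n) (sv.differential \<gamma>)"
proof (cases n)
  \<comment> \<open>A 0-cochain is 0 on nonempty lists, so its differential vanishes.\<close>
  case 0
  have "sv.differential \<gamma> as = 0" for as
  proof -
    have "cochain_at \<gamma> ps (x # ys) = 0" for ps x ys
      using sesquiD(1)[OF assms] by (simp add: 0 cochain_at_def)
    then show ?thesis by (simp add: sv.differential_def poly_op_fun_0)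
  qed
  then show ?thesis by (simp add: sesqui_def)
next
  case (Suc m)
  show ?thesis
    unfolding sesqui_def
  proof (intro conjI allI impI)
    fix as :: "sv list" assume "length as \<noteq> Suc n"
    have "cochain_at \<gamma> ((lam i + lam j) # nths (map lam [0..<length as]) (- {i, j})) (x # nths as (- {i, j})) = 0"
      if "i < j" "j < length as" for i j x
    proof -
      have "length (nths as (- {i, j})) = length as - 2"
        using complement_indices(3)[OF that] complement_indices(4)[OF that, of as] by simp
      then have "length (x # nths as (- {i, j})) \<noteq> n" using \<open>length as \<noteq> Suc n\<close> that by auto
      then show ?thesis using sesquiD(1)[OF assms] by (simp add: cochain_at_def)
    qed
    then show "sv.differential \<gamma> as = 0"
      unfolding sv.differential_def by (intro sum.neutral ballI) (simp add: poly_op_fun_0)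
  next
    fix as :: "sv list" and s x y and c :: complex
    assume as: "length as = Suc n" and s: "s < Suc n"
    have D: "sv.differential \<gamma> (as[s := v]) = (\<Sum>j<Suc n. \<Sum>i<j. (- 1) ^ (i + j) * diff_term \<gamma> i j (nths [0..<Suc n] (- {i, j})) (as[s := v]))" for v
      by (rule differential_eq) (simp add: as)
    have T: "diff_term \<gamma> i j (nths [0..<Suc n] (- {i, j})) (as[s := x + y]) =
        diff_term \<gamma> i j (nths [0..<Suc n] (- {i, j})) (as[s := x]) + diff_term \<gamma> i j (nths [0..<Suc n] (- {i, j})) (as[s := y])"
      "diff_term \<gamma> i j (nths [0..<Suc n] (- {i, j})) (as[s := sv_scl c x]) =
        mp_const c * diff_term \<gamma> i j (nths [0..<Suc n] (- {i, j})) (as[s := x])"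
      "diff_term \<gamma> i j (nths [0..<Suc n] (- {i, j})) (as[s := sv_D x]) =
        - lam s * diff_term \<gamma> i j (nths [0..<Suc n] (- {i, j})) (as[s := x])"
      if "i < j" "j < Suc n" for i j
      using diff_term_sesqui[OF assms[unfolded Suc] as[unfolded Suc] _ complement_indices(1,2)[OF that, unfolded Suc] s[unfolded Suc]]
        complement_indices(3)[OF that] Suc by (simp_all del: upt_Suc)
    show "sv.differential \<gamma> (as[s := x + y]) = sv.differential \<gamma> (as[s := x]) + sv.differential \<gamma> (as[s := y])"
      unfolding D sum.distrib[symmetric] by (intro sum.cong refl) (simp add: T distrib_left del: upt_Suc)
    show "sv.differential \<gamma> (as[s := sv_scl c x]) = mp_const c * sv.differential \<gamma> (as[s := x])"
      unfolding D sum_distrib_left by (intro sum.cong refl) (simp add: T mult.left_commute del: upt_Suc)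
    show "sv.differential \<gamma> (as[s := sv_D x]) = - lam s * sv.differential \<gamma> (as[s := x])"
      unfolding D sum_distrib_left by (intro sum.cong refl) (simp add: T mult.left_commute del: upt_Suc)
  qed
qed

lemma poly_op_gen_br:
  fixes f :: "sv \<Rightarrow> mpol"
  assumes f: "f 0 = 0" "\<And>c x. f (sv_scl c x) = mp_const c * f x" "\<And>x. f (sv_D x) = - (l + l') * f x"
  shows "poly_op (\<lambda>p. l * p) f (sv_gen_br X Y) =
    (mp_const (fst (gen_form X Y)) * l + mp_const (snd (gen_form X Y)) * l') * f (sv_elt (gen_mult X Y))"
proof -
  \<comment> \<open>Writing 3/2 and 2 through 1 and 1/2 lets additive normalization compare
    coefficients.\<close>
  have c: "mp_const (3/2) = 1 + mp_const (1/2)" "mp_const 2 = 1 + 1" "mp_const (- 1) = - 1"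
    by (simp_all add: mp_const_minus flip: mp_const_1 mp_const_add)
  show ?thesis
    by (cases X; cases Y; simp add: poly_op_pCons[of f, OF f(1)] poly_op_0[of f, OF f(1)] f c;
        simp add: mp_const_minus algebra_simps)
qed

text \<open>The sums agree termwise with \<open>ce_sum\<close>. The factor a \<lambda>_i + b
  \<lambda>_j lowers one of the two exponents and yields a e_i + b e_j, which is
  \<open>mode_coef\<close>; the substitution then adds the exponents, giving e_i + e_j - 1 as in
  \<open>mode_mult\<close>.\<close>

lemma cochain_form_differential:
  assumes "sv.is_cochain n \<gamma>"
  shows "cochain_form (sv.differential \<gamma>) = ce (cochain_form \<gamma>)"
proof
  fix xs
  have s: "sesqui n \<gamma>" and v: "\<And>as. length as = n \<Longrightarrow> mp_vars (\<gamma> as) \<subseteq> {..<n}"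
    using assms by (auto simp: is_cochain_iff)
  show "cochain_form (sv.differential \<gamma>) xs = ce (cochain_form \<gamma>) xs"
  proof (cases "length xs = Suc n")
    case False
    then show ?thesis
      using sesquiD(1)[OF sesqui_differential[OF s], of "map (sv_elt \<circ> fst) xs"] ce_in_forms[OF cochain_form_in_forms[OF assms]]
      by (simp add: cochain_form_def forms_def)
  next
    case True
    let ?N = "Suc n" let ?as = "map (sv_elt \<circ> fst) xs" let ?es = "map snd xs"
    have "dcoef (diff_term \<gamma> i j (nths [0..<?N] (- {i, j})) ?as) ?es =
      mode_coef (xs ! i) (xs ! j) * cochain_form \<gamma> (mode_mult (xs ! i) (xs ! j) # nths xs (- {i, j}))"
      if ij: "i < j" "j < ?N" for i j
    proof -
      define ks where "ks = nths [0..<?N] (- {i, j})"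
      note ks = complement_indices[OF ij, folded ks_def]
      obtain m where m: "n = Suc m" using ij by (cases n) auto
      have lk: "length ks = m" using ks(3) m by simp
      let ?Z = "gen_mult (fst (xs ! i)) (fst (xs ! j))"
      let ?p = "\<gamma> (sv_elt ?Z # map ((!) ?as) ks)"
      let ?q = "mp_subst (\<lambda>k. ((lam i + lam j) # map lam ks) ! k) ?p"
      obtain \<alpha> \<beta> where ab: "gen_form (fst (xs ! i)) (fst (xs ! j)) = (\<alpha>, \<beta>)" by fastforce
      have nth: "?as ! i = sv_elt (fst (xs ! i))" "?as ! j = sv_elt (fst (xs ! j))" using ij True by simp_all
      have "diff_term \<gamma> i j ks ?as = (mp_const \<alpha> * lam i + mp_const \<beta> * lam j) * ?q"
        unfolding diff_term_def nth sv_br_gen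
        by (subst poly_op_gen_br[where l' = "lam j"])
          (use cochain_at_Cons[OF s[unfolded m], of "map ((!) ?as) ks"] lk ab in \<open>simp_all add: cochain_at_def left_diff_distrib distrib_right\<close>)
      then have "dcoef (diff_term \<gamma> i j ks ?as) ?es =
        \<alpha> * (of_nat (?es ! i) * dcoef ?q (?es[i := ?es ! i - 1])) + \<beta> * (of_nat (?es ! j) * dcoef ?q (?es[j := ?es ! j - 1]))"
        using ij True by (simp add: distrib_right dcoef_add mult.assoc dcoef_const_mult dcoef_lam)
      also have "\<dots> = (\<alpha> * of_nat (?es ! i) + \<beta> * of_nat (?es ! j)) * dcoef ?p ((?es ! i + ?es ! j - 1) # map ((!) ?es) ks)"
      proof -
        have vp: "mp_vars ?p \<subseteq> {..<Suc (length ks)}" using v[of "sv_elt ?Z # map ((!) ?as) ks"] lk m by simp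
        have q: "dcoef ?q es' = dcoef ?p ((es' ! i + es' ! j) # map ((!) es') ks)" if "length es' = ?N" for es'
          by (rule dcoef_subst_diag[OF ks(1) _ vp]) (simp only: ks(2) that)
        have nk: "i \<notin> set ks" "j \<notin> set ks" "i \<noteq> j" using ks(1) by auto
        have mk: "map ((!) (?es[l := w])) ks = map ((!) ?es) ks" if "l = i \<or> l = j" for l w
          using nk that by (auto intro!: nth_list_update_neq)
        have 1: "of_nat (?es ! i) * dcoef ?q (?es[i := ?es ! i - 1]) =
          of_nat (?es ! i) * dcoef ?p ((?es ! i + ?es ! j - 1) # map ((!) ?es) ks)"
          using True ij nk by (cases "?es ! i") (simp_all add: q mk del: nth_map)
        have 2: "of_nat (?es ! j) * dcoef ?q (?es[j := ?es ! j - 1]) =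
          of_nat (?es ! j) * dcoef ?p ((?es ! i + ?es ! j - 1) # map ((!) ?es) ks)"
          using True ij nk by (cases "?es ! j") (simp_all add: q mk del: nth_map)
        show ?thesis unfolding 1 2 by (simp add: distrib_right mult.assoc)
      qed
      also have "\<dots> = mode_coef (xs ! i) (xs ! j) * cochain_form \<gamma> (mode_mult (xs ! i) (xs ! j) # nths xs (- {i, j}))"
      proof -
        have n: "nths xs (- {i, j}) = map ((!) xs) ks" using ks(4)[of xs] True by simp
        have lt: "k < length xs" if "k \<in> set ks" for k
        proof -
          from that have "k \<in> set (i # j # ks)" by simp
          then show ?thesis unfolding ks(2) using True by simp
        qed
        have e1: "map ((!) ?as) ks = map (\<lambda>k. sv_elt (fst (xs ! k))) ks" by (rule map_cong) (simp_all add: lt)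
        have e2: "map ((!) ?es) ks = map (\<lambda>k. snd (xs ! k)) ks" by (rule map_cong) (simp_all add: lt)
        show ?thesis unfolding e1 e2 n cochain_form_def
          using ij True ab by (simp add: mode_coef_def mode_mult_def comp_def)
      qed
      finally show ?thesis unfolding ks_def .
    qed
    moreover have "dcoef ((- 1) ^ k * p) es = (- 1) ^ k * dcoef p es" for k p es
      by (cases "even k") (simp_all add: dcoef_uminus)
    ultimately show ?thesis
      using True unfolding ce_sum[OF alternating_cochain_form[OF assms]]
      by (simp add: cochain_form_def[of "sv.differential \<gamma>"] differential_eq[of _ ?N] dcoef_sum del: sum.lessThan_Suc upt_Suc)
  qed
qed

lemma mp_vars_poly_op: 
  assumes "f 0 = 0" "mp_vars l \<subseteq> M" "\<And>x. mp_vars (f x) \<subseteq> M"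
  shows "mp_vars (poly_op (\<lambda>p. l * p) f P) \<subseteq> M"
  unfolding poly_op_bound[of f P "degree P" l, OF assms(1) order_refl]
  by (intro mp_vars_sum order_trans[OF mp_vars_mult] Un_least order_trans[OF mp_vars_power] assms)

lemma differential_is_cochain:
  assumes "sv.is_cochain n \<gamma>" shows "sv.is_cochain (Suc n) (sv.differential \<gamma>)"
proof (rule is_cochainI)
  have s: "sesqui n \<gamma>" and v: "\<And>as. length as = n \<Longrightarrow> mp_vars (\<gamma> as) \<subseteq> {..<n}"
    using assms by (auto simp: is_cochain_iff)
  show "sesqui (Suc n) (sv.differential \<gamma>)" by (rule sesqui_differential[OF s])
  show "cochain_form (sv.differential \<gamma>) \<in> forms (Suc n)"
    unfolding cochain_form_differential[OF assms] by (intro ce_in_forms cochain_form_in_forms assms)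
  fix Xs :: "sv_gen list" assume len: "length Xs = Suc n"
  have T: "mp_vars ((- 1) ^ (i + j) * diff_term \<gamma> i j (nths [0..<Suc n] (- {i, j})) (map sv_elt Xs)) \<subseteq> {..<Suc n}"
    if ij: "i < j" "j < Suc n" for i j
  proof -
    define ks where "ks = nths [0..<Suc n] (- {i, j})"
    note ks = complement_indices[OF ij, folded ks_def]
    obtain m where m: "n = Suc m" using ij by (cases n) auto
    have lk: "length ks = m" using ks(3) m by simp
    have "mp_vars (((lam i + lam j) # map lam ks) ! k) \<subseteq> {..<Suc n}" if "k < n" for k
    proof (cases k)
      case 0
      then show ?thesis using ij mp_vars_add[of "lam i" "lam j"] by auto
    next
      case (Suc l)
      then have "l < length ks" using that lk m by simp
      moreover from nth_mem[OF this] have "ks ! l < Suc n" using ks(2) by auto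
      ultimately show ?thesis using Suc by simp
    qed
    then have "mp_vars (cochain_at \<gamma> ((lam i + lam j) # map lam ks) (x # map ((!) (map sv_elt Xs)) ks)) \<subseteq> {..<Suc n}" for x
      unfolding cochain_at_def using v[of "x # map ((!) (map sv_elt Xs)) ks"] lk m
      by (intro mp_vars_subst) auto
    then have "mp_vars (diff_term \<gamma> i j ks (map sv_elt Xs)) \<subseteq> {..<Suc n}"
      unfolding diff_term_def using cochain_at_Cons(4)[OF s[unfolded m]] lk ij
      by (intro mp_vars_poly_op) auto
    moreover have "mp_vars ((- 1) ^ k * p) = mp_vars p" for k p by (cases "even k") simp_all
    ultimately show ?thesis unfolding ks_def by simp
  qed
  have "length (map sv_elt Xs) = Suc n" using len by simp
  from differential_eq[OF this] show "mp_vars (sv.differential \<gamma> (map sv_elt Xs)) \<subseteq> {..<Suc n}"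
    by (simp only:) (intro mp_vars_sum T, simp_all only: lessThan_iff)
qed

section \<open>The reduced cohomology groups\<close>

abbreviation cscl :: "complex \<Rightarrow> sv cochain \<Rightarrow> sv cochain" where
  "cscl c \<gamma> \<equiv> (\<lambda>as. mp_const c * \<gamma> as)"

definition cochain_set :: "nat \<Rightarrow> sv cochain set" where
  "cochain_set n = {\<gamma>. sv.is_cochain n \<gamma>}"

lemma cochain_form_cochain_set: "\<gamma> \<in> cochain_set n \<Longrightarrow> cochain_form \<gamma> \<in> forms n"
  by (simp add: cochain_set_def cochain_form_in_forms)

lemma cochain_set_surj: "c \<in> forms n \<Longrightarrow> \<exists>\<gamma>\<in>cochain_set n. cochain_form \<gamma> = c"
  using form_cochain_is_cochain cochain_form_form_cochain unfolding cochain_set_def by blast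

lemma cochain_set_inj:
  "\<gamma> \<in> cochain_set n \<Longrightarrow> \<delta> \<in> cochain_set n \<Longrightarrow> cochain_form \<gamma> = cochain_form \<delta> \<Longrightarrow> \<gamma> = \<delta>"
  by (auto simp: cochain_set_def intro: cochain_form_inj)

lemma cochain_set_add: assumes "\<gamma> \<in> cochain_set n" "\<delta> \<in> cochain_set n" shows "\<gamma> + \<delta> \<in> cochain_set n"
  unfolding cochain_set_def mem_Collect_eq
proof (rule is_cochainI)
  show "sesqui n (\<gamma> + \<delta>)" using assms unfolding cochain_set_def is_cochain_iff sesqui_def by (simp add: algebra_simps)
  show "cochain_form (\<gamma> + \<delta>) \<in> forms n"
    unfolding cochain_form_add by (intro forms_add cochain_form_cochain_set assms)
  fix Xs :: "sv_gen list" assume "length Xs = n"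
  then have "mp_vars (\<gamma> (map sv_elt Xs)) \<subseteq> {..<n}" "mp_vars (\<delta> (map sv_elt Xs)) \<subseteq> {..<n}"
    using assms by (simp_all add: cochain_set_def is_cochain_iff)
  then show "mp_vars ((\<gamma> + \<delta>) (map sv_elt Xs)) \<subseteq> {..<n}"
    using mp_vars_add[of "\<gamma> (map sv_elt Xs)" "\<delta> (map sv_elt Xs)"] by simp blast
qed

lemma cochain_set_scale: assumes "\<gamma> \<in> cochain_set n" shows "cscl c \<gamma> \<in> cochain_set n"
  unfolding cochain_set_def mem_Collect_eq
proof (rule is_cochainI)
  show "sesqui n (cscl c \<gamma>)" using assms unfolding cochain_set_def is_cochain_iff sesqui_def by (simp add: algebra_simps)
  show "cochain_form (cscl c \<gamma>) \<in> forms n"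
    unfolding cochain_form_scale by (intro forms_scale cochain_form_cochain_set assms)
  fix Xs :: "sv_gen list" assume "length Xs = n"
  then have "mp_vars (\<gamma> (map sv_elt Xs)) \<subseteq> {..<n}"
    using assms by (simp add: cochain_set_def is_cochain_iff)
  then show "mp_vars (cscl c \<gamma> (map sv_elt Xs)) \<subseteq> {..<n}"
    using mp_vars_mult[of "mp_const c" "\<gamma> (map sv_elt Xs)"] by simp
qed

lemma cochain_form_0 [simp]: "cochain_form 0 = 0"
  by (simp add: cochain_form_def fun_eq_iff)

lemma cochain_form_uminus: "cochain_form (- \<gamma>) = - cochain_form \<gamma>"
  by (simp add: cochain_form_def fun_eq_iff dcoef_uminus)

lemma cochain_form_diff: "cochain_form (\<gamma> - \<delta>) = cochain_form \<gamma> - cochain_form \<delta>"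
  using cochain_form_add[of \<gamma> "- \<delta>"] by (simp add: cochain_form_uminus)

lemma cochain_set_0: "0 \<in> cochain_set n"
  using cochain_set_scale[of _ n 0] cochain_set_surj[OF forms_zero, of n] by (auto simp: zero_fun_def)

lemma cochain_set_uminus: "\<gamma> \<in> cochain_set n \<Longrightarrow> - \<gamma> \<in> cochain_set n"
  using cochain_set_scale[of \<gamma> n "- 1"] by (simp add: mp_const_minus fun_Compl_def)

lemma cochain_set_diff: "\<gamma> \<in> cochain_set n \<Longrightarrow> \<delta> \<in> cochain_set n \<Longrightarrow> \<gamma> - \<delta> \<in> cochain_set n"
  using cochain_set_add[of \<gamma> n "- \<delta>"] cochain_set_uminus by simp

lemma cochain_set_differential: "\<gamma> \<in> cochain_set n \<Longrightarrow> sv.differential \<gamma> \<in> cochain_set (Suc n)"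
  by (simp add: cochain_set_def differential_is_cochain)

lemma form_differential: "\<gamma> \<in> cochain_set n \<Longrightarrow> cochain_form (sv.differential \<gamma>) = ce (cochain_form \<gamma>)"
  by (simp add: cochain_set_def cochain_form_differential)

lemma form_D: "\<gamma> \<in> cochain_set n \<Longrightarrow> cochain_form (cochain_D \<gamma>) = trans_der (cochain_form \<gamma>)"
  by (simp add: cochain_set_def cochain_form_D)

text \<open>Checked on forms, where \<open>ce\<close> is linear, rather than on the double
  sum.\<close>

lemma differential_add:
  assumes "\<gamma> \<in> cochain_set n" "\<delta> \<in> cochain_set n"
  shows "sv.differential (\<gamma> + \<delta>) = sv.differential \<gamma> + sv.differential \<delta>"
  by (rule cochain_set_inj[of _ "Suc n"])
    (use assms form_differential[OF cochain_set_add[OF assms]] in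
      \<open>simp_all add: cochain_set_differential cochain_set_add form_differential cochain_form_add ce_add\<close>)

lemma D_cochains_iff: "\<gamma> \<in> sv.D_cochains n \<longleftrightarrow> \<gamma> \<in> cochain_set n \<and> (\<exists>b\<in>forms n. cochain_form \<gamma> = trans_der b)"
proof
  assume "\<gamma> \<in> sv.D_cochains n"
  then obtain \<delta> where "\<delta> \<in> cochain_set n" "\<gamma> = cochain_D \<delta>"
    by (auto simp: sv.D_cochains_def sv.cochains_def cochain_set_def)
  then show "\<gamma> \<in> cochain_set n \<and> (\<exists>b\<in>forms n. cochain_form \<gamma> = trans_der b)"
    using cochain_D_is_cochain form_D cochain_form_cochain_set by (auto simp: cochain_set_def)
next
  assume "\<gamma> \<in> cochain_set n \<and> (\<exists>b\<in>forms n. cochain_form \<gamma> = trans_der b)"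
  then obtain b \<delta> where "\<gamma> \<in> cochain_set n" "cochain_form \<gamma> = trans_der b" "\<delta> \<in> cochain_set n" "cochain_form \<delta> = b"
    using cochain_set_surj by blast
  moreover from this have "\<gamma> = cochain_D \<delta>"
    by (intro cochain_set_inj[of _ n]) (simp_all add: form_D, simp add: cochain_set_def cochain_D_is_cochain)
  ultimately show "\<gamma> \<in> sv.D_cochains n" by (auto simp: sv.D_cochains_def sv.cochains_def cochain_set_def)
qed

lemma D_cochains_subset: "sv.D_cochains n \<subseteq> cochain_set n"
  and D_cochains_0: "0 \<in> sv.D_cochains n"
  and D_cochains_add: "\<gamma> \<in> sv.D_cochains n \<Longrightarrow> \<delta> \<in> sv.D_cochains n \<Longrightarrow> \<gamma> + \<delta> \<in> sv.D_cochains n"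
  and D_cochains_scale: "\<gamma> \<in> sv.D_cochains n \<Longrightarrow> cscl c \<gamma> \<in> sv.D_cochains n"
  and D_cochains_uminus: "\<gamma> \<in> sv.D_cochains n \<Longrightarrow> - \<gamma> \<in> sv.D_cochains n"
proof -
  show "sv.D_cochains n \<subseteq> cochain_set n" by (auto simp: D_cochains_iff)
  show "0 \<in> sv.D_cochains n"
    by (auto simp: D_cochains_iff cochain_set_0 lie_der_0 intro!: bexI[of _ 0] forms_zero)
  show "\<gamma> + \<delta> \<in> sv.D_cochains n" if "\<gamma> \<in> sv.D_cochains n" "\<delta> \<in> sv.D_cochains n"
    using that unfolding D_cochains_iff cochain_form_add by (metis cochain_set_add forms_add lie_der_add)
  show scl: "cscl c \<gamma> \<in> sv.D_cochains n" if "\<gamma> \<in> sv.D_cochains n" for c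
  proof -
    from that obtain b where "\<gamma> \<in> cochain_set n" "b \<in> forms n" "cochain_form \<gamma> = trans_der b"
      by (auto simp: D_cochains_iff)
    then show ?thesis
      by (auto simp: D_cochains_iff cochain_set_scale cochain_form_scale lie_der_scale
          intro!: bexI[of _ "\<lambda>xs. c * b xs"] forms_scale)
  qed
  show "- \<gamma> \<in> sv.D_cochains n" if "\<gamma> \<in> sv.D_cochains n"
    using scl[OF that, of "- 1"] by (simp add: mp_const_minus fun_Compl_def)
qed

section \<open>The reduced complex as a quotient of sets of cochains\<close>

lemma presented_cochains: "presented_module cscl (cochain_set n) (sv.cochains n) (\<lambda>x. x)"
  by standard
    (auto simp: cochain_set_0 cochain_set_add cochain_set_scale sv.cochains_def distrib_left, auto simp: cochain_set_def)

definition red_class :: "nat \<Rightarrow> sv cochain \<Rightarrow> sv cochain set" where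
  "red_class n z = (\<lambda>b. b + z) ` sv.D_cochains n"

lemma red_class_eq: "red_class n = presented_module.coset_of (\<lambda>x. x) (sv.D_cochains n)"
  by (rule ext) (simp add: red_class_def presented_module.coset_of_def[OF presented_cochains])

lemma presented_reduced: "presented_module cscl (cochain_set n) (sv.reduced_cochains n) (red_class n)"
  using presented_module.presented_module_quot[OF presented_cochains D_cochains_subset D_cochains_0
      D_cochains_add D_cochains_scale, of n]
  by (simp add: sv.reduced_cochains_def red_class_eq)

lemma red_class_eq_iff:
  "x \<in> cochain_set n \<Longrightarrow> y \<in> cochain_set n \<Longrightarrow> red_class n x = red_class n y \<longleftrightarrow> x - y \<in> sv.D_cochains n"
  unfolding red_class_eq
  by (rule presented_module.coset_of_eq_iff[OF presented_cochains D_cochains_subset D_cochains_0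
      D_cochains_add D_cochains_scale]) (auto simp: D_cochains_0 D_cochains_uminus)

lemma a_r_coset_red_class: "z \<in> cochain_set n \<Longrightarrow> sv.D_cochains n +>\<^bsub>sv.cochains n\<^esub> z = red_class n z"
  using presented_module.coset_of_eq[OF presented_cochains D_cochains_subset D_cochains_0
      D_cochains_add D_cochains_scale, of n] by (simp add: red_class_eq)

lemma differential_D_cochains:
  assumes "b \<in> sv.D_cochains n" shows "sv.differential b \<in> sv.D_cochains (Suc n)"
proof -
  from assms obtain c where "b \<in> cochain_set n" "c \<in> forms n" "cochain_form b = trans_der c" by (auto simp: D_cochains_iff)
  then show ?thesis
    by (auto simp: D_cochains_iff cochain_set_differential form_differential trans_der_ce[symmetric] intro!: bexI[of _ "ce c"] ce_in_forms)
qed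

lemma reduced_differential_class:
  assumes "z \<in> cochain_set n"
  shows "sv.reduced_differential n (red_class n z) = red_class (Suc n) (sv.differential z)"
proof -
  have "sv.D_cochains (Suc n) +>\<^bsub>sv.cochains (Suc n)\<^esub> sv.differential (b + z) = red_class (Suc n) (sv.differential z)"
    if b: "b \<in> sv.D_cochains n" for b
  proof -
    have bc: "b \<in> cochain_set n" using b D_cochains_subset by blast
    have "red_class (Suc n) (sv.differential b + sv.differential z) = red_class (Suc n) (sv.differential z)"
      by (subst red_class_eq_iff)
        (use bc assms differential_D_cochains[OF b] in \<open>simp_all add: cochain_set_add cochain_set_differential\<close>)
    then show ?thesis using bc assms
      by (simp add: a_r_coset_red_class cochain_set_add cochain_set_differential differential_add)
  qed
  then show ?thesis
    unfolding sv.reduced_differential_def red_class_def[of n] using D_cochains_0[of n] by auto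
qed

definition cocycle_set :: "nat \<Rightarrow> sv cochain set" where
  "cocycle_set n = {\<gamma> \<in> cochain_set n. cochain_form \<gamma> \<in> red_cocycles n}"

definition coboundary_set :: "nat \<Rightarrow> sv cochain set" where
  "coboundary_set n = {\<gamma> \<in> cochain_set n. cochain_form \<gamma> \<in> red_coboundaries n}"

lemma reduced_cocycles_eq: "sv.reduced_cocycles n = red_class n ` cocycle_set n"
proof -
  interpret R: presented_module cscl "cochain_set n" "sv.reduced_cochains n" "red_class n" by (rule presented_reduced)
  interpret R': presented_module cscl "cochain_set (Suc n)" "sv.reduced_cochains (Suc n)" "red_class (Suc n)" by (rule presented_reduced)
  have "sv.reduced_differential n (red_class n z) = \<zero>\<^bsub>sv.reduced_cochains (Suc n)\<^esub> \<longleftrightarrow> z \<in> cocycle_set n"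
    if z: "z \<in> cochain_set n" for z
  proof -
    have "sv.reduced_differential n (red_class n z) = \<zero>\<^bsub>sv.reduced_cochains (Suc n)\<^esub> \<longleftrightarrow> sv.differential z \<in> sv.D_cochains (Suc n)"
      unfolding reduced_differential_class[OF z] R'.P_0
      by (subst red_class_eq_iff) (use z in \<open>simp_all add: cochain_set_0 cochain_set_differential\<close>)
    also have "\<dots> \<longleftrightarrow> z \<in> cocycle_set n"
      using z cochain_form_cochain_set[OF z]
      by (auto simp: cocycle_set_def red_cocycles_def D_cochains_iff cochain_set_differential form_differential)
    finally show ?thesis .
  qed
  then show ?thesis
    unfolding sv.reduced_cocycles_def R.carrier_eq by (auto simp: cocycle_set_def)
qed

text \<open>The kernel of the first quotient lies in what the second divides out, as
  \<open>coset_of_eq_iff\<close> demands.\<close>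

lemma D_cochains_coboundary: "sv.D_cochains n \<subseteq> coboundary_set n"
proof (cases n)
  case 0
  then show ?thesis by (auto simp: coboundary_set_def D_cochains_iff trans_der_degree_0)
next
  case (Suc p)
  have "trans_der b \<in> red_coboundaries n" if "b \<in> forms n" for b
  proof -
    have "trans_der b = ce 0 + trans_der b" by (simp add: ce_0)
    then show ?thesis using that forms_zero[of p] unfolding Suc red_coboundaries.simps by blast
  qed
  then show ?thesis by (auto simp: coboundary_set_def D_cochains_iff)
qed

text \<open>A representative d a + \<partial> b differs from d a by an element that is already 0 in
  the reduced complex.\<close>

lemma reduced_coboundaries_eq: "sv.reduced_coboundaries n = red_class n ` coboundary_set n"
proof (cases n)
  case 0
  have "coboundary_set 0 = {0}"
    using cochain_set_inj[of _ 0 0] cochain_set_0[of 0] by (auto simp: coboundary_set_def)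
  then show ?thesis using presented_module.P_0[OF presented_reduced, of 0] by (simp add: 0)
next
  case (Suc p)
  interpret R: presented_module cscl "cochain_set p" "sv.reduced_cochains p" "red_class p" by (rule presented_reduced)
  have "sv.reduced_coboundaries n = red_class n ` sv.differential ` cochain_set p"
    using reduced_differential_class[of _ p] by (auto simp: Suc R.carrier_eq image_iff)
  also have "\<dots> = red_class n ` coboundary_set n"
  proof (intro equalityI subsetI)
    fix X assume "X \<in> red_class n ` sv.differential ` cochain_set p"
    then obtain z where z: "z \<in> cochain_set p" "X = red_class n (sv.differential z)" by auto
    have "ce (cochain_form z) = ce (cochain_form z) + trans_der 0" by (simp add: lie_der_0)
    then have "cochain_form (sv.differential z) \<in> red_coboundaries n"
      using cochain_form_cochain_set[OF z(1)] forms_zero unfolding form_differential[OF z(1)] Suc red_coboundaries.simps by blast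
    then show "X \<in> red_class n ` coboundary_set n"
      using z cochain_set_differential Suc by (auto simp: coboundary_set_def)
  next
    fix X assume "X \<in> red_class n ` coboundary_set n"
    then obtain g a b where g: "g \<in> cochain_set n" "X = red_class n g" "a \<in> forms p" "b \<in> forms n" "cochain_form g = ce a + trans_der b"
      by (auto simp: coboundary_set_def Suc)
    obtain z where z: "z \<in> cochain_set p" "cochain_form z = a" using cochain_set_surj g(3) by blast
    have dz: "sv.differential z \<in> cochain_set n" using cochain_set_differential[OF z(1)] Suc by simp
    have "g - sv.differential z \<in> sv.D_cochains n"
      using g z dz by (auto simp: D_cochains_iff cochain_set_diff cochain_form_diff form_differential intro!: bexI[of _ b])
    then have "X = red_class n (sv.differential z)" using red_class_eq_iff[OF g(1) dz] g(2) by simp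
    then show "X \<in> red_class n ` sv.differential ` cochain_set p" using z(1) by blast
  qed
  finally show ?thesis .
qed

lemma red_cocycles_closed:
  "0 \<in> red_cocycles n" "c \<in> red_cocycles n \<Longrightarrow> e \<in> red_cocycles n \<Longrightarrow> c + e \<in> red_cocycles n"
  "c \<in> red_cocycles n \<Longrightarrow> (\<lambda>xs. r * c xs) \<in> red_cocycles n"
proof -
  show "0 \<in> red_cocycles n"
    by (auto simp: red_cocycles_def forms_zero ce_0 lie_der_0 intro!: bexI[of _ 0])
  show "c \<in> red_cocycles n \<Longrightarrow> e \<in> red_cocycles n \<Longrightarrow> c + e \<in> red_cocycles n"
    using lincomb2_red_cocycles(1)[of c n e 1 1] by (simp add: lincomb2_def plus_fun_def)
  show "c \<in> red_cocycles n \<Longrightarrow> (\<lambda>xs. r * c xs) \<in> red_cocycles n"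
    using lincomb2_red_cocycles(1)[of c n c r 0] by (simp add: lincomb2_def)
qed

lemma red_coord_add: "c \<in> red_cocycles n \<Longrightarrow> e \<in> red_cocycles n \<Longrightarrow> red_coord n (c + e) i = red_coord n c i + red_coord n e i"
  using red_coord_lincomb2[of c n e 1 1 i] by (simp add: lincomb2_def plus_fun_def)

lemma red_coord_scale: "c \<in> red_cocycles n \<Longrightarrow> red_coord n (\<lambda>xs. r * c xs) i = r * red_coord n c i"
  using red_coord_lincomb2[of c n c r 0 i] by (simp add: lincomb2_def)

lemma red_coord_diff: "c \<in> red_cocycles n \<Longrightarrow> e \<in> red_cocycles n \<Longrightarrow> red_coord n (c - e) i = red_coord n c i - red_coord n e i"
  using red_coord_lincomb2[of c n e 1 "-1" i] by (simp add: lincomb2_def fun_diff_def)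

lemma red_cocycles_diff: "c \<in> red_cocycles n \<Longrightarrow> e \<in> red_cocycles n \<Longrightarrow> c - e \<in> red_cocycles n"
  using lincomb2_red_cocycles(1)[of c n e 1 "-1"] by (simp add: lincomb2_def fun_diff_def)

text \<open>By \<open>red_coord_kernel\<close> this set is the common kernel of linear coordinates
  on the reduced cocycles.\<close>

lemma red_coboundaries_closed:
  assumes "c \<in> red_coboundaries n"
  shows "e \<in> red_coboundaries n \<Longrightarrow> c + e \<in> red_coboundaries n" "(\<lambda>xs. r * c xs) \<in> red_coboundaries n"
proof -
  have c: "c \<in> red_cocycles n" using assms red_coboundaries_sub by blast
  show "c + e \<in> red_coboundaries n" if "e \<in> red_coboundaries n"
  proof -
    have e: "e \<in> red_cocycles n" using that red_coboundaries_sub by blast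
    show ?thesis
      using red_coord_kernel[OF c] red_coord_kernel[OF e] red_coord_kernel[OF red_cocycles_closed(2)[OF c e]] assms that
      by (simp add: red_coord_add[OF c e])
  qed
  show "(\<lambda>xs. r * c xs) \<in> red_coboundaries n"
    using red_coord_kernel[OF c] red_coord_kernel[OF red_cocycles_closed(3)[OF c, of r]] assms
    by (simp add: red_coord_scale[OF c])
qed

lemma red_dim_eq:
  "red_dim q = (if q \<in> {0, 2, 3} then 1 else if q \<in> {4, 6} then 2 else if q = 5 then 4 else 0)"
proof -
  consider "q = 0" | "q = 1" | "q = 2" | "q = 3" | "q = 4" | "q = 5" | "q = 6" | "q \<ge> 7" by linarith
  then show ?thesis by cases (simp_all add: red_dim_def betti_def)
qed

theorem theorem4p1:
  fixes q :: nat
  shows "vectorspace class_ring (sv.reduced_cohomology q) \<and>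
    vectorspace.fin_dim class_ring (sv.reduced_cohomology q) \<and>
    vectorspace.dim class_ring (sv.reduced_cohomology q) =
      (if q \<in> {0, 2, 3} then 1
       else if q \<in> {4, 6} then 2
       else if q = 5 then 4
       else 0)"
proof -
  interpret R: presented_module cscl "cochain_set q" "sv.reduced_cochains q" "red_class q"
    by (rule presented_reduced)
  note memZ = cocycle_set_def and memB = coboundary_set_def
  interpret Z: presented_module cscl "cocycle_set q"
    "(sv.reduced_cochains q)\<lparr>carrier := red_class q ` cocycle_set q\<rparr>" "red_class q"
    by (rule R.presented_submodule)
      (auto simp: memZ cochain_set_0 cochain_set_add cochain_set_scale cochain_form_add cochain_form_scale
        red_cocycles_closed)
  have BZ: "coboundary_set q \<subseteq> cocycle_set q" using red_coboundaries_sub by (auto simp: memZ memB)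
  have B0: "0 \<in> coboundary_set q" using D_cochains_0 D_cochains_coboundary by blast
  have Badd: "x \<in> coboundary_set q \<Longrightarrow> y \<in> coboundary_set q \<Longrightarrow> x + y \<in> coboundary_set q" for x y
    by (auto simp: memB cochain_set_add cochain_form_add red_coboundaries_closed)
  have Bscl: "x \<in> coboundary_set q \<Longrightarrow> cscl c x \<in> coboundary_set q" for x c
    by (auto simp: memB cochain_set_scale cochain_form_scale red_coboundaries_closed)
  have Bneg: "x \<in> coboundary_set q \<Longrightarrow> - x \<in> coboundary_set q" for x
    using Bscl[of x "- 1"] by (simp add: mp_const_minus fun_Compl_def)
  let ?\<pi> = "Z.coset_of (coboundary_set q)"
  \<comment> \<open>The second quotient: cosets of classes modulo \<partial>, still named by plain
    cochains.\<close>
  interpret H: presented_module cscl "cocycle_set q" "sv.reduced_cohomology q" ?\<pi>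
    using Z.presented_module_quot[OF BZ B0 Badd Bscl]
    by (simp add: sv.reduced_cohomology_def reduced_cocycles_eq reduced_coboundaries_eq)
  have "vectorspace class_ring (sv.reduced_cohomology q) \<and>
    vectorspace.fin_dim class_ring (sv.reduced_cohomology q) \<and>
    vectorspace.dim class_ring (sv.reduced_cohomology q) = red_dim q"
  proof (rule H.dim_by_coordinates[where f = "\<lambda>\<gamma>. red_coord q (cochain_form \<gamma>)"])
    fix x y assume xy: "x \<in> cocycle_set q" "y \<in> cocycle_set q"
    then have x: "x \<in> cochain_set q" "cochain_form x \<in> red_cocycles q"
      and y: "y \<in> cochain_set q" "cochain_form y \<in> red_cocycles q" by (auto simp: memZ)
    show "red_coord q (cochain_form (x + y)) i = red_coord q (cochain_form x) i + red_coord q (cochain_form y) i" for i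
      unfolding cochain_form_add by (rule red_coord_add[OF x(2) y(2)])
    have "?\<pi> x = ?\<pi> y \<longleftrightarrow> x - y \<in> coboundary_set q"
    proof (rule Z.coset_of_eq_iff[OF BZ B0 Badd Bscl xy _ Bneg])
      fix u v assume "u \<in> cocycle_set q" "v \<in> cocycle_set q" "red_class q u = red_class q v"
      then show "u - v \<in> coboundary_set q" using red_class_eq_iff[of u q v] D_cochains_coboundary by (auto simp: memZ)
    qed
    also have "\<dots> \<longleftrightarrow> cochain_form x - cochain_form y \<in> red_coboundaries q"
      using cochain_set_diff[OF x(1) y(1)] by (simp add: memB cochain_form_diff)
    also have "\<dots> \<longleftrightarrow> (\<forall>i<red_dim q. red_coord q (cochain_form x) i = red_coord q (cochain_form y) i)"
      using red_coord_kernel[OF red_cocycles_diff[OF x(2) y(2)]] by (simp add: red_coord_diff[OF x(2) y(2)])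
    finally show "?\<pi> x = ?\<pi> y \<longleftrightarrow> (\<forall>i<red_dim q. red_coord q (cochain_form x) i = red_coord q (cochain_form y) i)" .
  next
    fix c x i assume "x \<in> cocycle_set q"
    then show "red_coord q (cochain_form (cscl c x)) i = c * red_coord q (cochain_form x) i"
      unfolding cochain_form_scale by (intro red_coord_scale) (simp add: memZ)
  next
    fix v
    obtain c where c: "c \<in> red_cocycles q" "\<forall>i<red_dim q. red_coord q c i = v i" using red_coord_surj by blast
    moreover have "c \<in> forms q" using c(1) by (simp add: red_cocycles_def)
    then obtain z where "z \<in> cochain_set q" "cochain_form z = c" using cochain_set_surj by blast
    ultimately show "\<exists>z\<in>cocycle_set q. \<forall>i<red_dim q. red_coord q (cochain_form z) i = v i"
      by (intro bexI[of _ z]) (auto simp: memZ)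
  qed
  then show ?thesis unfolding red_dim_eq .
qed

end
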